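(* For $p,q,r\in\mathbb{N}$, $$\begin{aligned}&\zeta_2((p,s,q,r);PSp(2))+(-1)^p\zeta_2((p,q,s,r);PSp(2))\\ &\quad+(-1)^{p+q}\zeta_2((r,q,s,p);PSp(2))+(-1)^{p+q+r}\zeta_2((r,s,q,p);PSp(2))\\ &+\sum_{\xi=0}^{p}\sum_{\omega=0}^{p-\xi}\binom{\omega+r-1}{\omega}\binom{p+q-1-\xi-\omega}{q-1}\frac{(-1)^{p-\xi}}{2^{r+\omega}}\frac{(2\pi i)^\xi}{\xi!}\zeta(s+p+q+r-\xi)\frac{B_\xi(0)-B_\xi(1/2)}{2}\\ &+\sum_{\xi=0}^{q}\sum_{\omega=0}^{q-\xi}\binom{\omega+r-1}{\omega}\binom{p+q-1-\xi-\omega}{p-1}(-1)^{p-\omega}\frac{(2\pi i)^\xi}{\xi!}\zeta(s+p+q+r-\xi)\frac{B_\xi(0)-(2^{1-s-p-q-r+\xi}-1)B_\xi(1/2)}{2}\\ &+\sum_{\xi=0}^{r}\sum_{\omega=0}^{p-1}\binom{\omega+r-\xi}{\omega}\binom{p+q-2-\omega}{q-1}\frac{(-1)^{p}}{2^{r-\xi+\omega+1}}\frac{(2\pi i)^\xi}{\xi!}\zeta(s+p+q+r-\xi)\frac{B_\xi(0)-B_\xi(1/2)}{2}\\ &+\sum_{\xi=0}^{r}\sum_{\omega=0}^{q-1}\binom{\omega+r-\xi}{\omega}\binom{p+q-2-\omega}{p-1}(-1)^{p-\omega+1}\frac{(2\pi i)^\xi}{\xi!}\zeta(s+p+q+r-\xi)\frac{B_\xi(0)-B_\xi(1/2)}{2}=0\end{aligned}$$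 holds for $s\in\mathbb{C}$ except for singularities.
   Context: For $(s_1,s_2,s_3,s_4)\in\mathbb{C}^4$, $\zeta_2((s_1,s_2,s_3,s_4);PSp(2))=\sum_{m_1,m_2\ge1,\ m_1\equiv1\ (\mathrm{mod}\ 2)}\frac{1}{m_1^{s_1}m_2^{s_2}(m_1+m_2)^{s_3}(m_1+2m_2)^{s_4}}$ (the zeta-function of the weight lattice of the projective symplectic group $PSp(2)$, i.e. of the root lattice of type $C_2$), understood via its meromorphic continuation to $\mathbb{C}^4$. $\zeta$ is the Riemann zeta-function and $B_\xi(x)$ are the Bernoulli polynomials, $te^{xt}/(e^t-1)=\sum_\xi B_\xi(x)t^\xi/\xi!$. *)

theory Defs
  imports "HOL-Complex_Analysis.Complex_Analysis"
begin

section \<open>Bernoulli polynomials and the Riemann zeta-function\<close>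

text \<open>\<open>t e\<^sup>x\<^sup>t / (e\<^sup>t - 1) = \<Sum>\<xi>. B\<^sub>\<xi>(x) t\<^sup>\<xi> / \<xi>!\<close>, read as an identity of formal power series in \<open>t\<close>.\<close>

definition bernoulli_poly :: "nat \<Rightarrow> complex \<Rightarrow> complex" where
  "bernoulli_poly \<xi> x =
     fact \<xi> * fps_nth (fps_X * fps_exp x / (fps_exp 1 - 1)) \<xi>"

text \<open>The function chosen below is unique; its value at the pole \<open>1\<close> is \<open>0\<close>.\<close>

definition riemann_zeta :: "complex \<Rightarrow> complex" where
  "riemann_zeta = (SOME f. f nicely_meromorphic_on UNIV \<and>
     (\<forall>s. Re s > 1 \<longrightarrow> f s = (\<Sum>n. 1 / of_nat (Suc n) powr s)))"

section \<open>Meromorphic functions of several complex variables\<close>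

text \<open>Complex differentiability at every point; only used for open sets.\<close>

definition holomorphic_vec_on :: "(complex^'n \<Rightarrow> complex) \<Rightarrow> (complex^'n) set \<Rightarrow> bool" where
  "holomorphic_vec_on f U \<longleftrightarrow>
     (\<forall>z\<in>U. \<exists>D. (f has_derivative D) (at z within U) \<and> (\<forall>c v. D (c *s v) = c * D v))"

definition regular_at :: "(complex^'n \<Rightarrow> complex) \<Rightarrow> complex^'n \<Rightarrow> bool" where
  "regular_at f z \<longleftrightarrow> (\<exists>U. open U \<and> z \<in> U \<and> holomorphic_vec_on f U)"

text \<open>Locally a quotient of holomorphic functions whose denominator does not vanish identically.
  The values of \<open>f\<close> on the zero set of the denominator are not constrained.\<close>

definition meromorphic_vec :: "(complex^'n \<Rightarrow> complex) \<Rightarrow> bool" where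
  "meromorphic_vec f \<longleftrightarrow>
     (\<forall>z. \<exists>U g h. open U \<and> connected U \<and> z \<in> U \<and>
        holomorphic_vec_on g U \<and> holomorphic_vec_on h U \<and> (\<exists>w\<in>U. h w \<noteq> 0) \<and>
        (\<forall>w\<in>U. h w \<noteq> 0 \<longrightarrow> f w = g w / h w))"

text \<open>Normalised values, as for \<^const>\<open>nicely_meromorphic_on\<close> in one variable: \<open>f\<close> takes the value
  of the holomorphic extension wherever one exists locally, and \<open>0\<close> at the remaining points
  (poles and points of indeterminacy). Thus the points at which \<open>f\<close> is not regular are exactly
  the genuine singularities.\<close>

definition nicely_meromorphic_vec :: "(complex^'n \<Rightarrow> complex) \<Rightarrow> bool" where
  "nicely_meromorphic_vec f \<longleftrightarrow> meromorphic_vec f \<and>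
     (\<forall>U g. open U \<and> holomorphic_vec_on g U \<and> (\<forall>w\<in>U. regular_at f w \<longrightarrow> f w = g w)
        \<longrightarrow> (\<forall>w\<in>U. f w = g w)) \<and>
     (\<forall>z. \<not> regular_at f z \<longrightarrow> f z = 0)"

section \<open>The zeta-function of the weight lattice of \<open>PSp(2)\<close>\<close>

definition PSp2_index :: "(nat \<times> nat) set" where
  "PSp2_index = {(m1, m2). m1 \<ge> 1 \<and> m2 \<ge> 1 \<and> m1 mod 2 = 1}"

definition PSp2_term :: "complex^4 \<Rightarrow> nat \<times> nat \<Rightarrow> complex" where
  "PSp2_term z = (\<lambda>(m1, m2).
     1 / (of_nat m1 powr (z$1) * of_nat m2 powr (z$2) *
          of_nat (m1 + m2) powr (z$3) * of_nat (m1 + 2 * m2) powr (z$4)))"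

text \<open>The meromorphic continuation to \<open>\<complex>\<^sup>4\<close> of the series from its domain of absolute convergence.
  By the identity theorem there is only one function with this property.\<close>

definition PSp2_zeta :: "complex^4 \<Rightarrow> complex" where
  "PSp2_zeta = (SOME f. nicely_meromorphic_vec f \<and>
     (\<forall>z. (\<lambda>m. norm (PSp2_term z m)) summable_on PSp2_index \<longrightarrow>
          f z = infsum (PSp2_term z) PSp2_index))"

end

theory Submission
  imports Defs "HOL-Real_Asymp.Real_Asymp"
begin

text \<open>For \<open>Re s > 4\<close> the four values of \<open>PSp2_zeta\<close>, with their signs, are the sums of
  \<open>n\<^sup>-\<^sup>s k\<^sup>-\<^sup>p (k + n)\<^sup>-\<^sup>q (k + 2 n)\<^sup>-\<^sup>r\<close> over \<open>n \<ge> 1\<close> and the odd \<open>k\<close> in the four intervals cut out by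
  \<open>0\<close>, \<open>- n\<close> and \<open>- 2 n\<close>, so together they form the sum over all odd \<open>k \<noteq> - n\<close>. For fixed \<open>n\<close>, two
  partial fraction expansions reduce the sum over \<open>k\<close> to sums of \<open>x\<^sup>-\<^sup>j\<close> over a class of integers
  modulo 2, which are Bernoulli numbers up to powers of \<open>2 \<pi> \<i>\<close>; the remaining sum over \<open>n\<close> gives values of \<open>\<zeta>\<close>.

  To pass to general \<open>s\<close>, the double series is written as a sum over unit cells of integrals of the
  summand against weights. For a weight of mean zero, integration by parts improves the decay;
  for the weight \<open>1\<close>, Euler's relation for homogeneous functions does so at the cost of a linear factor
  in the denominator. Hence on each of an increasing sequence of half-space intersections exhausting
  the space, \<open>PSp2_zeta\<close> is a quotient whose denominator is a product of affine forms, none of which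
  vanishes identically on the four lines \<open>s \<mapsto> (p,s,q,r), (p,q,s,r), (r,q,s,p), (r,s,q,p)\<close>, and the
  identity theorem in \<open>s\<close> applies.\<close>

text \<open>Continuing the series is not enough: the four lines could lie inside the polar set. On
  two of them \<open>wB\<close> is the constant p + q + r, so an unspecified denominator might
  vanish identically there. Hence the denominators are explicit, with factors \<open>w + c\<close>
  for real \<open>c \<ge> -2\<close>: the Euler identities contribute -1 or -2, shifts of the
  exponents only raise \<open>c\<close>, and p + q + r is at least 3.

  Both zeta-functions are given by choice, so existence and uniqueness of a normalised continuation
  are needed. At a regular point the value is a limit along the line, so a zero of the denominator
  at \<open>s\<close> itself does no harm.

  In the inner sum, partial fraction terms of exponent 1 are not summable, and
  \<open>1/0 = 0\<close> silently drops the poles. Both defects cancel: opposite coefficients turn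
  the terms of exponent 1 into differences with sum 0, and the corrections at the poles are the
  general coefficient formula at index 0. The Bernoulli numbers enter through the cotangent,
  obtained from the reflection formula of the Gamma function by way of Digamma.\<close>

no_notation fps_nth (infixl "$" 75)

section \<open>Holomorphic functions of several complex variables\<close>

text \<open>Pointwise form of \<open>holomorphic_vec_on\<close>: the full filter \<open>at z\<close>
  replaces \<open>at z within U\<close>, so that the closure rules below carry no set.\<close>

definition holo_at :: "(complex^'n \<Rightarrow> complex) \<Rightarrow> complex^'n \<Rightarrow> bool" where
  "holo_at f z \<longleftrightarrow> (\<exists>D. (f has_derivative D) (at z) \<and> (\<forall>c v. D (c *s v) = c * D v))"

lemma holomorphic_vec_on_iff_holo_at:
  "open U \<Longrightarrow> holomorphic_vec_on f U \<longleftrightarrow> (\<forall>z\<in>U. holo_at f z)"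
  unfolding holomorphic_vec_on_def holo_at_def by (metis at_within_open)

lemma holo_at_const [simp]: "holo_at (\<lambda>z. c) z"
  unfolding holo_at_def by (rule exI[of _ "\<lambda>v. 0"]) auto

lemma holo_at_coord [simp]: "holo_at (\<lambda>z. z $ i) z"
  unfolding holo_at_def
  by (rule exI[of _ "\<lambda>v. v $ i"])
     (auto intro: bounded_linear_imp_has_derivative bounded_linear_vec_nth)

lemma holo_at_add: "holo_at f z \<Longrightarrow> holo_at g z \<Longrightarrow> holo_at (\<lambda>z. f z + g z) z"
  unfolding holo_at_def
proof (elim exE conjE)
  fix D E assume "(f has_derivative D) (at z)" "(g has_derivative E) (at z)"
    "\<forall>c v. D (c *s v) = c * D v" "\<forall>c v. E (c *s v) = c * E v"
  then show "\<exists>D. ((\<lambda>z. f z + g z) has_derivative D) (at z) \<and> (\<forall>c v. D (c *s v) = c * D v)"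
    by (intro exI[of _ "\<lambda>v. D v + E v"]) (auto intro!: derivative_eq_intros simp: algebra_simps)
qed

lemma holo_at_mult: "holo_at f z \<Longrightarrow> holo_at g z \<Longrightarrow> holo_at (\<lambda>z. f z * g z) z"
  unfolding holo_at_def
proof (elim exE conjE)
  fix D E assume "(f has_derivative D) (at z)" "(g has_derivative E) (at z)"
    "\<forall>c v. D (c *s v) = c * D v" "\<forall>c v. E (c *s v) = c * E v"
  then show "\<exists>D. ((\<lambda>z. f z * g z) has_derivative D) (at z) \<and> (\<forall>c v. D (c *s v) = c * D v)"
    by (intro exI[of _ "\<lambda>v. f z * E v + D v * g z"])
       (auto intro!: derivative_eq_intros simp: algebra_simps)
qed

lemma holo_at_field_compose:
  "holo_at f z \<Longrightarrow> (g has_field_derivative d) (at (f z)) \<Longrightarrow> holo_at (\<lambda>z. g (f z)) z"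
  unfolding holo_at_def has_field_derivative_def
proof (elim exE conjE)
  fix D assume D: "(f has_derivative D) (at z)" "\<forall>c v. D (c *s v) = c * D v"
     and g: "(g has_derivative (*) d) (at (f z))"
  show "\<exists>D. ((\<lambda>z. g (f z)) has_derivative D) (at z) \<and> (\<forall>c v. D (c *s v) = c * D v)"
    using has_derivative_compose[OF D(1) g] D(2)
    by (intro exI[of _ "\<lambda>v. d * D v"]) auto
qed

lemma holo_at_uminus: "holo_at f z \<Longrightarrow> holo_at (\<lambda>z. - f z) z"
  using holo_at_mult[OF holo_at_const[of "-1"], of f z] by simp

lemma holo_at_diff: "holo_at f z \<Longrightarrow> holo_at g z \<Longrightarrow> holo_at (\<lambda>z. f z - g z) z"
  using holo_at_add[OF _ holo_at_uminus, of f z g] by simp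

lemma holo_at_exp: "holo_at f z \<Longrightarrow> holo_at (\<lambda>z. exp (f z)) z"
  by (erule holo_at_field_compose) (rule DERIV_exp)

lemma holo_at_inverse: "holo_at f z \<Longrightarrow> f z \<noteq> 0 \<Longrightarrow> holo_at (\<lambda>z. inverse (f z)) z"
  by (erule holo_at_field_compose) (rule DERIV_inverse)

lemma holo_at_divide: "holo_at f z \<Longrightarrow> holo_at g z \<Longrightarrow> g z \<noteq> 0 \<Longrightarrow> holo_at (\<lambda>z. f z / g z) z"
  unfolding divide_inverse by (intro holo_at_mult holo_at_inverse)

lemma holo_at_sum: "(\<And>i. i \<in> I \<Longrightarrow> holo_at (f i) z) \<Longrightarrow> holo_at (\<lambda>z. \<Sum>i\<in>I. f i z) z"
  by (induction I rule: infinite_finite_induct) (auto intro: holo_at_add)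

lemmas holo_at_intros = holo_at_const holo_at_coord holo_at_add holo_at_mult holo_at_uminus holo_at_diff
  holo_at_exp holo_at_sum

lemma holo_at_linear_compose:
  assumes "holo_at f (A z)" "bounded_linear A" "\<And>c v. A (c *s v) = c *s A v"
  shows "holo_at (\<lambda>z. f (A z)) z"
proof -
  obtain D where D: "(f has_derivative D) (at (A z))" "\<forall>c v. D (c *s v) = c * D v"
    using assms(1) unfolding holo_at_def by auto
  have "((\<lambda>z. f (A z)) has_derivative (\<lambda>v. D (A v))) (at z)"
    using has_derivative_compose[OF bounded_linear_imp_has_derivative[OF assms(2)] D(1)] .
  then show ?thesis unfolding holo_at_def using D(2) assms(3) by (intro exI[of _ "\<lambda>v. D (A v)"]) auto
qed

lemma holo_at_shift: assumes "holo_at f (z + e)" shows "holo_at (\<lambda>z. f (z + e)) z"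
proof -
  obtain D where D: "(f has_derivative D) (at (z + e))" "\<forall>c v. D (c *s v) = c * D v"
    using assms unfolding holo_at_def by auto
  have "((\<lambda>z. z + e) has_derivative (\<lambda>v. v)) (at z)" by (auto intro!: derivative_eq_intros)
  from has_derivative_compose[OF this D(1)] D(2) show ?thesis unfolding holo_at_def by auto
qed

lemma holo_at_isCont: "holo_at f z \<Longrightarrow> isCont f z"
  unfolding holo_at_def by (auto dest: has_derivative_continuous)

lemma holo_at_cong:
  assumes "holo_at f z" "open U" "z \<in> U" "\<And>w. w \<in> U \<Longrightarrow> f w = g w" shows "holo_at g z"
  using assms unfolding holo_at_def by (metis has_derivative_transform_within_open)

section \<open>Restriction to complex lines and the identity theorem\<close>

lemma norm_cscale: "norm (c *s (v :: complex^'n)) = norm c * norm v"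
  by (simp add: norm_vec_def norm_mult L2_set_right_distrib)

lemma bounded_linear_cscale: "bounded_linear (\<lambda>w. w *s (v :: complex^'n))"
  by (rule bounded_linear_intro[where K = "norm v"])
     (simp_all add: norm_cscale vec_eq_iff algebra_simps scaleR_conv_of_real[where 'a = complex])

lemma isCont_cline [continuous_intros]: "continuous_on S (\<lambda>w. z + w *s (v :: complex^'n))"
  by (intro continuous_intros linear_continuous_on bounded_linear_cscale)

lemma open_cline: "open U \<Longrightarrow> open {w. z + w *s (v :: complex^'n) \<in> U}"
  using open_vimage[of U "\<lambda>w. z + w *s v"] isCont_cline[of UNIV z v] by (simp add: vimage_def)

text \<open>Complex linearity of \<open>D\<close> enters here: the chain rule gives
  \<open>w \<mapsto> D (w *s v)\<close>, which is multiplication by \<open>D v\<close>.\<close>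

lemma holo_at_line_has_derivative:
  fixes f :: "complex^'n \<Rightarrow> complex"
  assumes "(f has_derivative D) (at (z + w *s v))" "\<forall>c v. D (c *s v) = c * D v"
  shows "((\<lambda>w. f (z + w *s v)) has_field_derivative D v) (at w)"
proof -
  have "((\<lambda>w. z + w *s v) has_derivative (\<lambda>w. 0 + w *s v)) (at w)"
    by (intro has_derivative_add has_derivative_const bounded_linear_imp_has_derivative bounded_linear_cscale)
  then have "((\<lambda>w. z + w *s v) has_derivative (\<lambda>w. w *s v)) (at w)" by simp
  from has_derivative_compose[OF this assms(1)] assms(2)
  show ?thesis unfolding has_field_derivative_def
    by (metis (no_types, lifting) ext mult.commute)
qed

lemma holo_at_line:
  assumes "holo_at f (z + w *s v)" shows "(\<lambda>w. f (z + w *s v)) field_differentiable at w"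
  using assms holo_at_line_has_derivative unfolding holo_at_def field_differentiable_def by blast

lemma holo_at_line_holomorphic:
  assumes "\<And>w. w \<in> S \<Longrightarrow> holo_at f (z + w *s v)" shows "(\<lambda>w. f (z + w *s v)) holomorphic_on S"
  unfolding holomorphic_on_def
  using assms by (auto intro!: field_differentiable_at_within[OF holo_at_line])

text \<open>A complex line joins \<open>x\<close> to a point of \<open>W\<close>; the set of its
  parameters inside \<open>U\<close> is convex and contains 0 and 1, so the one-variable identity
  theorem applies.\<close>

lemma holo_at_identity_convex:
  assumes "open U" "convex U" "\<And>z. z \<in> U \<Longrightarrow> holo_at f z" "open W" "W \<noteq> {}" "W \<subseteq> U"
    and "\<And>z. z \<in> W \<Longrightarrow> f z = 0" and x: "x \<in> U"
  shows "f x = 0"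
proof -
  obtain w where w: "w \<in> W" using assms by auto
  define v where "v = x - w"
  define S where "S = {t. w + t *s v \<in> U}"
  define S' where "S' = {t. w + t *s v \<in> W}"
  have "open S" "open S'" unfolding S_def S'_def using assms by (auto intro: open_cline)
  have "convex S" unfolding S_def convex_def
  proof (intro allI ballI impI)
    fix s t and a b :: real assume *: "s \<in> {t. w + t *s v \<in> U}" "t \<in> {t. w + t *s v \<in> U}"
      "0 \<le> a" "0 \<le> b" "a + b = 1"
    have "a *\<^sub>R (w + s *s v) + b *\<^sub>R (w + t *s v) \<in> U"
      using * assms(2) unfolding convex_def by blast
    also have "a *\<^sub>R (w + s *s v) + b *\<^sub>R (w + t *s v) = (a+b) *\<^sub>R w + (a *\<^sub>R s + b *\<^sub>R t) *s v"
      by (simp add: vec_eq_iff algebra_simps scaleR_conv_of_real[where 'a = complex])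
    finally show "a *\<^sub>R s + b *\<^sub>R t \<in> {t. w + t *s v \<in> U}" using * by simp
  qed
  have 0: "0 \<in> S'" and 1: "1 \<in> S" using w x by (auto simp: S'_def S_def v_def)
  have "f (w + 1 *s v) = 0"
  proof (rule analytic_continuation_open[of S' S "\<lambda>t. f (w + t *s v)" "\<lambda>_. 0" 1])
    show "S' \<noteq> {}" using 0 by blast
    show "S' \<subseteq> S" using assms(6) by (auto simp: S_def S'_def)
    show "(\<lambda>t. f (w + t *s v)) holomorphic_on S"
      by (rule holo_at_line_holomorphic) (use assms(3) in \<open>auto simp: S_def\<close>)
  qed (use \<open>open S\<close> \<open>open S'\<close> convex_connected[OF \<open>convex S\<close>] 1 assms(7) in \<open>auto simp: S'_def\<close>)
  then show ?thesis by (simp add: v_def)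
qed

text \<open>The interior of the zero set is clopen in \<open>U\<close>: around a limit point the
  convex version, applied to a ball, spreads the vanishing over that ball.\<close>

lemma holo_at_identity_connected:
  assumes "open U" "connected U" "\<And>z. z \<in> U \<Longrightarrow> holo_at f z" "open W" "W \<noteq> {}" "W \<subseteq> U"
    and "\<And>z. z \<in> W \<Longrightarrow> f z = 0" and x: "x \<in> U"
  shows "f x = 0"
proof -
  define A where "A = U \<inter> interior {z. f z = 0}"
  have WA: "W \<subseteq> A" using assms interior_maximal[of W "{z. f z = 0}"] by (auto simp: A_def)
  have oA: "open A" using assms by (auto simp: A_def)
  have AU: "A \<subseteq> U" by (auto simp: A_def)
  have "openin (top_of_set U) A" using oA AU by (simp add: open_subset)
  moreover have "closedin (top_of_set U) A"
  proof (subst closedin_limpt, intro conjI allI impI)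
    show "A \<subseteq> U" by fact
    fix z assume z: "z islimpt A \<and> z \<in> U"
    obtain r where r: "r > 0" "ball z r \<subseteq> U" using z assms(1) by (meson openE)
    have ne: "ball z r \<inter> A \<noteq> {}" using z r unfolding islimpt_def
      by (metis centre_in_ball disjoint_iff open_ball)
    have A0: "f y = 0" if "y \<in> A" for y
      using that interior_subset[of "{z. f z = 0}"] by (auto simp: A_def)
    have "f y = 0" if "y \<in> ball z r" for y
    proof (rule holo_at_identity_convex[of "ball z r" f "ball z r \<inter> A"])
      show "holo_at f x" if "x \<in> ball z r" for x using that r assms(3) by blast
    qed (use A0 ne that oA in auto)
    then have "ball z r \<subseteq> interior {z. f z = 0}" by (intro interior_maximal) auto
    then show "z \<in> A" using z r by (auto simp: A_def)
  qed
  ultimately have "A = U" using assms(2) WA assms(5) unfolding connected_clopen by auto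
  then show ?thesis using x interior_subset[of "{z. f z = 0}"] by (auto simp: A_def)
qed

section \<open>Series and integrals depending on several complex parameters\<close>

text \<open>Termwise differentiation by the M-test. Bounds are given for the functions only; those
  for the derivatives come from Cauchy's inequality on complex lines, at the price of halving the
  ball.\<close>

lemma holo_at_suminf:
  fixes f :: "nat \<Rightarrow> complex^'n \<Rightarrow> complex"
  assumes r: "r > 0" and f: "\<And>n x. x \<in> ball z r \<Longrightarrow> holo_at (f n) x"
    and M: "summable M" "\<And>n x. x \<in> ball z r \<Longrightarrow> norm (f n x) \<le> M n"
  shows "holo_at (\<lambda>z. \<Sum>n. f n z) z"
proof -
  define S where "S = ball z (r/2)"
  have Sb: "x \<in> ball z r" if "x \<in> S" for x using that r by (auto simp: S_def)
  define D where "D n x = (SOME D. (f n has_derivative D) (at x) \<and> (\<forall>c v. D (c *s v) = c * D v))" for n x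
  have D': "(f n has_derivative D n x) (at x) \<and> (\<forall>c v. D n x (c *s v) = c * D n x v)" if "x \<in> ball z r" for n x
    using someI_ex[OF f[OF that, unfolded holo_at_def]] unfolding D_def .
  have D: "\<And>n x. x \<in> ball z r \<Longrightarrow> (f n has_derivative D n x) (at x)"
     "\<And>n x c v. x \<in> ball z r \<Longrightarrow> D n x (c *s v) = c * D n x v"
    using D' by blast+
  have bd: "norm (D n x v) \<le> M n * (4 / r) * norm v" if x: "x \<in> S" for n x v
  proof (cases "v = 0")
    case True
    then show ?thesis using has_derivative_bounded_linear[OF D(1)[OF Sb[OF x]]]
      by (simp add: linear_simps)
  next
    case False
    \<comment> \<open>Then \<open>\<rho> * norm v = r / 4\<close>: from a point of the half ball,
      the disc of radius \<open>\<rho>\<close> in direction \<open>v\<close> stays in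
      \<open>ball z r\<close>.\<close>
    define \<rho> where "\<rho> = r / (4 * norm v)"
    have \<rho>: "\<rho> > 0" using False r by (simp add: \<rho>_def)
    have in_ball: "x + w *s v \<in> ball z r" if "norm w \<le> \<rho>" for w
    proof -
      have "norm (w *s v) \<le> \<rho> * norm v" unfolding norm_cscale using that by (intro mult_right_mono) auto
      also have "\<dots> = r / 4" using False by (simp add: \<rho>_def)
      finally have "norm (w *s v) \<le> r/4" .
      moreover have "dist z x < r / 2" using x by (simp add: S_def)
      moreover have "dist z (x + w *s v) \<le> dist z x + norm (w *s v)"
        using dist_triangle[of z "x + w *s v" x] by (simp add: dist_norm)
      ultimately show ?thesis using r by simp
    qed
    have hol: "(\<lambda>w. f n (x + w *s v)) holomorphic_on cball 0 \<rho>"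
      by (rule holo_at_line_holomorphic) (use f in_ball in auto)
    have "((\<lambda>w. f n (x + w *s v)) has_field_derivative D n x v) (at 0)"
      using holo_at_line_has_derivative[of "f n" "D n x" x 0 v] D Sb[OF x] by simp
    then have der: "deriv (\<lambda>w. f n (x + w *s v)) 0 = D n x v" by (rule DERIV_imp_deriv)
    have "norm ((deriv ^^ 1) (\<lambda>w. f n (x + w *s v)) 0) \<le> fact 1 * M n / \<rho> ^ 1"
      using \<rho> in_ball M(2) hol
      by (intro Cauchy_inequality) (auto intro: holomorphic_on_subset holomorphic_on_imp_continuous_on)
    then show ?thesis using der by (simp add: \<rho>_def algebra_simps)
  qed
  have sD: "summable (\<lambda>n. D n x v)" if "x \<in> S" for x v
    by (rule summable_comparison_test'[where g = "\<lambda>n. M n * ((4 / r) * norm v)" and N = 0])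
       (use bd[OF that] summable_mult2[OF M(1)] in \<open>simp_all add: mult.assoc\<close>)
  define g' where "g' x v = (\<Sum>n. D n x v)" for x v
  have "\<exists>g. \<forall>x\<in>S. (\<lambda>n. f n x) sums (g x) \<and> (g has_derivative g' x) (at x within S)"
  proof (rule has_derivative_series)
    show "convex S" by (simp add: S_def)
    show "z \<in> S" using r by (simp add: S_def)
    show "(f n has_derivative D n x) (at x within S)" if "x \<in> S" for n x
      using D(1)[OF Sb[OF that]] has_derivative_at_withinI by blast
    have "summable (\<lambda>n. f n z)"
      by (rule summable_comparison_test'[OF M(1), of 0]) (use M(2) r in auto)
    then show "(\<lambda>n. f n z) sums (\<Sum>n. f n z)" by (rule summable_sums)
    fix e :: real assume e: "e > 0"
    have "(\<lambda>n. (\<Sum>i. M (i + n)) * (4 / r)) \<longlonglongrightarrow> 0 * (4 / r)"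
      by (intro tendsto_intros suminf_exist_split2 M(1))
    then have "eventually (\<lambda>n. (\<Sum>i. M (i + n)) * (4 / r) < e) sequentially"
      using e by (simp add: order_tendstoD(2))
    then show "\<forall>\<^sub>F n in sequentially. \<forall>x\<in>S. \<forall>h. norm ((\<Sum>i<n. D i x h) - g' x h) \<le> e * norm h"
    proof eventually_elim
      case (elim n)
      show ?case
      proof (intro ballI allI)
        fix x h assume x: "x \<in> S"
        have "norm ((\<Sum>i<n. D i x h) - g' x h) = norm (\<Sum>i. D (i + n) x h)"
          unfolding g'_def using suminf_split_initial_segment[OF sD[OF x], of h n]
          by (simp add: norm_minus_commute)
        also have "\<dots> \<le> (\<Sum>i. M (i + n) * ((4 / r) * norm h))"
          by (rule norm_suminf_le)
             (use bd[OF x] summable_mult2[OF summable_ignore_initial_segment[OF M(1)]] in \<open>simp_all add: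
               mult.assoc\<close>)
        also have "\<dots> = (\<Sum>i. M (i + n)) * (4 / r) * norm h"
          by (subst suminf_mult2[symmetric]) (use M(1) in \<open>auto intro: summable_ignore_initial_segment\<close>)
        also have "\<dots> \<le> e * norm h" using elim by (intro mult_right_mono) auto
        finally show "norm ((\<Sum>i<n. D i x h) - g' x h) \<le> e * norm h" .
      qed
    qed
  qed
  then obtain g where g: "\<And>x. x \<in> S \<Longrightarrow> (\<lambda>n. f n x) sums (g x)"
    "\<And>x. x \<in> S \<Longrightarrow> (g has_derivative g' x) (at x within S)" by blast
  have zS: "z \<in> S" "open S" using r by (auto simp: S_def)
  have "(g has_derivative g' z) (at z)" using g(2)[OF zS(1)] unfolding at_within_open[OF zS] .
  moreover have "g' z (c *s v) = c * g' z v" for c v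
    unfolding g'_def using D(2)[OF Sb[OF zS(1)]] sD[OF zS(1)] by (simp add: suminf_mult)
  ultimately have "holo_at g z" unfolding holo_at_def by blast
  then show ?thesis by (rule holo_at_cong[OF _ zS(2,1)]) (rule sums_unique[OF g(1)])
qed

lemma holo_at_infsum_pair:
  fixes f :: "nat \<times> nat \<Rightarrow> complex^'n \<Rightarrow> complex"
  assumes r: "r > 0" and f: "\<And>n x. x \<in> ball z r \<Longrightarrow> holo_at (f n) x"
    and M: "M summable_on UNIV" "\<And>n x. x \<in> ball z r \<Longrightarrow> norm (f n x) \<le> M n"
  shows "holo_at (\<lambda>z. infsum (\<lambda>m. f m z) UNIV) z"
proof -
  have bij: "bij_betw prod_decode UNIV (UNIV :: (nat \<times> nat) set)" by (rule bij_prod_decode)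
  have Ms: "(\<lambda>n. M (prod_decode n)) summable_on UNIV"
    using summable_on_reindex_bij_betw[OF bij, of M] M(1) by simp
  have M': "summable (\<lambda>n. M (prod_decode n))"
    using Ms by (rule summable_on_imp_summable)
  have "infsum (\<lambda>m. f m x) UNIV = (\<Sum>n. f (prod_decode n) x)" if "x \<in> ball z r" for x
  proof -
    have "summable (\<lambda>n. norm (f (prod_decode n) x))"
      by (rule summable_comparison_test'[OF M', of 0]) (use M(2) that in auto)
    then have "((\<lambda>n. f (prod_decode n) x) has_sum (\<Sum>n. f (prod_decode n) x)) UNIV"
      using summable_sums[OF summable_norm_cancel] by (intro norm_summable_imp_has_sum) blast
    then have "infsum (\<lambda>n. f (prod_decode n) x) UNIV = (\<Sum>n. f (prod_decode n) x)" by (rule infsumI)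
    with infsum_reindex_bij_betw[OF bij, of "\<lambda>m. f m x"] show ?thesis by (rule trans[OF sym])
  qed
  note eq = this
  have "holo_at (\<lambda>z. \<Sum>n. f (prod_decode n) z) z"
    by (rule holo_at_suminf[OF r _ M']) (use f M(2) in auto)
  then show ?thesis
  proof (rule holo_at_cong[of _ _ "ball z r"])
    show "(\<Sum>n. f (prod_decode n) w) = infsum (\<lambda>m. f m w) UNIV" if "w \<in> ball z r" for w
      using eq[OF that] by (rule sym)
  qed (use r in auto)
qed

text \<open>The integrals below have this shape, complex powers being exponentials of a form linear
  in \<open>z\<close>. The Leibniz rule asks for the derivative as a continuous map into bounded
  linear maps, hence the \<open>Blinfun\<close> coordinates.\<close>

lemma holo_at_exp_integral:
  fixes W :: "'m::euclidean_space \<Rightarrow> complex" and l :: "'n::finite \<Rightarrow> 'm \<Rightarrow> complex"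
  assumes W: "continuous_on (cbox a b) W" and l: "\<And>j. continuous_on (cbox a b) (l j)"
  shows "holo_at (\<lambda>z. integral (cbox a b) (\<lambda>t. W t * exp (- (\<Sum>j\<in>UNIV. z $ j * l j t)))) z"
proof -
  define B :: "'n \<Rightarrow> (complex^'n) \<Rightarrow>\<^sub>L complex" where "B j = Blinfun (\<lambda>v. v $ j)" for j
  have B: "blinfun_apply (B j) v = v $ j" for j v
    unfolding B_def by (simp add: bounded_linear_Blinfun_apply bounded_linear_vec_nth)
  define F where "F z t = W t * exp (- (\<Sum>j\<in>UNIV. z $ j * l j t))" for z t
  define D :: "complex^'n \<Rightarrow> 'm \<Rightarrow> (complex^'n) \<Rightarrow>\<^sub>L complex"
    where "D z t = (\<Sum>j\<in>UNIV. blinfun_mult_left (- F z t * l j t) o\<^sub>L B j)" for z t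
  have Dapp: "blinfun_apply (D z t) v = - F z t * (\<Sum>j\<in>UNIV. v $ j * l j t)" for z t v
    unfolding D_def
    by (simp add: blinfun.sum_left B blinfun_mult_left.rep_eq sum_distrib_left sum_negf algebra_simps)
  have contF: "continuous_on (UNIV \<times> cbox a b) (\<lambda>(z, t). F z t)"
    unfolding F_def split_beta
    by (intro continuous_intros continuous_on_compose2[OF W] continuous_on_compose2[OF l]) auto
  have contD: "continuous_on (UNIV \<times> cbox a b) (\<lambda>(z, t). D z t)"
    unfolding D_def split_beta
    using contF unfolding split_beta
    by (intro continuous_intros bounded_linear.continuous_on[OF bounded_linear_blinfun_mult_left]
      continuous_on_compose2[OF l]) auto
  have contFz: "continuous_on (cbox a b) (F z)" for z
    unfolding F_def by (intro continuous_intros W l)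
  have contDz: "continuous_on (cbox a b) (D z)" for z
    unfolding D_def
      by (intro continuous_intros bounded_linear.continuous_on[OF bounded_linear_blinfun_mult_left] contFz l)
  have der: "((\<lambda>z. integral (cbox a b) (F z)) has_derivative blinfun_apply (integral (cbox a b) (D z)))
    (at z within UNIV)"
  proof (rule leibniz_rule[OF _ _ contD])
    show "((\<lambda>x. F x t) has_derivative blinfun_apply (D x t)) (at x within UNIV)" for x t
    proof -
      have l1: "((\<lambda>x. - (\<Sum>j\<in>UNIV. x $ j * l j t)) has_derivative (\<lambda>v. - (\<Sum>j\<in>UNIV. v $ j * l j t))) (at x)"
        by (intro has_derivative_minus has_derivative_sum has_derivative_mult_left
              bounded_linear_imp_has_derivative bounded_linear_vec_nth)
      have "((\<lambda>y. W t * exp y) has_derivative (*) (W t * exp (- (\<Sum>j\<in>UNIV. x $ j * l j t)))) (at (-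
        (\<Sum>j\<in>UNIV. x $ j * l j t)))"
        using DERIV_cmult[OF DERIV_exp] unfolding has_field_derivative_def by blast
      from has_derivative_compose[OF l1 this] show ?thesis
        unfolding F_def by (rule has_derivative_eq_rhs) (simp add: Dapp F_def fun_eq_iff)
    qed
    show "F x integrable_on cbox a b" for x by (rule integrable_continuous[OF contFz])
  qed auto
  have "integral (cbox a b) (D z) (c *s v) = c * integral (cbox a b) (D z) v" for c v
  proof -
    have app: "blinfun_apply (integral (cbox a b) (D z)) v = integral (cbox a b) (\<lambda>t. D z t v)" for v
      by (rule blinfun_apply_integral[OF integrable_continuous[OF contDz]])
    have "(\<lambda>t. blinfun_apply (D z t) (c *s v)) = (\<lambda>t. c * blinfun_apply (D z t) v)"
      unfolding Dapp by (auto simp: sum_distrib_left algebra_simps)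
    then show ?thesis unfolding app by simp
  qed
  then show ?thesis using der unfolding holo_at_def F_def[symmetric] by auto
qed

section \<open>Meromorphic continuation from nested convex domains\<close>

lemma holo_at_nonzero_dense:
  assumes "open U" "connected U" "\<And>z. z \<in> U \<Longrightarrow> holo_at h z" "\<exists>w\<in>U. h w \<noteq> 0" "open W" "W \<subseteq> U" "W \<noteq> {}"
  shows "\<exists>w\<in>W. h w \<noteq> 0"
  using holo_at_identity_connected[OF assms(1-3) assms(5,7,6)] assms(4) by blast

text \<open>The nonzeros of \<open>h\<close> are dense, and continuity carries the equality across
  its zeros.\<close>

lemma holo_at_eq_if_eq_off_zeros:
  fixes f g h :: "complex^'n \<Rightarrow> complex"
  assumes "open U" "connected U" "\<And>z. z \<in> U \<Longrightarrow> holo_at h z" "\<exists>w\<in>U. h w \<noteq> 0"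
    and "\<And>w. w \<in> U \<Longrightarrow> h w \<noteq> 0 \<Longrightarrow> f w = g w" "isCont f z" "isCont g z" "z \<in> U"
  shows "f z = g z"
proof (rule ccontr)
  assume ne: "f z \<noteq> g z"
  have "isCont (\<lambda>w. f w - g w) z" using assms by (intro continuous_intros)
  then have "\<forall>\<^sub>F w in at z. f w - g w \<noteq> 0"
    using ne by (intro tendsto_imp_eventually_ne) (auto simp: isCont_def)
  then obtain V where V: "open V" "z \<in> V" "\<And>w. w \<in> V \<Longrightarrow> f w \<noteq> g w"
    unfolding eventually_at_topological using ne by auto metis
  obtain w where "w \<in> V \<inter> U" "h w \<noteq> 0"
    using holo_at_nonzero_dense[OF assms(1-4), of "V \<inter> U"] V assms by blast
  then show False using V assms by blast
qed

lemma open_limpt_closed_eq_UNIV: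
  fixes A :: "'a::topological_space set"
  assumes "connected (UNIV :: 'a set)" "open A" "A \<noteq> {}" "\<And>z. z islimpt A \<Longrightarrow> z \<in> A"
  shows "A = UNIV"
  using assms(1)[unfolded connected_clopen, rule_format, of A] assms(2-4) closed_limpt[of A]
  by auto

lemma regular_at_iff: "regular_at f z \<longleftrightarrow> (\<exists>U. open U \<and> z \<in> U \<and> (\<forall>w\<in>U. holo_at f w))"
  unfolding regular_at_def using holomorphic_vec_on_iff_holo_at by blast

text \<open>Agreement off a thin set is spread from \<open>W\<close> to the whole space by
  connectedness; the normalisation of the values then turns it into equality at every point, zeros
  of the local denominators included.\<close>

lemma nicely_meromorphic_vec_unique:
  fixes f f' :: "complex^'n \<Rightarrow> complex"
  assumes f: "nicely_meromorphic_vec f" and f': "nicely_meromorphic_vec f'"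
    and W: "open W" "W \<noteq> {}" "\<And>z. z \<in> W \<Longrightarrow> f z = f' z"
  shows "f = f'"
proof -
  \<comment> \<open>Equality is asked only off the zeros of some \<open>h\<close>, since meromorphy
    alone says nothing about the values there.\<close>
  define A where "A = {z. \<exists>V h. open V \<and> connected V \<and> z \<in> V \<and> (\<forall>w\<in>V. holo_at h w) \<and> (\<exists>w\<in>V. h w \<noteq> 0) \<and>
     (\<forall>w\<in>V. h w \<noteq> 0 \<longrightarrow> f w = f' w)}"
  have ball_in: "\<exists>r>0. ball z r \<subseteq> V" if "open V" "z \<in> V" for V and z :: "complex^'n"
    using that openE by metis
  have conn: "connected (ball z r)" for z :: "complex^'n" and r by (simp add: convex_connected)
  have "open A"
    unfolding A_def by (subst open_subopen) blast
  have "A = UNIV"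
  proof (rule open_limpt_closed_eq_UNIV[OF connected_UNIV \<open>open A\<close>])
    obtain w r where w: "w \<in> W" "r > 0" "ball w r \<subseteq> W" using W ball_in by blast
    have "w \<in> A" unfolding A_def
      by (rule CollectI, rule exI[of _ "ball w r"], rule exI[of _ "\<lambda>_. 1"])
        (use w W conn in \<open>auto intro!: exI[of _ w]\<close>)
    then show "A \<noteq> {}" by auto
    fix z assume z: "z islimpt A"
    obtain U g h where U: "open U" "connected U" "z \<in> U" "holomorphic_vec_on g U" "holomorphic_vec_on h U"
      "\<exists>w\<in>U. h w \<noteq> 0" "\<And>w. w \<in> U \<Longrightarrow> h w \<noteq> 0 \<Longrightarrow> f w = g w / h w"
      using f unfolding nicely_meromorphic_vec_def meromorphic_vec_def by meson
    obtain U' g' h' where U': "open U'" "connected U'" "z \<in> U'" "holomorphic_vec_on g' U'"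
      "holomorphic_vec_on h' U'"
      "\<exists>w\<in>U'. h' w \<noteq> 0" "\<And>w. w \<in> U' \<Longrightarrow> h' w \<noteq> 0 \<Longrightarrow> f' w = g' w / h' w"
      using f' unfolding nicely_meromorphic_vec_def meromorphic_vec_def by meson
    have hvs: "\<And>w. w \<in> U \<Longrightarrow> holo_at g w" "\<And>w. w \<in> U \<Longrightarrow> holo_at h w" "\<And>w. w \<in> U' \<Longrightarrow> holo_at g' w"
      "\<And>w. w \<in> U' \<Longrightarrow> holo_at h' w"
      using U(1,4,5) U'(1,4,5) holomorphic_vec_on_iff_holo_at by blast+
    have dense: "\<exists>w\<in>X. h w * h' w \<noteq> 0" if X: "open X" "X \<subseteq> U" "X \<subseteq> U'" "X \<noteq> {}" for X
    proof -
      obtain x where x: "x \<in> X" "h x \<noteq> 0"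
        using holo_at_nonzero_dense[OF U(1,2) hvs(2) U(6) X(1,2,4)] by blast
      have "isCont h x" using hvs(2) x X by (auto intro: holo_at_isCont)
      then have "\<forall>\<^sub>F w in at x. h w \<noteq> 0" using x by (intro tendsto_imp_eventually_ne) (auto simp: isCont_def)
      then obtain Y where Y: "open Y" "x \<in> Y" "\<And>w. w \<in> Y \<Longrightarrow> h w \<noteq> 0"
        unfolding eventually_at_topological using x by auto metis
      obtain w where "w \<in> X \<inter> Y" "h' w \<noteq> 0"
        using holo_at_nonzero_dense[OF U'(1,2) hvs(4) U'(6), of "X \<inter> Y"] X Y x by blast
      then show ?thesis using Y by auto
    qed
    obtain r where r: "r > 0" "ball z r \<subseteq> U \<inter> U'" using ball_in[of "U \<inter> U'" z] U U' by blast
    define B where "B = ball z r"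
    have B: "open B" "connected B" "z \<in> B" "B \<subseteq> U" "B \<subseteq> U'" using r conn by (auto simp: B_def)
    obtain a where a: "a \<in> A" "a \<in> B" using z B unfolding islimpt_def by blast
    then obtain V k where V: "open V" "connected V" "a \<in> V" "\<And>w. w \<in> V \<Longrightarrow> holo_at k w" "\<exists>w\<in>V. k w \<noteq> 0"
      "\<And>w. w \<in> V \<Longrightarrow> k w \<noteq> 0 \<Longrightarrow> f w = f' w" unfolding A_def by blast
    \<comment> \<open>Cross-multiplied difference of the two local quotients: it is holomorphic on
      the whole ball, so its vanishing near the point \<open>a\<close> of \<open>A\<close> spreads
      to \<open>B\<close>.\<close>
    define d where "d w = g w * h' w - g' w * h w" for w
    have hvd: "holo_at d w" if "w \<in> B" for w unfolding d_def using that hvs B by (intro holo_at_intros) auto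
    have "d w = 0" if w: "w \<in> V \<inter> B" for w
    proof (rule ccontr)
      assume "d w \<noteq> 0"
      have "isCont d w" using hvd w by (auto intro: holo_at_isCont)
      then have "\<forall>\<^sub>F w in at w. d w \<noteq> 0" using \<open>d w \<noteq> 0\<close>
        by (intro tendsto_imp_eventually_ne) (auto simp: isCont_def)
      then obtain Y where Y: "open Y" "w \<in> Y" "\<And>w. w \<in> Y \<Longrightarrow> d w \<noteq> 0"
        unfolding eventually_at_topological using \<open>d w \<noteq> 0\<close> by auto metis
      obtain y where y: "y \<in> Y \<inter> V \<inter> B" "k y \<noteq> 0"
        using holo_at_nonzero_dense[OF V(1,2,4,5), of "Y \<inter> V \<inter> B"] Y V(1) B(1) w by blast
      have "isCont k y" using V(4) y by (auto intro: holo_at_isCont)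
      then have "\<forall>\<^sub>F w in at y. k w \<noteq> 0" using y by (intro tendsto_imp_eventually_ne) (auto simp: isCont_def)
      then obtain Y2 where Y2: "open Y2" "y \<in> Y2" "\<And>w. w \<in> Y2 \<Longrightarrow> k w \<noteq> 0"
        unfolding eventually_at_topological using y by auto metis
      obtain x where x: "x \<in> Y \<inter> V \<inter> B \<inter> Y2" "h x * h' x \<noteq> 0"
        using dense[of "Y \<inter> V \<inter> B \<inter> Y2"] Y Y2 V(1) B y by blast
      have "f x = f' x" using V(6) Y2(3) x by blast
      moreover have "f x = g x / h x" using U(7)[of x] x B by auto
      moreover have "f' x = g' x / h' x" using U'(7)[of x] x B by auto
      ultimately have "g x / h x = g' x / h' x" by simp
      then have "d x = 0" using x by (auto simp: d_def field_simps)
      then show False using Y(3) x by blast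
    qed
    then have d0: "d w = 0" if "w \<in> B" for w
      using holo_at_identity_connected[OF B(1,2) hvd, of "V \<inter> B" w] V(1) B(1) V(3) a(2) that by blast
    show "z \<in> A" unfolding A_def
    proof (rule CollectI, rule exI[of _ B], rule exI[of _ "\<lambda>w. h w * h' w"], intro conjI ballI impI)
      show "\<exists>w\<in>B. h w * h' w \<noteq> 0" using dense[of B] B by blast
      fix w assume w: "w \<in> B"
      show "holo_at (\<lambda>w. h w * h' w) w" using hvs B w by (intro holo_at_mult) auto
      assume "h w * h' w \<noteq> 0"
      then have "f w = g w / h w" "f' w = g' w / h' w" "h w \<noteq> 0" "h' w \<noteq> 0"
        using U(7)[of w] U'(7)[of w] w B by auto
      then show "f w = f' w" using d0[OF w] by (simp add: d_def frac_eq_eq)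
    qed (use B in auto)
  qed
  \<comment> \<open>Near a regular point of \<open>f1\<close>, the holomorphic function in the
    normalisation of \<open>f2\<close> is taken to be \<open>f1\<close> itself; it has to be
    compared with \<open>f2\<close> only where \<open>f2\<close> is regular too.\<close>
  have main: "f2 z = f1 z"
    if f1: "nicely_meromorphic_vec f1" and f2: "nicely_meromorphic_vec f2" and reg: "regular_at f1 z"
      and A: "\<And>z. \<exists>V h. open V \<and> connected V \<and> z \<in> V \<and> (\<forall>w\<in>V. holo_at h w) \<and> (\<exists>w\<in>V. h w \<noteq> 0) \<and>
     (\<forall>w\<in>V. h w \<noteq> 0 \<longrightarrow> f1 w = f2 w)" for f1 f2 :: "complex^'n \<Rightarrow> complex" and z
  proof -
    obtain U where U: "open U" "z \<in> U" "\<And>w. w \<in> U \<Longrightarrow> holo_at f1 w" using reg regular_at_iff by metis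
    have "f2 w = f1 w" if w: "w \<in> U" "regular_at f2 w" for w
    proof -
      obtain U2 where U2: "open U2" "w \<in> U2" "\<And>w. w \<in> U2 \<Longrightarrow> holo_at f2 w" using w regular_at_iff by metis
      obtain V h where V: "open V" "connected V" "w \<in> V" "\<And>w. w \<in> V \<Longrightarrow> holo_at h w" "\<exists>w\<in>V. h w \<noteq> 0"
        "\<And>w. w \<in> V \<Longrightarrow> h w \<noteq> 0 \<Longrightarrow> f1 w = f2 w" using A[of w] by blast
      have "f1 w = f2 w"
        by (rule holo_at_eq_if_eq_off_zeros[OF V(1,2,4,5,6) _ _ V(3)])
          (use U(3) U2(2,3) w in \<open>auto intro: holo_at_isCont\<close>)
      then show ?thesis ..
    qed
    then show ?thesis using f2 U unfolding nicely_meromorphic_vec_def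
      by (metis holomorphic_vec_on_iff_holo_at)
  qed
  have A1: "\<exists>V h. open V \<and> connected V \<and> z \<in> V \<and> (\<forall>w\<in>V. holo_at h w) \<and> (\<exists>w\<in>V. h w \<noteq> 0) \<and>
     (\<forall>w\<in>V. h w \<noteq> 0 \<longrightarrow> f w = f' w)" for z using \<open>A = UNIV\<close> unfolding A_def by blast
  have A2: "\<exists>V h. open V \<and> connected V \<and> z \<in> V \<and> (\<forall>w\<in>V. holo_at h w) \<and> (\<exists>w\<in>V. h w \<noteq> 0) \<and>
     (\<forall>w\<in>V. h w \<noteq> 0 \<longrightarrow> f' w = f w)" for z using A1[of z] by metis
  show ?thesis
  proof
    fix z
    consider "regular_at f z" | "regular_at f' z" | "\<not> regular_at f z" "\<not> regular_at f' z" by blast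
    then show "f z = f' z"
    proof cases
      case 1 then show ?thesis using main[OF f f' _ A1] by simp
    next
      case 2 then show ?thesis using main[OF f' f _ A2] by simp
    next
      case 3 then show ?thesis using f f' unfolding nicely_meromorphic_vec_def by simp
    qed
  qed
qed

text \<open>The value at a point is read off from any local holomorphic solution \<open>k\<close> of \<open>k h = g\<close>.\<close>

lemma nicely_meromorphic_vec_exists:
  fixes A :: "nat \<Rightarrow> (complex^'n) set" and F :: "complex^'n \<Rightarrow> complex"
  assumes A: "\<And>n. open (A n)" "\<And>n. convex (A n)" "incseq A" "(\<Union>n. A n) = UNIV"
    and B: "open B" "B \<noteq> {}" "B \<subseteq> A 0"
    and g: "\<And>n z. z \<in> A n \<Longrightarrow> holo_at (g n) z" and h: "\<And>n z. holo_at (h n) z" "\<And>n. \<exists>w. h n w \<noteq> 0"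
    and F: "\<And>n z. z \<in> B \<Longrightarrow> g n z = h n z * F z"
  shows "\<exists>f. nicely_meromorphic_vec f \<and> (\<forall>n W k. open W \<longrightarrow> W \<subseteq> A n \<longrightarrow>
       (\<forall>w\<in>W. holo_at k w \<and> k w * h n w = g n w) \<longrightarrow> (\<forall>z\<in>W. f z = k z))"
proof -
  define E where "E z c \<longleftrightarrow> (\<exists>n W k. open W \<and> W \<subseteq> A n \<and> (\<forall>w\<in>W. holo_at k w) \<and>
    (\<forall>w\<in>W. k w * h n w = g n w) \<and> z \<in> W \<and> c = k z)" for z c
  \<comment> \<open>On \<open>B\<close> both sides are \<open>h n z * h m z * F z\<close>; the
    identity theorem extends the equality to the smaller domain \<open>A n\<close>.\<close>
  have cross: "g n z * h m z = g m z * h n z" if nm: "n \<le> m" "z \<in> A n" for n m z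
  proof -
    have sub: "A n \<subseteq> A m" "B \<subseteq> A n" using nm A(3) B(3) incseqD[OF A(3), of 0 n] incseqD[OF A(3), of n m] by auto
    have "g n z * h m z - g m z * h n z = 0"
      by (rule holo_at_identity_convex[OF A(1,2)[of n] _ B(1,2) sub(2) _ nm(2)])
         (use sub g h F in \<open>auto intro!: holo_at_intros\<close>)
    then show ?thesis by simp
  qed
  have cross': "g n z * h m z = g m z * h n z" if "z \<in> A n" "z \<in> A m" for n m z
    using cross[of n m z] cross[of m n z] that by (cases "n \<le> m") auto
  have hh: "\<exists>w. h n w * h m w \<noteq> 0" for n m
  proof -
    obtain x where x: "h n x \<noteq> 0" using h(2) by blast
    have "isCont (h n) x" using h(1) holo_at_isCont by blast
    then have "\<forall>\<^sub>F w in at x. h n w \<noteq> 0" using x by (intro tendsto_imp_eventually_ne) (auto simp: isCont_def)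
    then obtain Y where Y: "open Y" "x \<in> Y" "\<And>w. w \<in> Y \<Longrightarrow> h n w \<noteq> 0"
      unfolding eventually_at_topological using x by auto metis
    obtain w where "w \<in> Y" "h m w \<noteq> 0"
      using holo_at_nonzero_dense[of UNIV "h m" Y] h Y connected_UNIV by blast
    then show ?thesis using Y by auto
  qed
  have uniq: "c = c'" if c: "E z c" and c': "E z c'" for z c c'
  proof -
    obtain n W k where W: "open W" "W \<subseteq> A n" "\<And>w. w \<in> W \<Longrightarrow> holo_at k w"
      "\<And>w. w \<in> W \<Longrightarrow> k w * h n w = g n w" "z \<in> W" "c = k z" using c unfolding E_def by blast
    obtain m W' k' where W': "open W'" "W' \<subseteq> A m" "\<And>w. w \<in> W' \<Longrightarrow> holo_at k' w"
      "\<And>w. w \<in> W' \<Longrightarrow> k' w * h m w = g m w" "z \<in> W'" "c' = k' z" using c' unfolding E_def by blast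
    obtain r where r: "r > 0" "ball z r \<subseteq> W \<inter> W'" using W W' by (meson IntI open_Int openE)
    have "k z = k' z"
    proof (rule holo_at_eq_if_eq_off_zeros[where U = "ball z r" and h = "\<lambda>w. h n w * h m w"])
      show "connected (ball z r)" by (simp add: convex_connected)
      show "holo_at (\<lambda>w. h n w * h m w) w" for w by (intro holo_at_mult h)
      show "\<exists>w\<in>ball z r. h n w * h m w \<noteq> 0"
        using holo_at_nonzero_dense[of UNIV "\<lambda>w. h n w * h m w" "ball z r"] hh[of n m] r(1) h(1)
        by (auto intro: holo_at_mult connected_UNIV)
      show "isCont k z" "isCont k' z" using W W' holo_at_isCont by blast+
      show "z \<in> ball z r" using r by simp
      fix w assume w: "w \<in> ball z r" "h n w * h m w \<noteq> 0"
      then have "k w * h n w = g n w" "k' w * h m w = g m w" "g n w * h m w = g m w * h n w"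
        using W(2,4) W'(2,4) r(2) cross' by blast+
      then have "(k w * h n w) * h m w - (k' w * h m w) * h n w = 0" by simp
      then have "(k w - k' w) * (h n w * h m w) = 0" by (simp add: algebra_simps)
      then show "k w = k' w" using w by simp
    qed simp
    then show ?thesis using W W' by simp
  qed
  define f where "f z = (if \<exists>c. E z c then THE c. E z c else 0)" for z
  have fE: "f z = c" if "E z c" for z c unfolding f_def using that uniq by (auto intro: the_equality)
  have fk: "f z = k z" if "open W" "W \<subseteq> A n" "\<And>w. w \<in> W \<Longrightarrow> holo_at k w"
       "\<And>w. w \<in> W \<Longrightarrow> k w * h n w = g n w" "z \<in> W" for n W k z
    by (rule fE) (unfold E_def, use that in blast)
  have fq: "f z = g n z / h n z" if z: "z \<in> A n" "h n z \<noteq> 0" for n z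
  proof -
    have op: "open {z. h n z \<noteq> 0}"
      using continuous_at_imp_continuous_on[of UNIV "h n"] holo_at_isCont[OF h(1)[of n]]
      by (simp add: open_Collect_neq)
    show ?thesis
      by (rule fk[of "A n \<inter> {z. h n z \<noteq> 0}" n "\<lambda>z. g n z / h n z"])
         (use z op A(1) g h in \<open>auto intro!: holo_at_divide\<close>)
  qed
  \<comment> \<open>By density, a holomorphic \<open>k\<close> that matches \<open>f\<close> off the
    zeros of \<open>h n\<close> solves \<open>k * h n = g n\<close>, hence is one of the local
    solutions from which \<open>f\<close> is read off. This yields both regularity and the extension
    clause of the normalisation.\<close>
  have ext: "regular_at f z \<and> f z = k z"
    if V: "open V" "z \<in> V" "\<And>w. w \<in> V \<Longrightarrow> holo_at k w" and n: "V \<subseteq> A n"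
      and eq: "\<And>w. w \<in> V \<Longrightarrow> h n w \<noteq> 0 \<Longrightarrow> f w = k w" for V z k n
  proof -
    have eq': "k w * h n w = g n w" if w: "w \<in> V" for w
    proof -
      obtain r where r: "r > 0" "ball w r \<subseteq> V" using V w openE by metis
      show ?thesis
      proof (rule holo_at_eq_if_eq_off_zeros[where U = "ball w r" and h = "h n"])
        show "connected (ball w r)" by (simp add: convex_connected)
        show "\<exists>w\<in>ball w r. h n w \<noteq> 0"
          using holo_at_nonzero_dense[of UNIV "h n" "ball w r"] h r(1) by (auto intro: connected_UNIV)
        show "isCont (\<lambda>w. k w * h n w) w" using V w h by (intro continuous_intros holo_at_isCont) auto
        show "isCont (g n) w" using w n g by (intro holo_at_isCont) auto
        fix x assume x: "x \<in> ball w r" "h n x \<noteq> 0"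
        then have "x \<in> V" using r by auto
        then show "k x * h n x = g n x" using eq[of x] fq[of x n] x n by auto
      qed (use r h in auto)
    qed
    have "f w = k w" if "w \<in> V" for w using fk[OF V(1) n V(3) eq' that] by blast
    then have "holo_at f w" if "w \<in> V" for w using holo_at_cong[OF V(3)[OF that] V(1) that] by simp
    then show ?thesis using fk[OF V(1) n V(3) eq' V(2)] V regular_at_iff by blast
  qed
  have inA: "\<exists>n. z \<in> A n" for z using A(4) by blast
  have regq: "regular_at f z" if z: "z \<in> A n" "h n z \<noteq> 0" for n z
  proof -
    have op: "open {z. h n z \<noteq> 0}"
      using continuous_at_imp_continuous_on[of UNIV "h n"] holo_at_isCont[OF h(1)[of n]]
      by (simp add: open_Collect_neq)
    show ?thesis
    proof (rule conjunct1[OF ext[of "A n \<inter> {z. h n z \<noteq> 0}" z "\<lambda>z. g n z / h n z" n]])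
      show "open (A n \<inter> {z. h n z \<noteq> 0})" using op A(1) by blast
      show "holo_at (\<lambda>z. g n z / h n z) w" if "w \<in> A n \<inter> {z. h n z \<noteq> 0}" for w
        using that g h by (auto intro!: holo_at_divide)
    qed (use z fq in auto)
  qed
  have "nicely_meromorphic_vec f"
    unfolding nicely_meromorphic_vec_def
  proof (intro conjI allI impI)
    show "meromorphic_vec f" unfolding meromorphic_vec_def
    proof
      fix z obtain n where n: "z \<in> A n" using inA by blast
      have "\<exists>w\<in>A n. h n w \<noteq> 0"
        using holo_at_nonzero_dense[of UNIV "h n" "A n"] h A(1) n by (auto intro: connected_UNIV)
      then show "\<exists>U g h. open U \<and> connected U \<and> z \<in> U \<and> holomorphic_vec_on g U \<and> holomorphic_vec_on h U \<and>
             (\<exists>w\<in>U. h w \<noteq> 0) \<and> (\<forall>w\<in>U. h w \<noteq> 0 \<longrightarrow> f w = g w / h w)"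
        using A(1,2) n g h fq
        by (intro exI[of _ "A n"] exI[of _ "g n"] exI[of _ "h n"])
           (auto simp: holomorphic_vec_on_iff_holo_at convex_connected)
    qed
    fix U k
    assume *: "open U \<and> holomorphic_vec_on k U \<and> (\<forall>w\<in>U. regular_at f w \<longrightarrow> f w = k w)"
    show "\<forall>w\<in>U. f w = k w"
    proof
      fix w assume w: "w \<in> U"
      obtain n where n: "w \<in> A n" using inA by blast
      show "f w = k w"
        using ext[of "U \<inter> A n" w k n] * w n A(1) regq holomorphic_vec_on_iff_holo_at by blast
    qed
  next
    fix z assume nr: "\<not> regular_at f z"
    have "\<not> E z c" for c
    proof
      assume "E z c"
      then obtain n W k where W: "open W" "W \<subseteq> A n" "\<And>w. w \<in> W \<Longrightarrow> holo_at k w"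
        "\<And>w. w \<in> W \<Longrightarrow> k w * h n w = g n w" "z \<in> W" "c = k z" unfolding E_def by blast
      have "regular_at f z" using ext[OF W(1,5,3,2)] fk[OF W(1,2,3,4)] by blast
      then show False using nr by simp
    qed
    then show "f z = 0" by (simp add: f_def)
  qed
  then show ?thesis using fk by (intro exI[of _ f] conjI allI impI ballI) simp_all
qed

section \<open>Double Dirichlet series\<close>

lemma infsum_nat_suminf:
  fixes f :: "nat \<Rightarrow> complex" assumes "summable (\<lambda>n. norm (f n))"
  shows "infsum f UNIV = suminf f"
  by (rule infsumI, rule norm_summable_imp_has_sum[OF assms summable_sums[OF summable_norm_cancel[OF assms]]])

text \<open>Summability of \<open>g\<close> suffices: the index set splits into the row
  \<open>a = 0\<close> and the image of the shift, so no limit at infinity has to be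
  computed.\<close>

lemma infsum_pair_telescope:
  fixes g :: "nat \<times> nat \<Rightarrow> complex"
  assumes g: "g summable_on UNIV"
  shows "infsum (\<lambda>(a,b). g (Suc a, b) - g (a, b)) UNIV = - infsum (\<lambda>b. g (0, b)) UNIV"
    and "(\<lambda>(a,b). g (Suc a, b)) summable_on UNIV" "(\<lambda>b. g (0, b)) summable_on UNIV"
proof -
  define A where "A = range (\<lambda>b. (0 :: nat, b :: nat))"
  define B where "B = range (\<lambda>(a,b). (Suc a, b :: nat))"
  have U: "UNIV = A \<union> B" "A \<inter> B = {}"
  proof -
    have "x \<in> A \<union> B" for x by (cases x, cases "fst x") (auto simp: A_def B_def image_iff)
    then show "UNIV = A \<union> B" by blast
    show "A \<inter> B = {}" by (auto simp: A_def B_def)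
  qed
  have sA: "g summable_on A" and sB: "g summable_on B" using g summable_on_subset_banach by blast+
  have iA: "inj (\<lambda>b. (0 :: nat, b :: nat))" and iB: "inj (\<lambda>(a,b). (Suc a, b :: nat))" by (auto simp: inj_on_def)
  show s0: "(\<lambda>b. g (0, b)) summable_on UNIV"
    using sA summable_on_reindex[OF iA, of g] by (simp add: A_def o_def)
  show s1: "(\<lambda>(a,b). g (Suc a, b)) summable_on UNIV"
    using sB summable_on_reindex[OF iB, of g] by (simp add: B_def o_def case_prod_unfold)
  have "infsum g UNIV = infsum g A + infsum g B"
    unfolding U(1) using infsum_Un_disjoint[OF sA sB U(2)] .
  also have "infsum g A = infsum (\<lambda>b. g (0, b)) UNIV"
    unfolding A_def by (subst infsum_reindex[OF iA]) (simp add: o_def)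
  also have "infsum g B = infsum (\<lambda>(a,b). g (Suc a, b)) UNIV"
    unfolding B_def by (subst infsum_reindex[OF iB]) (simp add: o_def case_prod_unfold)
  finally have eq: "infsum g UNIV = infsum (\<lambda>b. g (0, b)) UNIV + infsum (\<lambda>(a,b). g (Suc a, b)) UNIV" .
  have "infsum (\<lambda>m. (case m of (a,b) \<Rightarrow> g (Suc a, b)) + - g m) UNIV =
     infsum (\<lambda>(a,b). g (Suc a, b)) UNIV + infsum (\<lambda>m. - g m) UNIV"
    by (rule infsum_add[OF s1]) (simp add: g summable_on_uminus)
  then show "infsum (\<lambda>(a,b). g (Suc a, b) - g (a, b)) UNIV = - infsum (\<lambda>b. g (0, b)) UNIV"
    using eq by (simp add: case_prod_unfold infsum_uminus)
qed

lemma suminf_telescope':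
  fixes g :: "nat \<Rightarrow> complex" assumes "summable g"
  shows "(\<Sum>b. g (Suc b) - g b) = - g 0"
  using suminf_diff[OF assms[folded summable_Suc_iff[of g]] assms] suminf_split_head[OF assms] by simp

lemma summable_on_pair_powr:
  assumes "d > 0"
  shows "(\<lambda>(a,b). (real (Suc a) * real (Suc b)) powr (-1 - d)) summable_on UNIV"
proof -
  have "summable (\<lambda>n. real n powr (-1 - d))" using assms by (subst summable_real_powr_iff) auto
  then have s: "summable (\<lambda>n. real (Suc n) powr (-1 - d))" by (subst summable_Suc_iff)
  define T where "T = (\<Sum>n. real (Suc n) powr (-1 - d))"
  have hs: "((\<lambda>n. real (Suc n) powr (-1 - d)) has_sum T) UNIV"
    unfolding T_def using s by (intro norm_summable_imp_has_sum summable_sums) auto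
  have "(\<lambda>(a,b). (real (Suc a) * real (Suc b)) powr (-1 - d)) summable_on (Sigma UNIV (\<lambda>_. UNIV))"
  proof (rule summable_on_SigmaI)
    fix a :: nat
    show "((\<lambda>b. case (a, b) of (a, b) \<Rightarrow> (real (Suc a) * real (Suc b)) powr (- 1 - d)) has_sum
          real (Suc a) powr (-1 - d) * T) UNIV"
      using has_sum_cmult_right[OF hs, of "real (Suc a) powr (-1 - d)"] by (simp add: powr_mult del: of_nat_Suc)
    show "(\<lambda>a. real (Suc a) powr (-1 - d) * T) summable_on UNIV"
      using summable_on_cmult_left[OF has_sum_imp_summable[OF hs]] .
  qed auto
  then show ?thesis by simp
qed

text \<open>Weights of mean zero can be integrated by parts over a unit interval without boundary terms.\<close>

lemma antiderivative_mean_zero: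
  fixes P :: "real \<Rightarrow> complex"
  assumes P: "continuous_on {0..1} P" "integral {0..1} P = 0"
  obtains V where "continuous_on {0..1} V" "integral {0..1} V = 0"
    "\<And>f f'. (\<And>u. u \<in> {0..1} \<Longrightarrow> (f has_vector_derivative f' u) (at u within {0..1})) \<Longrightarrow>
       continuous_on {0..1} f' \<Longrightarrow>
       integral {0..1} (\<lambda>u. P u * f u) = V 0 * (f 1 - f 0) - integral {0..1} (\<lambda>u. V u * f' u)"
proof -
  obtain g where g: "\<And>x. x \<in> {0..1} \<Longrightarrow> (g has_vector_derivative P x) (at x within {0..1})"
    using antiderivative_continuous[OF P(1)] by blast
  have cg: "continuous_on {0..1} g"
    using g has_vector_derivative_continuous continuous_on_eq_continuous_within by blast
  \<comment> \<open>Subtracting the mean makes \<open>V\<close> mean zero again, so the lemma can be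
    iterated. Mean zero of \<open>P\<close> gives \<open>V 1 = V 0\<close>, and what remains at the
    ends is a multiple of \<open>f 1 - f 0\<close>, which telescopes over neighbouring
    cells.\<close>
  define c where "c = integral {0..1} g"
  define V where "V u = g u - c" for u
  have cV: "continuous_on {0..1} V" unfolding V_def by (intro continuous_intros cg)
  have mV: "integral {0..1} V = 0"
    unfolding V_def using cg by (subst integral_diff) (auto intro: integrable_continuous_interval simp: c_def)
  have dV: "(V has_vector_derivative P x) (at x within {0..1})" if "x \<in> {0..1}" for x
    unfolding V_def using g[OF that] by (auto intro!: derivative_eq_intros)
  have "(P has_integral (V 1 - V 0)) {0..1}"
    by (rule fundamental_theorem_of_calculus) (use dV in auto)
  then have V01: "V 1 = V 0" using P(2) by (simp add: integral_unique)
  show ?thesis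
  proof (rule that[OF cV mV])
    fix f f' :: "real \<Rightarrow> complex"
    assume f: "\<And>u. u \<in> {0..1} \<Longrightarrow> (f has_vector_derivative f' u) (at u within {0..1})"
      and cf': "continuous_on {0..1} f'"
    have cf: "continuous_on {0..1} f"
      using f has_vector_derivative_continuous continuous_on_eq_continuous_within by blast
    have "((\<lambda>u. V u * f' u + P u * f u) has_integral (V 1 * f 1 - V 0 * f 0)) {0..1}"
      by (rule fundamental_theorem_of_calculus) (use has_vector_derivative_mult[OF dV f] in auto)
    then have "integral {0..1} (\<lambda>u. V u * f' u + P u * f u) = V 0 * (f 1 - f 0)"
      using V01 by (simp add: integral_unique algebra_simps)
    moreover have "integral {0..1} (\<lambda>u. V u * f' u + P u * f u) =
       integral {0..1} (\<lambda>u. V u * f' u) + integral {0..1} (\<lambda>u. P u * f u)"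
      by (rule integral_add) (intro integrable_continuous_interval continuous_intros cV cf' P(1) cf)+
    ultimately show "integral {0..1} (\<lambda>u. P u * f u) = V 0 * (f 1 - f 0) - integral {0..1} (\<lambda>u. V u * f' u)"
      by (simp add: algebra_simps)
  qed
qed

text \<open>First-order Euler-Maclaurin formula on one cell: the kernel \<open>u - 1\<close>
  vanishes at 1, so partial integration leaves only the value at 0.\<close>

lemma integral_eq_left_endpoint:
  fixes f f' :: "real \<Rightarrow> complex"
  assumes f: "\<And>u. u \<in> {0..1} \<Longrightarrow> (f has_vector_derivative f' u) (at u within {0..1})"
    and cf': "continuous_on {0..1} f'"
  shows "f 0 = integral {0..1} f + integral {0..1} (\<lambda>u. (of_real u - 1) * f' u)"
proof -
  have cf: "continuous_on {0..1} f"
    using f has_vector_derivative_continuous continuous_on_eq_continuous_within by blast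
  have d: "((\<lambda>u. (of_real u - 1) * f u) has_vector_derivative ((of_real u - 1) * f' u +
    1 * f u)) (at u within {0..1})"
    if "u \<in> {0..1}" for u
    by (rule has_vector_derivative_mult[OF _ f[OF that]])
       (auto intro!: derivative_eq_intros simp: has_vector_derivative_def scaleR_conv_of_real)
  have "((\<lambda>u. (of_real u - 1) * f' u + 1 * f u) has_integral ((of_real 1 - 1) * f 1 - (of_real 0 - 1) * f
    0)) {0..1}"
    by (rule fundamental_theorem_of_calculus[of 0 1 "\<lambda>u. (of_real u - 1) * f u"]) (use d in auto)
  then have "integral {0..1} (\<lambda>u. (of_real u - 1) * f' u + 1 * f u) = f 0"
    by (simp add: integral_unique)
  moreover have "integral {0..1} (\<lambda>u. (of_real u - 1) * f' u + 1 * f u) =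
     integral {0..1} (\<lambda>u. (of_real u - 1) * f' u) + integral {0..1} (\<lambda>u. 1 * f u)"
    by (rule integral_add) (intro integrable_continuous_interval continuous_intros cf' cf)+
  ultimately show ?thesis by simp
qed

section \<open>Decay exponents, domain of convergence and the homogeneous summand\<close>

text \<open>\<open>wA\<close>, \<open>wB\<close> and \<open>wT\<close> are the decay exponents of a summand along the directions
  \<open>m\<^sub>2 \<rightarrow> \<infinity>\<close>, \<open>m\<^sub>1 \<rightarrow> \<infinity>\<close>, and both at once.\<close>

definition wA :: "complex^4 \<Rightarrow> complex" where "wA z = z$2 + z$3 + z$4"
definition wB :: "complex^4 \<Rightarrow> complex" where "wB z = z$1 + z$3 + z$4"
definition wT :: "complex^4 \<Rightarrow> complex" where "wT z = z$1 + z$2 + z$3 + z$4"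

text \<open>The exact domain of absolute convergence, as \<open>PSp2_summable\<close> and
  \<open>PSp2_summable_imp_conv_dom\<close> show. Moving both indices at once is a two-dimensional
  sum, hence the bound 2 for \<open>wT\<close>.\<close>

definition conv_dom :: "(complex^4) set" where
  "conv_dom = {z. Re (wA z) > 1 \<and> Re (wB z) > 1 \<and> Re (wT z) > 2}"

abbreviation ax :: "4 \<Rightarrow> complex^4" where "ax j \<equiv> axis j 1"

lemma ax_nth: "ax j $ k = (if k = j then 1 else 0)" by (simp add: axis_def)

lemma four_neq [simp]: "(1::4) \<noteq> 2" "(1::4) \<noteq> 3" "(1::4) \<noteq> 4" "(2::4) \<noteq> 3" "(2::4) \<noteq> 4" "(3::4) \<noteq> 4"
   "(2::4) \<noteq> 1" "(3::4) \<noteq> 1" "(4::4) \<noteq> 1" "(3::4) \<noteq> 2" "(4::4) \<noteq> 2" "(4::4) \<noteq> 3" by auto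

lemma w_add: "wA (z + e) = wA z + wA e" "wB (z + e) = wB z + wB e" "wT (z + e) = wT z + wT e"
  by (auto simp: wA_def wB_def wT_def)

lemma w_diff: "wA (z - e) = wA z - wA e" "wB (z - e) = wB z - wB e" "wT (z - e) = wT z - wT e"
  by (auto simp: wA_def wB_def wT_def)

lemma w_ax: "wA (ax 1) = 0" "wA (ax 2) = 1" "wA (ax 3) = 1" "wA (ax 4) = 1"
  "wB (ax 1) = 1" "wB (ax 2) = 0" "wB (ax 3) = 1" "wB (ax 4) = 1"
  "wT (ax 1) = 1" "wT (ax 2) = 1" "wT (ax 3) = 1" "wT (ax 4) = 1"
  by (auto simp: wA_def wB_def wT_def ax_nth)

lemma holo_at_w: "holo_at wA z" "holo_at wB z" "holo_at wT z"
  unfolding wA_def[abs_def] wB_def[abs_def] wT_def[abs_def] by (intro holo_at_intros)+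

text \<open>The summand, with both linear forms in the range \<open>[1, 2]\<close> of coefficients so that the class is closed
  under exchanging the two variables. The series over \<open>PSp2_index\<close> is, up to the factor \<open>exp (- z$1 * ln 2)\<close>,
  the case \<open>(c3, d3, c4, d4) = (2, 1, 2, 2)\<close>, \<open>(\<alpha>, \<beta>) = (1/2, 1)\<close>, where \<open>m\<^sub>1 = 2 (a + \<alpha>)\<close>.\<close>

locale conical =
  fixes c3 d3 c4 d4 \<alpha> \<beta> :: real
  assumes c3: "1 \<le> c3" "c3 \<le> 2" and d3: "1 \<le> d3" "d3 \<le> 2" and c4: "1 \<le> c4" "c4 \<le> 2" and d4: "1 \<le> d4" "d4 \<le> 2"
    and al: "1/2 \<le> \<alpha>" "\<alpha> \<le> 1" and be: "1/2 \<le> \<beta>" "\<beta> \<le> 1"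
begin

definition \<phi> :: "complex^4 \<Rightarrow> real \<Rightarrow> real \<Rightarrow> complex" where
  "\<phi> z x y = exp (- (z$1 * of_real (ln x) + z$2 * of_real (ln y) +
     z$3 * of_real (ln (c3 * x + d3 * y)) + z$4 * of_real (ln (c4 * x + d4 * y))))"

lemma pos3: "x > 0 \<Longrightarrow> y > 0 \<Longrightarrow> c3 * x + d3 * y > 0" using c3 d3 by (simp add: add_pos_pos)
lemma pos4: "x > 0 \<Longrightarrow> y > 0 \<Longrightarrow> c4 * x + d4 * y > 0" using c4 d4 by (simp add: add_pos_pos)

lemma phi_shift:
  assumes "x > 0" "y > 0"
  shows "\<phi> (z + ax 1) x y = \<phi> z x y / of_real x" "\<phi> (z + ax 2) x y = \<phi> z x y / of_real y"
    "\<phi> (z + ax 3) x y = \<phi> z x y / of_real (c3 * x + d3 * y)"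
    "\<phi> (z + ax 4) x y = \<phi> z x y / of_real (c4 * x + d4 * y)"
    "\<phi> (z - ax 1) x y = \<phi> z x y * of_real x" "\<phi> (z - ax 2) x y = \<phi> z x y * of_real y"
proof -
  have *: "exp (- (a + complex_of_real (ln w))) = exp (- a) / of_real w"
    "exp (- (a - complex_of_real (ln w))) = exp (- a) * of_real w" if "w > 0" for a w
    using that by (simp_all add: exp_diff exp_of_real exp_add exp_minus divide_inverse)
  have r: "z$1 * a + z$2 * b + z$3 * c + (z$4 + 1) * d = (z$1 * a + z$2 * b + z$3 * c + z$4 * d) + d"
     "z$1 * a + z$2 * b + (z$3 + 1) * c + z$4 * d = (z$1 * a + z$2 * b + z$3 * c + z$4 * d) + c"
     "z$1 * a + (z$2 + 1) * b + z$3 * c + z$4 * d = (z$1 * a + z$2 * b + z$3 * c + z$4 * d) + b"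
     "(z$1 + 1) * a + z$2 * b + z$3 * c + z$4 * d = (z$1 * a + z$2 * b + z$3 * c + z$4 * d) + a"
     "z$1 * a + (z$2 - 1) * b + z$3 * c + z$4 * d = (z$1 * a + z$2 * b + z$3 * c + z$4 * d) - b"
     "(z$1 - 1) * a + z$2 * b + z$3 * c + z$4 * d = (z$1 * a + z$2 * b + z$3 * c + z$4 * d) - a" for a b c d
    by (simp_all add: algebra_simps)
  note p = assms pos3[OF assms] pos4[OF assms]
  show "\<phi> (z + ax 1) x y = \<phi> z x y / of_real x" "\<phi> (z + ax 2) x y = \<phi> z x y / of_real y"
    "\<phi> (z + ax 3) x y = \<phi> z x y / of_real (c3 * x + d3 * y)"
    "\<phi> (z + ax 4) x y = \<phi> z x y / of_real (c4 * x + d4 * y)"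
    "\<phi> (z - ax 1) x y = \<phi> z x y * of_real x" "\<phi> (z - ax 2) x y = \<phi> z x y * of_real y"
    unfolding \<phi>_def vector_add_component vector_minus_component ax_nth
    using p by (simp_all only: four_neq if_True if_False add_0_right diff_zero refl r *)
qed

text \<open>The linear form divided by itself. Integrated and summed, this merges the corrections of
  the two Euler identities in \<open>J_one_one_euler\<close>.\<close>

lemma phi_form:
  assumes "x > 0" "y > 0"
  shows "of_real c3 * \<phi> (z - ax 1 + ax 3) x y + of_real d3 * \<phi> (z - ax 2 + ax 3) x y = \<phi> z x y"
    "of_real c4 * \<phi> (z - ax 1 + ax 4) x y + of_real d4 * \<phi> (z - ax 2 + ax 4) x y = \<phi> z x y"
proof -
  have *: "c * (p * x / f) + d * (p * y / f) = p" if "f = c * x + d * y" "f \<noteq> 0" for c d p x y f :: complex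
    using that by (simp add: divide_simps) (simp add: algebra_simps)
  show "of_real c3 * \<phi> (z - ax 1 + ax 3) x y + of_real d3 * \<phi> (z - ax 2 + ax 3) x y = \<phi> z x y"
    unfolding phi_shift[OF assms] using pos3[OF assms]
    by (intro *) (simp_all del: of_real_add of_real_mult, simp)
  show "of_real c4 * \<phi> (z - ax 1 + ax 4) x y + of_real d4 * \<phi> (z - ax 2 + ax 4) x y = \<phi> z x y"
    unfolding phi_shift[OF assms] using pos4[OF assms]
    by (intro *) (simp_all del: of_real_add of_real_mult, simp)
qed

lemma continuous_on_phi [continuous_intros]:
  assumes "continuous_on S f" "continuous_on S g" "\<And>s. s \<in> S \<Longrightarrow> f s > 0" "\<And>s. s \<in> S \<Longrightarrow> g s > 0"
  shows "continuous_on S (\<lambda>s. \<phi> z (f s) (g s))"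
proof -
  have "f s \<noteq> 0" "g s \<noteq> 0" "c3 * f s + d3 * g s \<noteq> 0" "c4 * f s + d4 * g s \<noteq> 0" if "s \<in> S" for s
    using assms(3,4)[OF that] pos3 pos4 by (auto simp: less_imp_neq[THEN not_sym])
  then show ?thesis unfolding \<phi>_def using assms(1,2) by (intro continuous_intros) auto
qed

text \<open>The partial derivative in \<open>x\<close>, written with shifted exponents so that
  integrating it against a weight gives integrals of the same family.\<close>

definition phix where
  "phix z x y = - (z$1 * \<phi> (z + ax 1) x y + of_real c3 * z$3 * \<phi> (z + ax 3) x y +
    of_real c4 * z$4 * \<phi> (z + ax 4) x y)"

definition phiy where
  "phiy z x y = - (z$2 * \<phi> (z + ax 2) x y + of_real d3 * z$3 * \<phi> (z + ax 3) x y +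
    of_real d4 * z$4 * \<phi> (z + ax 4) x y)"

lemma phi_deriv:
  assumes "x > 0" "y > 0"
  shows "((\<lambda>x. \<phi> z x y) has_vector_derivative phix z x y) (at x within S)"
    "((\<lambda>y. \<phi> z x y) has_vector_derivative phiy z x y) (at y within S)"
proof -
  note p = assms pos3[OF assms] pos4[OF assms]
  define l where "l x y = - (z$1 * of_real (ln x) + z$2 * of_real (ln y) +
     z$3 * of_real (ln (c3 * x + d3 * y)) + z$4 * of_real (ln (c4 * x + d4 * y)))" for x y
  have ph: "\<phi> z x y = exp (l x y)" for x y by (simp add: \<phi>_def l_def)
  have ld: "((\<lambda>t. complex_of_real (ln (c * t + d))) has_vector_derivative of_real (c / (c * t +
    d))) (at t within S)"
    if "c * t + d > 0" for c t d S
    using that by (intro has_vector_derivative_of_real)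
      (auto intro!: derivative_eq_intros simp: has_real_derivative_iff_has_vector_derivative[symmetric]
        divide_inverse)
  have ld0: "((\<lambda>t. complex_of_real (ln t)) has_vector_derivative of_real (1 / t)) (at t within S)"
    if "t > 0" for t S using ld[of 1 t 0 S] that by simp
  have dx: "((\<lambda>x. l x y) has_vector_derivative
      - (z$1 * of_real (1 / x) + 0 + z$3 * of_real (c3 / (c3 * x + d3 * y)) +
        z$4 * of_real (c4 / (c4 * x + d4 * y)))) (at x within S)"
    unfolding l_def using p
    by (intro has_vector_derivative_minus has_vector_derivative_add has_vector_derivative_const
        bounded_linear.has_vector_derivative[OF bounded_linear_mult_right] ld ld0)
  have dy: "((\<lambda>y. l x y) has_vector_derivative
      - (0 + z$2 * of_real (1 / y) + z$3 * of_real (d3 / (d3 * y + c3 * x)) +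
        z$4 * of_real (d4 / (d4 * y + c4 * x)))) (at y within S)"
    unfolding l_def using p
    unfolding add.commute[of "c3 * x"] add.commute[of "c4 * x"]
    by (intro has_vector_derivative_minus has_vector_derivative_add has_vector_derivative_const
        bounded_linear.has_vector_derivative[OF bounded_linear_mult_right] ld ld0)
  have ex: "(exp has_field_derivative exp w) (at w within A)" for w :: complex and A
    by (rule DERIV_subset[OF DERIV_exp]) simp
  show "((\<lambda>x. \<phi> z x y) has_vector_derivative phix z x y) (at x within S)"
    unfolding ph using field_vector_diff_chain_within[OF dx ex, unfolded o_def]
    by (rule has_vector_derivative_eq_rhs) (simp add: phix_def phi_shift[OF assms] ph algebra_simps)
  show "((\<lambda>y. \<phi> z x y) has_vector_derivative phiy z x y) (at y within S)"
    unfolding ph using field_vector_diff_chain_within[OF dy ex, unfolded o_def]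
    by (rule has_vector_derivative_eq_rhs) (simp add: phiy_def phi_shift[OF assms] ph algebra_simps)
qed

text \<open>Each argument agrees with \<open>Suc a\<close>, \<open>Suc b\<close> or their maximum up
  to a factor 8 (coefficients at most 2, variables at most twice the index), so each of the four
  logarithms is off by at most \<open>ln 8\<close>.\<close>

lemma phi_bound:
  fixes z :: "complex^4"
  assumes "\<And>j. \<bar>Re (z$j)\<bar> \<le> K" "u \<in> {0..1}" "t \<in> {0..1}"
  shows "norm (\<phi> z (\<alpha> + real a + u) (\<beta> + real b + t)) \<le> exp (4 * K * ln 8) *
     exp (- (Re (z$1) * ln (Suc a) + Re (z$2) * ln (Suc b) + Re (z$3 + z$4) * ln (max (Suc a) (Suc b))))"
proof -
  define x where "x = \<alpha> + real a + u"
  define y where "y = \<beta> + real b + t"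
  define A where "A = real (Suc a)" define B where "B = real (Suc b)"
  have x: "A / 2 \<le> x" "x \<le> 2 * A" and y: "B / 2 \<le> y" "y \<le> 2 * B" and A: "A \<ge> 1" "B \<ge> 1"
    using assms(2,3) al be by (auto simp: x_def y_def A_def B_def)
  define M where "M = max A B"
  have M: "M \<ge> 1" "A \<le> M" "B \<le> M" "M = A \<or> M = B" using A by (auto simp: M_def)
  have form: "M / 2 \<le> c * x + d * y" "c * x + d * y \<le> 8 * M" if "1 \<le> c" "c \<le> 2" "1 \<le> d" "d \<le> 2" for c d
  proof -
    have "1 * x \<le> c * x" "1 * y \<le> d * y" "c * x \<le> 2 * x" "d * y \<le> 2 * y"
      using that x y A by (auto intro!: mult_right_mono)
    then show "M / 2 \<le> c * x + d * y" "c * x + d * y \<le> 8 * M" using x y A M by linarith+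
  qed
  have lnb: "\<bar>ln w - ln N\<bar> \<le> ln 8" if w: "N / 2 \<le> w" "w \<le> 8 * N" "N \<ge> 1" for w N :: real
  proof -
    have "w > 0" using w by auto
    have "ln w \<le> ln (8 * N)" using w \<open>w > 0\<close> by simp
    also have "\<dots> = ln 8 + ln N" using w by (simp add: ln_mult)
    finally have 1: "ln w \<le> ln 8 + ln N" .
    have "ln N \<le> ln (8 * w)" using w \<open>w > 0\<close> by simp
    also have "\<dots> = ln 8 + ln w" using \<open>w > 0\<close> by (simp add: ln_mult)
    finally show ?thesis using 1 by auto
  qed
  have pr: "- (\<sigma> * ln w) \<le> K * ln 8 - \<sigma> * ln N" if "\<bar>\<sigma>\<bar> \<le> K" "\<bar>ln w - ln N\<bar> \<le> ln 8" for \<sigma> w N :: real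
  proof -
    have "\<bar>\<sigma> * (ln w - ln N)\<bar> \<le> K * ln 8" unfolding abs_mult using that by (intro mult_mono) auto
    then show ?thesis by (simp add: algebra_simps abs_le_iff)
  qed
  have "norm (\<phi> z x y) = exp (- (Re (z$1) * ln x + Re (z$2) * ln y + Re (z$3) * ln (c3 * x + d3 * y) +
    Re (z$4) * ln (c4 * x + d4 * y)))"
    by (simp add: \<phi>_def)
  also have "\<dots> \<le> exp (4 * (K * ln 8) - (Re (z$1) * ln A + Re (z$2) * ln B + Re (z$3) * ln M + Re (z$4) * ln M))"
    using pr[OF assms(1) lnb, of A x 1] pr[OF assms(1) lnb, of B y 2]
      pr[OF assms(1) lnb, of M "c3 * x + d3 * y" 3] pr[OF assms(1) lnb, of M "c4 * x + d4 * y" 4]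
      x y A M(1) form[OF c3 d3] form[OF c4 d4] by simp
  finally have *: "norm (\<phi> z x y) \<le> exp (4 * (K * ln 8) - (Re (z$1) * ln A + Re (z$2) * ln B +
    Re (z$3) * ln M + Re (z$4) * ln M))" .
  have Mm: "M = real (max (Suc a) (Suc b))" by (simp add: M_def A_def B_def of_nat_max)
  have "4 * (K * ln 8) - (Re (z$1) * ln A + Re (z$2) * ln B + Re (z$3) * ln M + Re (z$4) * ln M) =
    4 * K * ln 8 + - (Re (z$1) * ln A + Re (z$2) * ln B + Re (z$3 + z$4) * ln M)" by (simp add: algebra_simps)
  then have "exp (4 * (K * ln 8) - (Re (z$1) * ln A + Re (z$2) * ln B + Re (z$3) * ln M + Re (z$4) * ln M)) =
    exp (4 * K * ln 8) * exp (- (Re (z$1) * ln A + Re (z$2) * ln B + Re (z$3 + z$4) * ln M))"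
    by (simp only: exp_add)
  with * show ?thesis unfolding Mm A_def B_def x_def y_def by (simp only:)
qed

text \<open>In the logarithmic coordinates \<open>p\<close>, \<open>q\<close> the exponent is linear
  on each of the cones \<open>p \<le> q\<close> and \<open>q \<le> p\<close>, so it suffices to
  compare on the extremal rays; these comparisons are the conditions on \<open>wA\<close>,
  \<open>wB\<close> and \<open>wT\<close>.\<close>

lemma phi_bound_powr:
  fixes z :: "complex^4"
  assumes "\<And>j. \<bar>Re (z$j)\<bar> \<le> K" "u \<in> {0..1}" "t \<in> {0..1}"
    and w: "Re (wA z) \<ge> 1 + \<delta>" "Re (wB z) \<ge> 1 + \<delta>" "Re (wT z) \<ge> 2 + 2 * \<delta>"
  shows "norm (\<phi> z (\<alpha> + real a + u) (\<beta> + real b + t)) \<le>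
     exp (4 * K * ln 8) * (real (Suc a) * real (Suc b)) powr (-1 - \<delta>)"
proof -
  define p where "p = ln (real (Suc a))" define q where "q = ln (real (Suc b))"
  define m where "m = ln (real (max (Suc a) (Suc b)))"
  have pq: "p \<ge> 0" "q \<ge> 0" "m = (if p \<le> q then q else p)" by (auto simp: p_def q_def m_def max_def)
  have key: "s1 * p + s2 * q + s3 * m \<ge> (1 + \<delta>) * (p + q)"
    if "s2 + s3 \<ge> 1 + \<delta>" "s1 + s3 \<ge> 1 + \<delta>" "s1 + s2 + s3 \<ge> 2 + 2 * \<delta>" for s1 s2 s3
  proof (cases "p \<le> q")
    case True
    have "(s2 + s3 - (1 + \<delta>)) * (q - p) \<ge> 0" "(s1 + s2 + s3 - (2 + 2 * \<delta>)) * p \<ge> 0"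
      using that pq True by (auto intro!: mult_nonneg_nonneg)
    then show ?thesis using True pq by (simp add: algebra_simps)
  next
    case False
    have "(s1 + s3 - (1 + \<delta>)) * (p - q) \<ge> 0" "(s1 + s2 + s3 - (2 + 2 * \<delta>)) * q \<ge> 0"
      using that pq False by (auto intro!: mult_nonneg_nonneg)
    then show ?thesis using False pq by (simp add: algebra_simps)
  qed
  have "(real (Suc a) * real (Suc b)) powr (-1 - \<delta>) = exp (- ((1 + \<delta>) * (p + q)))"
    by (simp add: powr_def p_def q_def ln_mult algebra_simps del: of_nat_Suc)
  moreover have "exp (- (Re (z$1) * p + Re (z$2) * q + Re (z$3 + z$4) * m)) \<le> exp (- ((1 + \<delta>) * (p + q)))"
    using key[of "Re (z$2)" "Re (z$3 + z$4)" "Re (z$1)"] w by (simp add: wA_def wB_def wT_def algebra_simps)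
  ultimately show ?thesis
    using phi_bound[OF assms(1-3), of a b] unfolding p_def q_def m_def
    by (smt (verit, best) exp_ge_zero mult_left_mono)
qed

end

text \<open>Five summands are the most that occur; shorter identities are padded with
  \<open>0 * 0\<close> to fit.\<close>

lemma integral_lincomb5:
  fixes f1 f2 f3 f4 f5 :: "real \<Rightarrow> complex"
  assumes "continuous_on {0..1} f1" "continuous_on {0..1} f2" "continuous_on {0..1} f3"
    "continuous_on {0..1} f4" "continuous_on {0..1} f5"
  shows "integral {0..1} (\<lambda>t. a1 * f1 t + a2 * f2 t + a3 * f3 t + a4 * f4 t + a5 * f5 t) =
    a1 * integral {0..1} f1 + a2 * integral {0..1} f2 + a3 * integral {0..1} f3 +
      a4 * integral {0..1} f4 + a5 * integral {0..1} f5"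
  by (rule integral_unique, intro has_integral_add has_integral_mult_right integrable_integral
    integrable_continuous_interval assms)

lemma infsum_lincomb5:
  fixes f1 f2 f3 f4 f5 :: "'a \<Rightarrow> complex"
  assumes "f1 summable_on A" "f2 summable_on A" "f3 summable_on A" "f4 summable_on A" "f5 summable_on A"
  shows "infsum (\<lambda>t. a1 * f1 t + a2 * f2 t + a3 * f3 t + a4 * f4 t + a5 * f5 t) A =
    a1 * infsum f1 A + a2 * infsum f2 A + a3 * infsum f3 A + a4 * infsum f4 A + a5 * infsum f5 A"
  by (rule infsumI, intro has_sum_add has_sum_cmult_right has_sum_infsum assms)

lemma continuous_bound_unit:
  fixes P :: "real \<Rightarrow> complex" assumes "continuous_on {0..1} P"
  obtains C where "C \<ge> 0" "\<And>u. u \<in> {0..1} \<Longrightarrow> norm (P u) \<le> C"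
proof -
  have "bounded (P ` {0..1})" using assms compact_continuous_image compact_imp_bounded by blast
  then obtain C where "\<And>u. u \<in> {0..1} \<Longrightarrow> norm (P u) \<le> C" unfolding bounded_iff by blast
  then show ?thesis using that[of C] norm_ge_zero[of "P 0"]
    by (meson atLeastAtMost_iff order_refl order_trans zero_le_one)
qed

lemma holo_at_infsum_nat:
  fixes f :: "nat \<Rightarrow> complex^'n \<Rightarrow> complex"
  assumes r: "r > 0" and f: "\<And>n x. x \<in> ball z r \<Longrightarrow> holo_at (f n) x"
    and M: "summable M" "\<And>n x. x \<in> ball z r \<Longrightarrow> norm (f n x) \<le> M n"
  shows "holo_at (\<lambda>z. infsum (\<lambda>m. f m z) UNIV) z"
proof (rule holo_at_cong[OF holo_at_suminf[OF r f M]])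
  fix x assume x: "x \<in> ball z r"
  have "summable (\<lambda>n. norm (f n x))" by (rule summable_comparison_test'[OF M(1), of 0]) (use M(2)[OF x] in auto)
  then show "(\<Sum>n. f n x) = infsum (\<lambda>m. f m x) UNIV" by (rule infsum_nat_suminf[symmetric])
qed (use r in auto)

lemma Re_w_le_norm: "\<bar>Re (wA z) - Re (wA x)\<bar> \<le> 4 * norm (x - z)" "\<bar>Re (wB z) - Re (wB x)\<bar> \<le> 4 * norm (x - z)"
  "\<bar>Re (wT z) - Re (wT x)\<bar> \<le> 4 * norm (x - z)"
proof -
  have *: "\<bar>Re (z $ j) - Re (x $ j)\<bar> \<le> norm (x - z)" for j
  proof -
    have "\<bar>Re (z $ j) - Re (x $ j)\<bar> = \<bar>Re ((x - z) $ j)\<bar>" by simp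
    also have "\<dots> \<le> norm ((x - z) $ j)" by (rule abs_Re_le_cmod)
    also have "\<dots> \<le> norm (x - z)" by (rule Finite_Cartesian_Product.norm_nth_le)
    finally show ?thesis .
  qed
  show "\<bar>Re (wA z) - Re (wA x)\<bar> \<le> 4 * norm (x - z)" "\<bar>Re (wB z) - Re (wB x)\<bar> \<le> 4 * norm (x - z)"
    "\<bar>Re (wT z) - Re (wT x)\<bar> \<le> 4 * norm (x - z)"
    unfolding wA_def wB_def wT_def using *[of 1] *[of 2] *[of 3] *[of 4] norm_ge_zero[of "x - z"] by auto
qed

section \<open>Weighted integrals over unit cells and over segments of rows\<close>

context conical begin

text \<open>Stages between integral and lattice sum: \<open>cell\<close> averages over both
  variables, \<open>edge\<close> over \<open>y\<close> only, \<open>pt\<close> samples at the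
  lattice point. The weights stay general because each integration by parts replaces them.\<close>

definition cell where
  "cell P Q z = (\<lambda>(a,b). integral {0..1} (\<lambda>t. Q t * integral {0..1} (\<lambda>u. P u * \<phi> z (\<alpha> + real a + u) (\<beta> +
    real b + t))))"
definition edge where
  "edge Q z = (\<lambda>(a,b). integral {0..1} (\<lambda>t. Q t * \<phi> z (\<alpha> + real a) (\<beta> + real b + t)))"
definition pt where "pt z = (\<lambda>(a,b). \<phi> z (\<alpha> + real a) (\<beta> + real b))"

lemma posx: "u \<in> {0..1} \<Longrightarrow> \<alpha> + real a + u > 0" "\<alpha> + real a > 0" using al by auto
lemma posy: "u \<in> {0..1} \<Longrightarrow> \<beta> + real a + u > 0" "\<beta> + real a > 0" using be by auto

lemma cont_inner:
  assumes "continuous_on {0..1} P"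
  shows "continuous_on {0..1} (\<lambda>t. integral {0..1} (\<lambda>u. P u * \<phi> z (\<alpha> + real a + u) (\<beta> + real b + t)))"
proof -
  have "continuous_on ({0..1} \<times> cbox 0 1) (\<lambda>(t,u). P u * \<phi> z (\<alpha> + real a + u) (\<beta> + real b + t))"
    unfolding split_beta
    by (intro continuous_intros continuous_on_compose2[OF assms]) (use posx posy in auto)
  from integral_continuous_on_param[OF this] show ?thesis by simp
qed

lemma cell_prod:
  assumes "continuous_on {0..1} P" "continuous_on {0..1} Q"
  shows "cell P Q z (a,b) = integral (cbox (0,0) (1,1)) (\<lambda>(t,u). Q t * P u * \<phi> z (\<alpha> + real a + u) (\<beta> +
    real b + t))"
proof -
  have "continuous_on (cbox (0,0) (1,1)) (\<lambda>(t,u). Q t * P u * \<phi> z (\<alpha> + real a + u) (\<beta> + real b + t))"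
    unfolding split_beta cbox_Pair_eq
    by (intro continuous_intros continuous_on_compose2[OF assms(1)] continuous_on_compose2[OF assms(2)])
      (use posx posy in auto)
  from integral_prod_continuous[OF this] show ?thesis
    by (simp add: cell_def mult.assoc)
qed

lemma phi_sum: "\<phi> z x y = exp (- (\<Sum>j\<in>UNIV. z $ j * of_real (ln (if j = 1 then x else if j = 2 then y
    else if j = 3 then c3 * x + d3 * y else c4 * x + d4 * y))))"
  unfolding \<phi>_def sum_4 by simp

lemma holo_at_phi: "holo_at (\<lambda>z. \<phi> z x y) z" unfolding \<phi>_def by (intro holo_at_intros)

lemma holo_at_cell:
  assumes "continuous_on {0..1} P" "continuous_on {0..1} Q"
  shows "holo_at (\<lambda>z. cell P Q z (a,b)) z"
proof -
  define l :: "4 \<Rightarrow> real \<times> real \<Rightarrow> complex" where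
    "l j = (\<lambda>(t,u). of_real (ln (if j = 1 then \<alpha> + real a + u else if j = 2 then \<beta> + real b + t
    else if j = 3 then c3 * (\<alpha> + real a + u) + d3 * (\<beta> + real b + t) else c4 * (\<alpha> + real a + u) +
      d4 * (\<beta> + real b + t))))" for j
  have p: "\<alpha> + real a + u > 0" "\<beta> + real b + t > 0" "c3 * (\<alpha> + real a + u) + d3 * (\<beta> + real b + t) > 0"
     "c4 * (\<alpha> + real a + u) + d4 * (\<beta> + real b + t) > 0" if "u \<in> {0..1}" "t \<in> {0..1}" for u t
    using posx(1)[OF that(1)] posy(1)[OF that(2)] by (auto intro!: pos3 pos4)
  have "continuous_on (cbox (0,0) (1,1)) (l j)" for j
  proof -
    have nz: "(if j = 1 then \<alpha> + real a + u else if j = 2 then \<beta> + real b + t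
    else if j = 3 then c3 * (\<alpha> + real a + u) + d3 * (\<beta> + real b + t) else c4 * (\<alpha> + real a + u) +
      d4 * (\<beta> + real b + t)) \<noteq> 0"
      if "(t,u) \<in> cbox (0,0) (1,1)" for t u
      using p[of u t] that by auto
    show ?thesis unfolding l_def split_beta
      by (intro continuous_on_of_real continuous_on_ln ballI, cases "j = 1"; cases "j = 2"; cases "j = 3")
         (use nz in \<open>auto intro!: continuous_intros simp: split_beta split: if_splits\<close>)
  qed
  moreover have "continuous_on (cbox (0,0) (1,1)) (\<lambda>(t,u). Q t * P u)"
    unfolding split_beta cbox_Pair_eq
    by (intro continuous_intros continuous_on_compose2[OF assms(1)] continuous_on_compose2[OF assms(2)]) auto
  ultimately have "holo_at (\<lambda>z. integral (cbox (0,0) (1,1)) (\<lambda>tu. (case tu of (t,u) \<Rightarrow> Q t * P u) * exp (-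
    (\<Sum>j\<in>UNIV. z $ j * l j tu)))) z"
    by (intro holo_at_exp_integral)
  then show ?thesis
    unfolding cell_prod[OF assms] phi_sum l_def by (simp add: case_prod_unfold cong: if_cong)
qed

lemma holo_at_edge:
  assumes "continuous_on {0..1} Q"
  shows "holo_at (\<lambda>z. edge Q z (a,b)) z"
proof -
  define l :: "4 \<Rightarrow> real \<Rightarrow> complex" where
    "l j = (\<lambda>t. of_real (ln (if j = 1 then \<alpha> + real a else if j = 2 then \<beta> + real b + t
    else if j = 3 then c3 * (\<alpha> + real a) + d3 * (\<beta> + real b + t) else c4 * (\<alpha> + real a) + d4 * (\<beta> +
      real b + t))))" for j
  have p: "\<alpha> + real a > 0" "\<beta> + real b + t > 0" "c3 * (\<alpha> + real a) + d3 * (\<beta> + real b + t) > 0"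
     "c4 * (\<alpha> + real a) + d4 * (\<beta> + real b + t) > 0" if "t \<in> {0..1}" for t
    using posx(2) posy(1)[OF that(1)] by (auto intro!: pos3 pos4)
  have "continuous_on (cbox 0 1) (l j)" for j
    unfolding l_def
      by (intro continuous_on_of_real continuous_on_ln ballI, cases "j = 1"; cases "j = 2"; cases "j = 3")
         (use p in \<open>force intro!: continuous_intros split: if_splits\<close>)+
  then have "holo_at (\<lambda>z. integral (cbox 0 1) (\<lambda>t. Q t * exp (- (\<Sum>j\<in>UNIV. z $ j * l j t)))) z"
    using assms by (intro holo_at_exp_integral) auto
  then show ?thesis
    unfolding edge_def phi_sum l_def by simp
qed

text \<open>A common interface for \<open>cell\<close>, \<open>edge\<close> and \<open>pt\<close>: a
  term is controlled by any bound of \<open>\<phi>\<close> on its cell, with a constant independent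
  of the cell and of \<open>z\<close>. Summability and holomorphy of the sums are then proved
  once.\<close>

definition dominated :: "(complex^4 \<Rightarrow> nat \<times> nat \<Rightarrow> complex) \<Rightarrow> bool" where
  "dominated T \<longleftrightarrow> (\<forall>a b z. holo_at (\<lambda>z. T z (a,b)) z) \<and> (\<exists>C\<ge>0. \<forall>a b z K.
     (\<forall>u\<in>{0..1}. \<forall>t\<in>{0..1}. norm (\<phi> z (\<alpha> + real a + u) (\<beta> + real b + t)) \<le> K) \<longrightarrow> norm (T z (a,b)) \<le> C * K)"

lemma norm_integral_unit_le:
  fixes f :: "real \<Rightarrow> complex"
  assumes "continuous_on {0..1} f" "\<And>u. u \<in> {0..1} \<Longrightarrow> norm (f u) \<le> K"
  shows "norm (integral {0..1} f) \<le> K"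
  using integral_bound[of 0 1 f K] assms by auto

lemma dominated_cell:
  assumes "continuous_on {0..1} P" "continuous_on {0..1} Q" shows "dominated (cell P Q)"
proof -
  obtain C D where C: "C \<ge> 0" "\<And>u. u \<in> {0..1} \<Longrightarrow> norm (P u) \<le> C" and D: "D \<ge> 0" "\<And>u. u \<in> {0..1} \<Longrightarrow> norm (Q u) \<le> D"
    using continuous_bound_unit[OF assms(1)] continuous_bound_unit[OF assms(2)] by metis
  show ?thesis unfolding dominated_def
  proof (intro conjI allI exI[of _ "D * C"] impI)
    fix a b z K assume K: "\<forall>u\<in>{0..1}. \<forall>t\<in>{0..1}. norm (\<phi> z (\<alpha> + real a + u) (\<beta> + real b + t)) \<le> K"
    have "norm (integral {0..1} (\<lambda>u. P u * \<phi> z (\<alpha> + real a + u) (\<beta> + real b + t))) \<le> C * K" if "t \<in> {0..1}" for t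
    proof (rule norm_integral_unit_le)
      show "continuous_on {0..1} (\<lambda>u. P u * \<phi> z (\<alpha> + real a + u) (\<beta> + real b + t))"
        by (intro continuous_intros assms) (use posx posy that in auto)
      fix u :: real assume "u \<in> {0..1}"
      then show "norm (P u * \<phi> z (\<alpha> + real a + u) (\<beta> + real b + t)) \<le> C * K"
        unfolding norm_mult using C K that by (intro mult_mono) auto
    qed
    then have "norm (cell P Q z (a,b)) \<le> D * (C * K)"
      unfolding cell_def prod.case
    proof (intro norm_integral_unit_le continuous_intros cont_inner assms)
      fix t :: real assume t: "t \<in> {0..1}"
      assume *: "\<And>t. t \<in> {0..1} \<Longrightarrow> norm (integral {0..1} (\<lambda>u. P u * \<phi> z (\<alpha> + real a + u) (\<beta> + real b +
        t))) \<le> C * K"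
      show "norm (Q t * integral {0..1} (\<lambda>u. P u * \<phi> z (\<alpha> + real a + u) (\<beta> + real b + t))) \<le> D * (C * K)"
        unfolding norm_mult using D *[OF t] t by (intro mult_mono) auto
    qed
    then show "norm (cell P Q z (a,b)) \<le> D * C * K" by (simp add: mult.assoc)
  qed (use C D holo_at_cell assms in auto)
qed

lemma dominated_edge:
  assumes "continuous_on {0..1} Q" shows "dominated (edge Q)"
proof -
  obtain D where D: "D \<ge> 0" "\<And>u. u \<in> {0..1} \<Longrightarrow> norm (Q u) \<le> D"
    using continuous_bound_unit[OF assms(1)] by metis
  show ?thesis unfolding dominated_def
  proof (intro conjI allI exI[of _ D] impI)
    fix a b z K assume K: "\<forall>u\<in>{0..1}. \<forall>t\<in>{0..1}. norm (\<phi> z (\<alpha> + real a + u) (\<beta> + real b + t)) \<le> K"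
    show "norm (edge Q z (a,b)) \<le> D * K"
      unfolding edge_def prod.case
    proof (rule norm_integral_unit_le)
      show "continuous_on {0..1} (\<lambda>t. Q t * \<phi> z (\<alpha> + real a) (\<beta> + real b + t))"
        by (intro continuous_intros assms) (use posx posy in auto)
      fix t :: real assume t: "t \<in> {0..1}"
      then show "norm (Q t * \<phi> z (\<alpha> + real a) (\<beta> + real b + t)) \<le> D * K"
        unfolding norm_mult using D K[rule_format, of 0 t] t by (intro mult_mono) auto
    qed
  qed (use D holo_at_edge assms in auto)
qed

lemma dominated_pt: "dominated pt"
  unfolding dominated_def
proof (intro conjI allI exI[of _ 1] impI)
  fix a b z K assume K: "\<forall>u\<in>{0..1}. \<forall>t\<in>{0..1}. norm (\<phi> z (\<alpha> + real a + u) (\<beta> + real b + t)) \<le> K"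
  show "norm (pt z (a,b)) \<le> 1 * K" using K[rule_format, of 0 0] by (simp add: pt_def)
qed (auto simp: pt_def holo_at_phi)

lemma dominated_near:
  assumes T: "dominated T" and z: "z \<in> conv_dom"
  obtains r M where "r > 0" "M summable_on UNIV" "\<And>m x. x \<in> ball z r \<Longrightarrow> norm (T x m) \<le> M m"
proof -
  \<comment> \<open>At most half of each slack (a quarter for \<open>wT\<close>): moving by less
    than \<open>r = \<delta> / 4\<close> costs at most \<open>\<delta>\<close> by
    \<open>Re_w_le_norm\<close>, and the margin that \<open>phi_bound_powr\<close> asks for is
    left.\<close>
  define \<delta> where "\<delta> = min (Re (wA z) - 1) (min (Re (wB z) - 1) ((Re (wT z) - 2) / 2)) / 2"
  have \<delta>: "\<delta> > 0" "Re (wA z) \<ge> 1 + 2 * \<delta>" "Re (wB z) \<ge> 1 + 2 * \<delta>" "Re (wT z) \<ge> 2 + 4 * \<delta>"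
    using z by (auto simp: conv_dom_def \<delta>_def min_def field_simps)
  define r where "r = \<delta> / 4"
  obtain C where C: "C \<ge> 0" "\<And>a b z K. (\<forall>u\<in>{0..1}. \<forall>t\<in>{0..1}. norm (\<phi> z (\<alpha> + real a + u) (\<beta> + real b +
    t)) \<le> K) \<Longrightarrow> norm (T z (a,b)) \<le> C * K"
    using T unfolding dominated_def by blast
  define K where "K = norm z + r"
  define M where "M = (\<lambda>(a,b). (C * exp (4 * K * ln 8)) * (real (Suc a) * real (Suc b)) powr (-1 - \<delta>))"
  show ?thesis
  proof (rule that)
    show "r > 0" using \<delta> by (simp add: r_def)
    show "M summable_on UNIV"
      unfolding M_def using summable_on_cmult_right[OF summable_on_pair_powr[OF \<delta>(1)], of
        "C * exp (4 * K * ln 8)"]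
      by (simp add: case_prod_unfold)
    fix m :: "nat \<times> nat" and x assume x: "x \<in> ball z r"
    obtain a b where m: "m = (a,b)" by (cases m)
    have nx: "norm (x - z) < r" using x by (simp add: dist_norm norm_minus_commute)
    have Kx: "\<bar>Re (x $ j)\<bar> \<le> K" for j
    proof -
      have "\<bar>Re (x $ j)\<bar> \<le> norm (x $ j)" by (rule abs_Re_le_cmod)
      also have "\<dots> \<le> norm x" by (rule Finite_Cartesian_Product.norm_nth_le)
      also have "\<dots> \<le> K" using norm_triangle_ineq[of z "x - z"] nx by (simp add: K_def)
      finally show ?thesis .
    qed
    have "norm (T x (a,b)) \<le> C * (exp (4 * K * ln 8) * (real (Suc a) * real (Suc b)) powr (-1 - \<delta>))"
      using Re_w_le_norm[of z x] nx \<delta> by (intro C(2) ballI phi_bound_powr Kx) (auto simp: r_def)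
    then show "norm (T x m) \<le> M m" by (simp add: M_def m mult.assoc)
  qed
qed

lemma dominated_summable:
  assumes "dominated T" "z \<in> conv_dom" shows "(\<lambda>m. norm (T z m)) summable_on UNIV" "T z summable_on UNIV"
proof -
  obtain r M where "r > 0" "M summable_on UNIV" "\<And>m x. x \<in> ball z r \<Longrightarrow> norm (T x m) \<le> M m"
    using dominated_near[OF assms] by blast
  then show "(\<lambda>m. norm (T z m)) summable_on UNIV"
    by (intro Infinite_Sum.abs_summable_on_comparison_test'[of M]) auto
  then show "T z summable_on UNIV" by (rule abs_summable_summable)
qed

lemma dominated_holo_at:
  assumes "dominated T" "z \<in> conv_dom" shows "holo_at (\<lambda>z. infsum (T z) UNIV) z"
proof -
  obtain r M where rM: "r > 0" "M summable_on UNIV" "\<And>m x. x \<in> ball z r \<Longrightarrow> norm (T x m) \<le> M m"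
    using dominated_near[OF assms] by blast
  have "holo_at (\<lambda>z. infsum (\<lambda>m. T z m) UNIV) z"
  proof (rule holo_at_infsum_pair[OF rM(1) _ rM(2)])
    show "holo_at (\<lambda>z. T z m) x" for m x using assms(1) unfolding dominated_def by (cases m) auto
  qed (use rM(3) in auto)
  then show ?thesis by simp
qed

text \<open>On the row \<open>a = 0\<close> the logarithm of \<open>Suc a\<close> is 0 and the
  maximum is \<open>Suc b\<close>, so \<open>wA\<close> alone governs convergence. This row is what
  telescoping in \<open>a\<close> leaves over.\<close>

lemma dominated_near1:
  assumes T: "dominated T" and z: "Re (wA z) > 1"
  obtains r M where "r > 0" "summable M" "\<And>b x. x \<in> ball z r \<Longrightarrow> norm (T x (0,b)) \<le> M b"
proof -
  define \<delta> where "\<delta> = (Re (wA z) - 1) / 2"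
  have \<delta>: "\<delta> > 0" "Re (wA z) = 1 + 2 * \<delta>" using z by (auto simp: \<delta>_def field_simps)
  define r where "r = \<delta> / 4"
  obtain C where C: "C \<ge> 0" "\<And>a b z K. (\<forall>u\<in>{0..1}. \<forall>t\<in>{0..1}. norm (\<phi> z (\<alpha> + real a + u) (\<beta> + real b +
    t)) \<le> K) \<Longrightarrow> norm (T z (a,b)) \<le> C * K"
    using T unfolding dominated_def by blast
  define K where "K = norm z + r"
  define M where "M b = (C * exp (4 * K * ln 8)) * real (Suc b) powr (-1 - \<delta>)" for b
  show ?thesis
  proof (rule that)
    show "r > 0" using \<delta> by (simp add: r_def)
    have "summable (\<lambda>n. real n powr (-1 - \<delta>))" using \<delta> by (subst summable_real_powr_iff) auto
    then have "summable (\<lambda>n. real (Suc n) powr (-1 - \<delta>))" by (subst summable_Suc_iff)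
    then show "summable M" unfolding M_def by (rule summable_mult)
    fix b x assume x: "x \<in> ball z r"
    have nx: "norm (x - z) < r" using x by (simp add: dist_norm norm_minus_commute)
    have Kx: "\<bar>Re (x $ j)\<bar> \<le> K" for j
    proof -
      have "\<bar>Re (x $ j)\<bar> \<le> norm (x $ j)" by (rule abs_Re_le_cmod)
      also have "\<dots> \<le> norm x" by (rule Finite_Cartesian_Product.norm_nth_le)
      also have "\<dots> \<le> K" using norm_triangle_ineq[of z "x - z"] nx by (simp add: K_def)
      finally show ?thesis .
    qed
    have wx: "Re (wA x) \<ge> 1 + \<delta>" using Re_w_le_norm(1)[of z x] nx \<delta> by (auto simp: r_def)
    have "norm (T x (0,b)) \<le> C * (exp (4 * K * ln 8) * real (Suc b) powr (-1 - \<delta>))"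
    proof (intro C(2) ballI)
      fix u t :: real assume "u \<in> {0..1}" "t \<in> {0..1}"
      from phi_bound[of x K, OF Kx this, of 0 b]
      have "norm (\<phi> x (\<alpha> + real 0 + u) (\<beta> + real b + t)) \<le>
        exp (4 * K * ln 8) * exp (- (Re (wA x) * ln (real (Suc b))))"
        by (simp add: wA_def algebra_simps)
      also have "exp (- (Re (wA x) * ln (real (Suc b)))) \<le> real (Suc b) powr (-1 - \<delta>)"
        using mult_right_mono[OF wx, of "ln (real (Suc b))"] by (simp add: powr_def algebra_simps)
      finally show "norm (\<phi> x (\<alpha> + real 0 + u) (\<beta> + real b + t)) \<le>
        exp (4 * K * ln 8) * real (Suc b) powr (-1 - \<delta>)"
        by simp
    qed
    then show "norm (T x (0,b)) \<le> M b" by (simp add: M_def mult.assoc)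
  qed
qed

lemma dominated_summable1:
  assumes "dominated T" "Re (wA z) > 1"
  shows "summable (\<lambda>b. norm (T z (0,b)))" "summable (\<lambda>b. T z (0,b))" "(\<lambda>b. T z (0,b)) summable_on UNIV"
proof -
  obtain r M where rM: "r > 0" "summable M" "\<And>m x. x \<in> ball z r \<Longrightarrow> norm (T x (0,m)) \<le> M m"
    using dominated_near1[OF assms] by blast
  show s: "summable (\<lambda>b. norm (T z (0,b)))"
    by (rule summable_comparison_test'[OF rM(2), of 0]) (use rM(1,3) in simp)
  then show "summable (\<lambda>b. T z (0,b))" by (rule summable_norm_cancel)
  show "(\<lambda>b. T z (0,b)) summable_on UNIV" using s by (rule norm_summable_imp_summable_on)
qed

lemma dominated_holo_at1:
  assumes "dominated T" "Re (wA z) > 1" shows "holo_at (\<lambda>z. infsum (\<lambda>b. T z (0,b)) UNIV) z"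
proof -
  obtain r M where rM: "r > 0" "summable M" "\<And>m x. x \<in> ball z r \<Longrightarrow> norm (T x (0,m)) \<le> M m"
    using dominated_near1[OF assms] by blast
  show ?thesis
  proof (rule holo_at_infsum_nat[OF rM(1) _ rM(2)])
    show "holo_at (\<lambda>z. T z (0,m)) x" for m x using assms(1) unfolding dominated_def by auto
  qed (use rM(3) in auto)
qed

section \<open>Integration by parts and Euler identities on a single cell\<close>

abbreviation "mz (P :: real \<Rightarrow> complex) \<equiv> continuous_on {0..1} P \<and> integral {0..1} P = 0"

lemma deriv_cell_u:
  assumes "u \<in> {0..1}" "y > 0"
  shows "((\<lambda>u. \<phi> z (\<alpha> + real a + u) y) has_vector_derivative phix z (\<alpha> + real a + u) y) (at u within S)"
proof -
  have "((\<lambda>u. \<alpha> + real a + u) has_vector_derivative 1) (at u within S)" by (auto intro!: derivative_eq_intros)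
  from vector_diff_chain_within[OF this phi_deriv(1)[OF posx(1)[OF assms(1), of a] assms(2)]]
  show ?thesis by (simp add: o_def)
qed

lemma deriv_cell_t:
  assumes "t \<in> {0..1}" "x > 0"
  shows "((\<lambda>t. \<phi> z x (\<beta> + real b + t)) has_vector_derivative phiy z x (\<beta> + real b + t)) (at t within S)"
proof -
  have "((\<lambda>t. \<beta> + real b + t) has_vector_derivative 1) (at t within S)" by (auto intro!: derivative_eq_intros)
  from vector_diff_chain_within[OF this phi_deriv(2)[OF assms(2) posy(1)[OF assms(1), of b]]]
  show ?thesis by (simp add: o_def)
qed

lemma cont_phi_u: "y > 0 \<Longrightarrow> continuous_on {0..1} (\<lambda>u. \<phi> z (\<alpha> + real a + u) y)"
  by (intro continuous_intros) (use posx in auto)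

lemma cont_phi_t: "x > 0 \<Longrightarrow> continuous_on {0..1} (\<lambda>t. \<phi> z x (\<beta> + real b + t))"
  by (intro continuous_intros) (use posy in auto)

lemma cont_phix: "y > 0 \<Longrightarrow> continuous_on {0..1} (\<lambda>u. phix z (\<alpha> + real a + u) y)"
  unfolding phix_def by (intro continuous_intros cont_phi_u)

lemma cont_phiy: "x > 0 \<Longrightarrow> continuous_on {0..1} (\<lambda>t. phiy z x (\<beta> + real b + t))"
  unfolding phiy_def by (intro continuous_intros cont_phi_t)

lemma suc_arg: "\<alpha> + real (Suc a) = \<alpha> + real a + 1" "\<beta> + real (Suc a) = \<beta> + real a + 1" by auto

lemma integral_phix:
  assumes "continuous_on {0..1} V" "y > 0"
  shows "integral {0..1} (\<lambda>u. V u * phix z (\<alpha> + real a + u) y) =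
    - (z$1 * integral {0..1} (\<lambda>u. V u * \<phi> (z + ax 1) (\<alpha> + real a + u) y)
     + of_real c3 * z$3 * integral {0..1} (\<lambda>u. V u * \<phi> (z + ax 3) (\<alpha> + real a + u) y)
     + of_real c4 * z$4 * integral {0..1} (\<lambda>u. V u * \<phi> (z + ax 4) (\<alpha> + real a + u) y))"
proof -
  have c: "continuous_on {0..1} (\<lambda>u. V u * \<phi> w (\<alpha> + real a + u) y)" for w
    by (intro continuous_intros assms cont_phi_u)
  have "(\<lambda>u. V u * phix z (\<alpha> + real a + u) y) = (\<lambda>u. - z$1 * (V u * \<phi> (z + ax 1) (\<alpha> + real a + u) y)
     + (- of_real c3 * z$3) * (V u * \<phi> (z + ax 3) (\<alpha> + real a + u) y)
     + (- of_real c4 * z$4) * (V u * \<phi> (z + ax 4) (\<alpha> + real a + u) y) + 0 * 0 + 0 * 0)"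
    by (simp add: phix_def fun_eq_iff algebra_simps)
  then show ?thesis by (simp only: integral_lincomb5[OF c c c continuous_on_const continuous_on_const]) simp
qed

lemma integral_phiy:
  assumes "continuous_on {0..1} V" "x > 0"
  shows "integral {0..1} (\<lambda>t. V t * phiy z x (\<beta> + real b + t)) =
    - (z$2 * integral {0..1} (\<lambda>t. V t * \<phi> (z + ax 2) x (\<beta> + real b + t))
     + of_real d3 * z$3 * integral {0..1} (\<lambda>t. V t * \<phi> (z + ax 3) x (\<beta> + real b + t))
     + of_real d4 * z$4 * integral {0..1} (\<lambda>t. V t * \<phi> (z + ax 4) x (\<beta> + real b + t)))"
proof -
  have c: "continuous_on {0..1} (\<lambda>t. V t * \<phi> w x (\<beta> + real b + t))" for w
    by (intro continuous_intros assms cont_phi_t)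
  have "(\<lambda>t. V t * phiy z x (\<beta> + real b + t)) = (\<lambda>t. - z$2 * (V t * \<phi> (z + ax 2) x (\<beta> + real b + t))
     + (- of_real d3 * z$3) * (V t * \<phi> (z + ax 3) x (\<beta> + real b + t))
     + (- of_real d4 * z$4) * (V t * \<phi> (z + ax 4) x (\<beta> + real b + t)) + 0 * 0 + 0 * 0)"
    by (simp add: phiy_def fun_eq_iff algebra_simps)
  then show ?thesis by (simp only: integral_lincomb5[OF c c c continuous_on_const continuous_on_const]) simp
qed

text \<open>Partial integration in \<open>x\<close>. Whatever is not a boundary difference in
  \<open>a\<close> has one exponent raised, hence better decay in \<open>x\<close>; the new weight
  \<open>V\<close> is again of mean zero.\<close>

lemma cell_parts:
  assumes "mz P"
  obtains V where "mz V" "\<And>Q z a b. continuous_on {0..1} Q \<Longrightarrow>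
    cell P Q z (a,b) = V 0 * (edge Q z (Suc a,b) - edge Q z (a,b)) + z$1 * cell V Q (z + ax 1) (a,b)
      + of_real c3 * z$3 * cell V Q (z + ax 3) (a,b) + of_real c4 * z$4 * cell V Q (z + ax 4) (a,b)"
proof -
  obtain V where V: "continuous_on {0..1} V" "integral {0..1} V = 0"
    "\<And>f f'. (\<And>u. u \<in> {0..1} \<Longrightarrow> (f has_vector_derivative f' u) (at u within {0..1})) \<Longrightarrow>
       continuous_on {0..1} f' \<Longrightarrow>
       integral {0..1} (\<lambda>u. P u * f u) = V 0 * (f 1 - f 0) - integral {0..1} (\<lambda>u. V u * f' u)"
    using assms antiderivative_mean_zero[of P] by blast
  show ?thesis
  proof (rule that)
    show "mz V" using V by simp
    fix Q :: "real \<Rightarrow> complex" and z a b assume Q: "continuous_on {0..1} Q"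
    let ?I = "\<lambda>w t. integral {0..1} (\<lambda>u. V u * \<phi> w (\<alpha> + real a + u) (\<beta> + real b + t))"
    have inner: "integral {0..1} (\<lambda>u. P u * \<phi> z (\<alpha> + real a + u) (\<beta> + real b + t)) =
      V 0 * (\<phi> z (\<alpha> + real (Suc a)) (\<beta> + real b + t) - \<phi> z (\<alpha> + real a) (\<beta> + real b + t))
      + z$1 * ?I (z + ax 1) t + of_real c3 * z$3 * ?I (z + ax 3) t + of_real c4 * z$4 * ?I (z + ax 4) t"
      if "t \<in> {0..1}" for t
    proof -
      have y: "\<beta> + real b + t > 0" using posy that by auto
      show ?thesis
        by (subst V(3)[OF deriv_cell_u[OF _ y] cont_phix[OF y]])
           (auto simp: integral_phix[OF V(1) y] suc_arg simp del: of_nat_Suc)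
    qed
    have cI: "continuous_on {0..1} (\<lambda>t. Q t * ?I w t)" for w
      by (intro continuous_intros Q cont_inner V(1))
    have cE: "continuous_on {0..1} (\<lambda>t. Q t * \<phi> z (\<alpha> + real a') (\<beta> + real b + t))" for a'
      by (intro continuous_intros Q cont_phi_t posx)
    have "cell P Q z (a,b) = integral {0..1} (\<lambda>t. V 0 * (Q t * \<phi> z (\<alpha> + real (Suc a)) (\<beta> + real b + t))
       + (- V 0) * (Q t * \<phi> z (\<alpha> + real a) (\<beta> + real b + t)) + z$1 * (Q t * ?I (z + ax 1) t)
       + of_real c3 * z$3 * (Q t * ?I (z + ax 3) t) + of_real c4 * z$4 * (Q t * ?I (z + ax 4) t))"
      unfolding cell_def prod.case by (rule integral_cong) (simp only: inner,
        simp only: algebra_simps mult_minus_left diff_conv_add_uminus mult_minus_right)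
    then show "cell P Q z (a,b) = V 0 * (edge Q z (Suc a,b) - edge Q z (a,b)) + z$1 * cell V Q (z + ax 1) (a,b)
      + of_real c3 * z$3 * cell V Q (z + ax 3) (a,b) + of_real c4 * z$4 * cell V Q (z + ax 4) (a,b)"
      unfolding integral_lincomb5[OF cE cE cI cI cI] unfolding cell_def edge_def prod.case
        by (simp add: algebra_simps)
  qed
qed

lemma edge_parts:
  assumes "mz Q"
  obtains V where "mz V" "\<And>z a b.
    edge Q z (a,b) = V 0 * (pt z (a,Suc b) - pt z (a,b)) + z$2 * edge V (z + ax 2) (a,b)
      + of_real d3 * z$3 * edge V (z + ax 3) (a,b) + of_real d4 * z$4 * edge V (z + ax 4) (a,b)"
proof -
  obtain V where V: "continuous_on {0..1} V" "integral {0..1} V = 0"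
    "\<And>f f'. (\<And>u. u \<in> {0..1} \<Longrightarrow> (f has_vector_derivative f' u) (at u within {0..1})) \<Longrightarrow>
       continuous_on {0..1} f' \<Longrightarrow>
       integral {0..1} (\<lambda>u. Q u * f u) = V 0 * (f 1 - f 0) - integral {0..1} (\<lambda>u. V u * f' u)"
    using assms antiderivative_mean_zero[of Q] by blast
  show ?thesis
  proof (rule that)
    show "mz V" using V by simp
    fix z a b
    have x: "\<alpha> + real a > 0" by (rule posx)
    show "edge Q z (a,b) = V 0 * (pt z (a,Suc b) - pt z (a,b)) + z$2 * edge V (z + ax 2) (a,b)
      + of_real d3 * z$3 * edge V (z + ax 3) (a,b) + of_real d4 * z$4 * edge V (z + ax 4) (a,b)"
      unfolding edge_def pt_def prod.case
      by (subst V(3)[OF deriv_cell_t[OF _ x] cont_phiy[OF x]])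
         (auto simp: integral_phiy[OF V(1) x] suc_arg simp del: of_nat_Suc)
  qed
qed

abbreviation "W1 \<equiv> (\<lambda>u. of_real u - 1 :: complex)"

lemma edge_eq_cell:
  assumes Q: "continuous_on {0..1} Q"
  shows "edge Q z (a,b) = cell (\<lambda>_. 1) Q z (a,b) - z$1 * cell W1 Q (z + ax 1) (a,b)
      - of_real c3 * z$3 * cell W1 Q (z + ax 3) (a,b) - of_real c4 * z$4 * cell W1 Q (z + ax 4) (a,b)"
proof -
  have W: "continuous_on {0..1} W1" by (intro continuous_intros)
  let ?I = "\<lambda>P w t. integral {0..1} (\<lambda>u. P u * \<phi> w (\<alpha> + real a + u) (\<beta> + real b + t))"
  have inner: "\<phi> z (\<alpha> + real a) (\<beta> + real b + t) = ?I (\<lambda>_. 1) z t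
      - z$1 * ?I W1 (z + ax 1) t - of_real c3 * z$3 * ?I W1 (z + ax 3) t - of_real c4 * z$4 * ?I W1 (z + ax 4) t"
    if "t \<in> {0..1}" for t
  proof -
    have y: "\<beta> + real b + t > 0" using posy that by auto
    show ?thesis
      using integral_eq_left_endpoint[OF deriv_cell_u[OF _ y] cont_phix[OF y], of z a]
      by (simp add: integral_phix[OF W y])
  qed
  have cI: "continuous_on {0..1} (\<lambda>t. Q t * ?I P w t)" if "continuous_on {0..1} P" for w P
    by (intro continuous_intros Q cont_inner that)
  have "edge Q z (a,b) = integral {0..1} (\<lambda>t. 1 * (Q t * ?I (\<lambda>_. 1) z t)
       + (- z$1) * (Q t * ?I W1 (z + ax 1) t)
       + (- of_real c3 * z$3) * (Q t * ?I W1 (z + ax 3) t) + (- of_real c4 * z$4) * (Q t * ?I W1 (z +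
         ax 4) t) + 0 * 0)"
    unfolding edge_def prod.case by (rule integral_cong) (simp only: inner,
      simp only: algebra_simps mult_minus_left diff_conv_add_uminus mult_minus_right, simp)
  then show ?thesis
    unfolding integral_lincomb5[OF cI[OF continuous_on_const] cI[OF W] cI[OF W] cI[OF W] continuous_on_const]
    unfolding cell_def edge_def prod.case by (simp add: algebra_simps)
qed

lemma pt_eq_edge:
  shows "pt z (a,b) = edge (\<lambda>_. 1) z (a,b) - z$2 * edge W1 (z + ax 2) (a,b)
      - of_real d3 * z$3 * edge W1 (z + ax 3) (a,b) - of_real d4 * z$4 * edge W1 (z + ax 4) (a,b)"
proof -
  have W: "continuous_on {0..1} W1" by (intro continuous_intros)
  have x: "\<alpha> + real a > 0" by (rule posx)
  show ?thesis unfolding edge_def pt_def prod.case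
    using integral_eq_left_endpoint[OF deriv_cell_t[OF _ x] cont_phiy[OF x], of z b]
    by (simp add: integral_phiy[OF W x])
qed

text \<open>The Euler field \<open>x \<partial>\<^sub>x\<close>: on each cell \<open>\<partial>\<^sub>x (x \<phi>)\<close> integrates to a difference of boundary values.\<close>

lemma cell_euler:
  assumes Q: "continuous_on {0..1} Q"
  shows "(1 - wB z) * cell (\<lambda>_. 1) Q z (a,b) + of_real d3 * z$3 * cell (\<lambda>_. 1) Q (z - ax 2 + ax 3) (a,b)
      + of_real d4 * z$4 * cell (\<lambda>_. 1) Q (z - ax 2 + ax 4) (a,b) =
        edge Q (z - ax 1) (Suc a,b) - edge Q (z - ax 1) (a,b)"
proof -
  let ?I = "\<lambda>w t. integral {0..1} (\<lambda>u. 1 * \<phi> w (\<alpha> + real a + u) (\<beta> + real b + t))"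
  have inner: "(1 - wB z) * ?I z t + of_real d3 * z$3 * ?I (z - ax 2 + ax 3) t +
    of_real d4 * z$4 * ?I (z - ax 2 + ax 4) t =
     \<phi> (z - ax 1) (\<alpha> + real (Suc a)) (\<beta> + real b + t) - \<phi> (z - ax 1) (\<alpha> + real a) (\<beta> + real b + t)"
    if t: "t \<in> {0..1}" for t
  proof -
    define y where "y = \<beta> + real b + t"
    have y: "y > 0" using posy t by (auto simp: y_def)
    have c: "continuous_on {0..1} (\<lambda>u. 1 * \<phi> w (\<alpha> + real a + u) y)" for w
      using cont_phi_u[OF y] by simp
    \<comment> \<open>The right side is the derivative of \<open>x \<phi>\<close>. Writing
      \<open>d3 y\<close> as the form minus \<open>c3 x\<close> replaces the shift
      \<open>- ax 1 + ax 3\<close>, which does not change \<open>wB\<close>, by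
      \<open>- ax 2 + ax 3\<close>, which raises it by one.\<close>
    have pw: "(1 - wB z) * \<phi> z x y + of_real d3 * z$3 * \<phi> (z - ax 2 + ax 3) x y +
      of_real d4 * z$4 * \<phi> (z - ax 2 + ax 4) x y
      = phix (z - ax 1) x y" if x: "x > 0" for x
    proof -
      note p = x y pos3[OF x y] pos4[OF x y]
      have nz: "complex_of_real x \<noteq> 0" "complex_of_real (c3 * x + d3 * y) \<noteq> 0" "complex_of_real (c4 * x +
        d4 * y) \<noteq> 0"
        using p by (auto simp del: of_real_add of_real_mult)
      have f3: "of_real d3 * of_real y = of_real (c3 * x + d3 * y) - of_real c3 * complex_of_real x"
        and f4: "of_real d4 * of_real y = of_real (c4 * x + d4 * y) - of_real c4 * complex_of_real x" by simp_all
      have "of_real d3 * z$3 * \<phi> (z - ax 2 + ax 3) x y =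
        z$3 * \<phi> z x y * (of_real d3 * of_real y) / of_real (c3 * x + d3 * y)"
        unfolding phi_shift[OF x y] by simp
      also have "\<dots> = z$3 * \<phi> z x y - of_real c3 * z$3 * (\<phi> z x y * of_real x / of_real (c3 * x + d3 * y))"
        unfolding f3 using nz(2)
          by (simp add: diff_divide_distrib right_diff_distrib del: of_real_add of_real_mult)
      finally have e3: "of_real d3 * z$3 * \<phi> (z - ax 2 + ax 3) x y =
        z$3 * \<phi> z x y - of_real c3 * z$3 * \<phi> (z - ax 1 + ax 3) x y"
        unfolding phi_shift[OF x y] .
      have "of_real d4 * z$4 * \<phi> (z - ax 2 + ax 4) x y =
        z$4 * \<phi> z x y * (of_real d4 * of_real y) / of_real (c4 * x + d4 * y)"
        unfolding phi_shift[OF x y] by simp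
      also have "\<dots> = z$4 * \<phi> z x y - of_real c4 * z$4 * (\<phi> z x y * of_real x / of_real (c4 * x + d4 * y))"
        unfolding f4 using nz(3)
          by (simp add: diff_divide_distrib right_diff_distrib del: of_real_add of_real_mult)
      finally have e4: "of_real d4 * z$4 * \<phi> (z - ax 2 + ax 4) x y =
        z$4 * \<phi> z x y - of_real c4 * z$4 * \<phi> (z - ax 1 + ax 4) x y"
        unfolding phi_shift[OF x y] .
      have e1: "\<phi> (z - ax 1 + ax 1) x y = \<phi> z x y" by simp
      have "phix (z - ax 1) x y = - ((z$1 - 1) * \<phi> z x y + of_real c3 * z$3 * \<phi> (z - ax 1 + ax 3) x y +
        of_real c4 * z$4 * \<phi> (z - ax 1 + ax 4) x y)"
        unfolding phix_def e1 by (simp add: ax_nth)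
      then show ?thesis unfolding e3 e4 by (simp add: wB_def algebra_simps)
    qed
    have "(1 - wB z) * ?I z t + of_real d3 * z$3 * ?I (z - ax 2 + ax 3) t +
      of_real d4 * z$4 * ?I (z - ax 2 + ax 4) t =
      integral {0..1} (\<lambda>u. (1 - wB z) * (1 * \<phi> z (\<alpha> + real a + u) y) +
        of_real d3 * z$3 * (1 * \<phi> (z - ax 2 + ax 3) (\<alpha> + real a + u) y)
       + of_real d4 * z$4 * (1 * \<phi> (z - ax 2 + ax 4) (\<alpha> + real a + u) y) + 0 * 0 + 0 * 0)"
      unfolding integral_lincomb5[OF c c c continuous_on_const continuous_on_const] by (simp add: y_def)
    also have "\<dots> = integral {0..1} (\<lambda>u. phix (z - ax 1) (\<alpha> + real a + u) y)"
      by (rule integral_cong) (use pw posx in simp)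
    also have "\<dots> = \<phi> (z - ax 1) (\<alpha> + real a + 1) y - \<phi> (z - ax 1) (\<alpha> + real a + 0) y"
      by (rule integral_unique, rule fundamental_theorem_of_calculus) (use deriv_cell_u[OF _ y] in auto)
    finally show ?thesis by (simp add: y_def suc_arg del: of_nat_Suc)
  qed
  have cI: "continuous_on {0..1} (\<lambda>t. Q t * ?I w t)" for w
    by (intro continuous_intros Q cont_inner)
  have cE: "continuous_on {0..1} (\<lambda>t. Q t * \<phi> w (\<alpha> + real a') (\<beta> + real b + t))" for a' w
    by (intro continuous_intros Q cont_phi_t posx)
  have "(1 - wB z) * cell (\<lambda>_. 1) Q z (a,b) + of_real d3 * z$3 * cell (\<lambda>_. 1) Q (z - ax 2 + ax 3) (a,b)
      + of_real d4 * z$4 * cell (\<lambda>_. 1) Q (z - ax 2 + ax 4) (a,b) =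
    integral {0..1} (\<lambda>t. (1 - wB z) * (Q t * ?I z t) + of_real d3 * z$3 * (Q t * ?I (z - ax 2 + ax 3) t)
      + of_real d4 * z$4 * (Q t * ?I (z - ax 2 + ax 4) t) + 0 * 0 + 0 * 0)"
    unfolding integral_lincomb5[OF cI cI cI continuous_on_const continuous_on_const] cell_def by simp
  also have "\<dots> = integral {0..1} (\<lambda>t. Q t * ((1 - wB z) * ?I z t + of_real d3 * z$3 * ?I (z - ax 2 + ax 3) t
      + of_real d4 * z$4 * ?I (z - ax 2 + ax 4) t))"
    by (simp add: algebra_simps)
  also have "\<dots> = integral {0..1} (\<lambda>t. Q t * \<phi> (z - ax 1) (\<alpha> + real (Suc a)) (\<beta> + real b +
    t) - Q t * \<phi> (z - ax 1) (\<alpha> + real a) (\<beta> + real b + t))"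
    by (rule integral_cong) (simp only: inner right_diff_distrib)
  also have "\<dots> = edge Q (z - ax 1) (Suc a,b) - edge Q (z - ax 1) (a,b)"
    unfolding edge_def prod.case by (rule integral_diff) (intro integrable_continuous_interval cE)+
  finally show ?thesis .
qed

text \<open>Euler's argument in \<open>y\<close> with \<open>x\<close> fixed: \<open>c3 x\<close>
  now counts as a constant, and the corrections carry the full shifts \<open>ax 3\<close> and
  \<open>ax 4\<close>. Since the coefficients depend on \<open>a\<close>, the identity is applied on
  the row \<open>a = 0\<close>.\<close>

lemma edge_euler:
  "(1 - wA z) * edge (\<lambda>_. 1) z (a,b) + of_real (c3 * (\<alpha> + real a)) * z$3 * edge (\<lambda>_. 1) (z + ax 3) (a,b)
      + of_real (c4 * (\<alpha> + real a)) * z$4 * edge (\<lambda>_. 1) (z + ax 4) (a,b) =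
        pt (z - ax 2) (a,Suc b) - pt (z - ax 2) (a,b)"
proof -
  define x where "x = \<alpha> + real a"
  have x: "x > 0" using posx by (auto simp: x_def)
  have c: "continuous_on {0..1} (\<lambda>t. 1 * \<phi> w x (\<beta> + real b + t))" for w
    using cont_phi_t[OF x] by simp
  have pw: "(1 - wA z) * \<phi> z x y + of_real (c3 * x) * z$3 * \<phi> (z + ax 3) x y +
    of_real (c4 * x) * z$4 * \<phi> (z + ax 4) x y
      = phiy (z - ax 2) x y" if y: "y > 0" for y
  proof -
    note p = x y pos3[OF x y] pos4[OF x y]
    have nz: "complex_of_real (c3 * x + d3 * y) \<noteq> 0" "complex_of_real (c4 * x + d4 * y) \<noteq> 0"
      using p by (auto simp del: of_real_add of_real_mult)
    have f3: "of_real d3 * of_real y = of_real (c3 * x + d3 * y) - complex_of_real (c3 * x)"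
      and f4: "of_real d4 * of_real y = of_real (c4 * x + d4 * y) - complex_of_real (c4 * x)" by simp_all
    have "of_real d3 * z$3 * \<phi> (z - ax 2 + ax 3) x y = z$3 * \<phi> z x y * (of_real d3 * of_real y) / of_real
      (c3 * x + d3 * y)"
      unfolding phi_shift[OF x y] by simp
    also have "\<dots> = z$3 * \<phi> z x y - of_real (c3 * x) * z$3 * (\<phi> z x y / of_real (c3 * x + d3 * y))"
      unfolding f3 using nz by (simp add: diff_divide_distrib right_diff_distrib del: of_real_add of_real_mult)
    finally have e3: "of_real d3 * z$3 * \<phi> (z - ax 2 + ax 3) x y =
      z$3 * \<phi> z x y - of_real (c3 * x) * z$3 * \<phi> (z + ax 3) x y"
      unfolding phi_shift[OF x y] .
    have "of_real d4 * z$4 * \<phi> (z - ax 2 + ax 4) x y = z$4 * \<phi> z x y * (of_real d4 * of_real y) / of_real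
      (c4 * x + d4 * y)"
      unfolding phi_shift[OF x y] by simp
    also have "\<dots> = z$4 * \<phi> z x y - of_real (c4 * x) * z$4 * (\<phi> z x y / of_real (c4 * x + d4 * y))"
      unfolding f4 using nz by (simp add: diff_divide_distrib right_diff_distrib del: of_real_add of_real_mult)
    finally have e4: "of_real d4 * z$4 * \<phi> (z - ax 2 + ax 4) x y =
      z$4 * \<phi> z x y - of_real (c4 * x) * z$4 * \<phi> (z + ax 4) x y"
      unfolding phi_shift[OF x y] .
    have e1: "\<phi> (z - ax 2 + ax 2) x y = \<phi> z x y" by simp
    have "phiy (z - ax 2) x y = - ((z$2 - 1) * \<phi> z x y + of_real d3 * z$3 * \<phi> (z - ax 2 + ax 3) x y +
      of_real d4 * z$4 * \<phi> (z - ax 2 + ax 4) x y)"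
      unfolding phiy_def e1 by (simp add: ax_nth)
    then show ?thesis unfolding e3 e4 by (simp add: wA_def algebra_simps)
  qed
  have "(1 - wA z) * edge (\<lambda>_. 1) z (a,b) + of_real (c3 * x) * z$3 * edge (\<lambda>_. 1) (z + ax 3) (a,b)
      + of_real (c4 * x) * z$4 * edge (\<lambda>_. 1) (z + ax 4) (a,b) =
    integral {0..1} (\<lambda>t. (1 - wA z) * (1 * \<phi> z x (\<beta> + real b + t)) + of_real (c3 * x) * z$3 * (1 * \<phi> (z +
      ax 3) x (\<beta> + real b + t))
       + of_real (c4 * x) * z$4 * (1 * \<phi> (z + ax 4) x (\<beta> + real b + t)) + 0 * 0 + 0 * 0)"
    unfolding integral_lincomb5[OF c c c continuous_on_const continuous_on_const] by (simp add: edge_def x_def)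
  also have "\<dots> = integral {0..1} (\<lambda>t. phiy (z - ax 2) x (\<beta> + real b + t))"
    by (rule integral_cong) (use pw posy in simp)
  also have "\<dots> = \<phi> (z - ax 2) x (\<beta> + real b + 1) - \<phi> (z - ax 2) x (\<beta> + real b + 0)"
    by (rule integral_unique, rule fundamental_theorem_of_calculus) (use deriv_cell_t[OF _ x] in auto)
  finally show ?thesis by (simp add: x_def pt_def suc_arg del: of_nat_Suc)
qed

lemma cell_split_mean:
  assumes "continuous_on {0..1} P" "continuous_on {0..1} Q"
  shows "cell P Q z m = c * cell (\<lambda>_. 1) Q z m + cell (\<lambda>u. P u - c) Q z m"
proof -
  obtain a b where m: "m = (a,b)" by (cases m)
  let ?I = "\<lambda>P t. integral {0..1} (\<lambda>u. P u * \<phi> z (\<alpha> + real a + u) (\<beta> + real b + t))"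
  have cP: "continuous_on {0..1} (\<lambda>u. P u - c)" by (intro continuous_intros assms)
  have c: "continuous_on {0..1} (\<lambda>u. P u * \<phi> z (\<alpha> + real a + u) y)" if "continuous_on {0..1} P" "y > 0" for y P
    by (intro continuous_intros cont_phi_u that)
  have inner: "?I P t = c * ?I (\<lambda>_. 1) t + ?I (\<lambda>u. P u - c) t" if "t \<in> {0..1}" for t
  proof -
    have y: "\<beta> + real b + t > 0" using posy that by auto
    have "?I P t = integral {0..1} (\<lambda>u. c * (1 * \<phi> z (\<alpha> + real a + u) (\<beta> + real b + t)) +
       1 * ((P u - c) * \<phi> z (\<alpha> + real a + u) (\<beta> + real b + t)) + 0 * 0 + 0 * 0 + 0 * 0)"
      by (rule integral_cong) (simp add: algebra_simps)
    also have "\<dots> = c * ?I (\<lambda>_. 1) t + ?I (\<lambda>u. P u - c) t"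
      by (subst integral_lincomb5) (auto intro: c cP y cont_phi_u)
    finally show ?thesis .
  qed
  have "cell P Q z (a,b) = integral {0..1} (\<lambda>t. c * (Q t * ?I (\<lambda>_. 1) t) +
    1 * (Q t * ?I (\<lambda>u. P u - c) t) + 0 * 0 + 0 * 0 + 0 * 0)"
    unfolding cell_def prod.case by (rule integral_cong) (simp only: inner, simp add: algebra_simps)
  also have "\<dots> = c * cell (\<lambda>_. 1) Q z (a,b) + cell (\<lambda>u. P u - c) Q z (a,b)"
    unfolding cell_def prod.case
    by (subst integral_lincomb5) (auto intro!: continuous_on_mult assms cont_inner[of
      "\<lambda>_. 1", simplified] cont_inner cP)
  finally show ?thesis by (simp add: m)
qed

lemma edge_split_mean:
  assumes "continuous_on {0..1} Q"
  shows "edge Q z m = c * edge (\<lambda>_. 1) z m + edge (\<lambda>u. Q u - c) z m"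
proof -
  obtain a b where m: "m = (a,b)" by (cases m)
  have cP: "continuous_on {0..1} (\<lambda>u. Q u - c)" by (intro continuous_intros assms)
  have "edge Q z (a,b) = integral {0..1} (\<lambda>t. c * (1 * \<phi> z (\<alpha> + real a) (\<beta> + real b + t)) +
     1 * ((Q t - c) * \<phi> z (\<alpha> + real a) (\<beta> + real b + t)) + 0 * 0 + 0 * 0 + 0 * 0)"
    unfolding edge_def prod.case by (rule integral_cong) (simp add: algebra_simps)
  also have "\<dots> = c * edge (\<lambda>_. 1) z (a,b) + edge (\<lambda>u. Q u - c) z (a,b)"
    unfolding edge_def prod.case
    by (subst integral_lincomb5) (auto intro!: continuous_on_mult cP cont_phi_t[OF posx(2)])
  finally show ?thesis by (simp add: m)
qed

lemma cell_form:
  assumes "continuous_on {0..1} P" "continuous_on {0..1} Q"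
  shows "of_real c3 * cell P Q (z - ax 1 + ax 3) m + of_real d3 * cell P Q (z - ax 2 + ax 3) m = cell P Q z m"
    "of_real c4 * cell P Q (z - ax 1 + ax 4) m + of_real d4 * cell P Q (z - ax 2 + ax 4) m = cell P Q z m"
proof -
  obtain a b where m: "m = (a,b)" by (cases m)
  let ?I = "\<lambda>w t. integral {0..1} (\<lambda>u. P u * \<phi> w (\<alpha> + real a + u) (\<beta> + real b + t))"
  have gen: "c * cell P Q w (a,b) + d * cell P Q w' (a,b) = cell P Q z (a,b)"
    if pw: "\<And>x y. x > 0 \<Longrightarrow> y > 0 \<Longrightarrow> c * \<phi> w x y + d * \<phi> w' x y = \<phi> z x y" for c d w w'
  proof -
    have c: "continuous_on {0..1} (\<lambda>u. P u * \<phi> w (\<alpha> + real a + u) y)" if "y > 0" for y w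
      by (intro continuous_intros cont_phi_u that assms)
    have inner: "c * ?I w t + d * ?I w' t = ?I z t" if "t \<in> {0..1}" for t
    proof -
      have y: "\<beta> + real b + t > 0" using posy that by auto
      have "c * ?I w t + d * ?I w' t = integral {0..1} (\<lambda>u. c * (P u * \<phi> w (\<alpha> + real a + u) (\<beta> + real b + t)) +
         d * (P u * \<phi> w' (\<alpha> + real a + u) (\<beta> + real b + t)) + 0 * 0 + 0 * 0 + 0 * 0)"
        by (subst integral_lincomb5) (auto intro: c y)
      also have "\<dots> = ?I z t"
      proof (rule integral_cong)
        fix u :: real assume "u \<in> {0..1}"
        then show "c * (P u * \<phi> w (\<alpha> + real a + u) (\<beta> + real b + t)) +
         d * (P u * \<phi> w' (\<alpha> + real a + u) (\<beta> + real b + t)) + 0 * 0 + 0 * 0 + 0 * 0 = P u * \<phi> z (\<alpha> +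
           real a + u) (\<beta> + real b + t)"
          using pw[OF posx(1)[of u a] y, symmetric] by (simp add: algebra_simps)
      qed
      finally show ?thesis .
    qed
    have "c * cell P Q w (a,b) + d * cell P Q w' (a,b) = integral {0..1} (\<lambda>t. c * (Q t * ?I w t) +
      d * (Q t * ?I w' t) + 0 * 0 + 0 * 0 + 0 * 0)"
      unfolding cell_def prod.case
      by (subst integral_lincomb5) (auto intro!: continuous_on_mult assms cont_inner)
    also have "\<dots> = cell P Q z (a,b)"
      unfolding cell_def prod.case by (rule integral_cong) (simp only: inner[symmetric], simp add: algebra_simps)
    finally show ?thesis .
  qed
  show "of_real c3 * cell P Q (z - ax 1 + ax 3) m + of_real d3 * cell P Q (z - ax 2 + ax 3) m = cell P Q z m"
    "of_real c4 * cell P Q (z - ax 1 + ax 4) m + of_real d4 * cell P Q (z - ax 2 + ax 4) m = cell P Q z m"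
    unfolding m using phi_form by (blast intro: gen)+
qed

end

section \<open>Meromorphic continuation of double Dirichlet series\<close>

text \<open>The parameters count what has been gained in each direction. The base 4, 4, 8 lies
  strictly inside \<open>conv_dom\<close>, which leaves room for the shifts by \<open>- ax 1\<close>
  and \<open>- ax 2\<close> in the Euler identities.\<close>

definition halfspaces :: "real \<Rightarrow> real \<Rightarrow> real \<Rightarrow> (complex^4) set" where
  "halfspaces a b c = {z. Re (wA z) > 4 - a \<and> Re (wB z) > 4 - b \<and> Re (wT z) > 8 - c}"

definition sw :: "complex^4 \<Rightarrow> complex^4" where
  "sw z = (\<chi> j. z $ (if j = 1 then 2 else if j = 2 then 1 else j))"

lemma sw_nth [simp]: "sw z $ 1 = z $ 2" "sw z $ 2 = z $ 1" "sw z $ 3 = z $ 3" "sw z $ 4 = z $ 4"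
  by (auto simp: sw_def)

lemma sw_sw [simp]: "sw (sw z) = z"
  by (simp add: vec_eq_iff forall_4)

lemma sw_add: "sw (x + y) = sw x + sw y" and sw_diff: "sw (x - y) = sw x - sw y"
  by (simp_all add: vec_eq_iff forall_4)

lemma sw_ax: "sw (ax 1) = ax 2" "sw (ax 2) = ax 1" "sw (ax 3) = ax 3" "sw (ax 4) = ax 4"
  by (simp_all add: vec_eq_iff forall_4 ax_nth)

lemma w_sw [simp]: "wA (sw z) = wB z" "wB (sw z) = wA z" "wT (sw z) = wT z"
  by (auto simp: wA_def wB_def wT_def)

lemma holo_at_sw: "holo_at f (sw z) \<Longrightarrow> holo_at (\<lambda>z. f (sw z)) z"
proof (rule holo_at_linear_compose)
  show "bounded_linear sw"
  proof (rule linear_conv_bounded_linear[THEN iffD1])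
    show "linear sw" by (rule linearI) (simp_all add: vec_eq_iff forall_4)
  qed
  show "sw (c *s v) = c *s sw v" for c v by (simp add: vec_eq_iff forall_4)
qed

lemma halfspaces_mono: "a' \<le> a \<Longrightarrow> b' \<le> b \<Longrightarrow> c' \<le> c \<Longrightarrow> halfspaces a' b' c' \<subseteq> halfspaces a b c"
  by (auto simp: halfspaces_def)

lemma open_halfspaces: "open (halfspaces a b c)"
proof -
  have c: "continuous_on UNIV (\<lambda>z. Re (wA z))" "continuous_on UNIV (\<lambda>z. Re (wB z))"
    "continuous_on UNIV (\<lambda>z. Re (wT z))"
    unfolding wA_def wB_def wT_def by (intro continuous_intros)+
  show ?thesis unfolding halfspaces_def
    by (intro open_Collect_conj open_Collect_less c continuous_on_const)
qed

lemma convex_halfspaces: "convex (halfspaces a b c)"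
proof -
  have *: "convex {z. Re (w z) > k}"
    if "\<And>x y :: complex^4. w (x + y) = w x + w y" "\<And>r x. w (r *\<^sub>R x) = r *\<^sub>R w x" for k
      and w :: "complex^4 \<Rightarrow> complex"
  proof -
    have "linear (\<lambda>z. Re (w z))" by (rule linearI) (simp_all add: that)
    then have "convex ((\<lambda>z. Re (w z)) -` {k<..})" by (intro convex_linear_vimage) auto
    then show ?thesis by (simp add: vimage_def)
  qed
  have "convex ({z. Re (wA z) > 4 - a} \<inter> ({z. Re (wB z) > 4 - b} \<inter> {z. Re (wT z) > 8 - c}))"
    by (intro convex_Int *) (auto simp: wA_def wB_def wT_def scaleR_conv_of_real[where 'a =
      complex] algebra_simps)
  then show ?thesis by (simp add: halfspaces_def Collect_conj_eq)
qed

lemma halfspaces0_conv_dom: "z \<in> halfspaces 0 0 0 \<Longrightarrow> z \<in> conv_dom" by (auto simp: halfspaces_def conv_dom_def)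

text \<open>Agreement is required only on the base, where all the series converge; outside of it
  \<open>F\<close> may be an \<open>infsum\<close> without convergence.\<close>

definition holo_ext :: "real \<Rightarrow> real \<Rightarrow> real \<Rightarrow> (complex^4 \<Rightarrow> complex) \<Rightarrow> bool" where
  "holo_ext a b c F \<longleftrightarrow> (\<exists>g. (\<forall>z\<in>halfspaces a b c. holo_at g z) \<and> (\<forall>z\<in>halfspaces 0 0 0. g z = F z))"

lemma holo_extI: "(\<And>z. z \<in> halfspaces a b c \<Longrightarrow> holo_at F z) \<Longrightarrow> holo_ext a b c F"
  unfolding holo_ext_def by blast

lemma holo_ext_mono: "holo_ext a b c F \<Longrightarrow> a' \<le> a \<Longrightarrow> b' \<le> b \<Longrightarrow> c' \<le> c \<Longrightarrow> holo_ext a' b' c' F"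
  unfolding holo_ext_def using halfspaces_mono by blast

lemma holo_ext_cong: "holo_ext a b c F \<Longrightarrow> (\<And>z. z \<in> halfspaces 0 0 0 \<Longrightarrow> F z = G z) \<Longrightarrow> holo_ext a b c G"
  unfolding holo_ext_def by auto

lemma holo_ext_add: "holo_ext a b c F \<Longrightarrow> holo_ext a b c G \<Longrightarrow> holo_ext a b c (\<lambda>z. F z + G z)"
  unfolding holo_ext_def by (elim exE conjE, rule_tac x = "\<lambda>z. g z + ga z" in exI) (auto intro: holo_at_add)

lemma holo_ext_mult: "holo_ext a b c F \<Longrightarrow> holo_ext a b c G \<Longrightarrow> holo_ext a b c (\<lambda>z. F z * G z)"
  unfolding holo_ext_def by (elim exE conjE, rule_tac x = "\<lambda>z. g z * ga z" in exI) (auto intro: holo_at_mult)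

lemma holo_ext_shift:
  assumes "holo_ext a b c F" "wA e = of_real x" "wB e = of_real y" "wT e = of_real t" "x \<ge> 0" "y \<ge> 0" "t \<ge> 0"
  shows "holo_ext (a + x) (b + y) (c + t) (\<lambda>z. F (z + e))"
proof -
  obtain g where g: "\<And>z. z \<in> halfspaces a b c \<Longrightarrow> holo_at g z" "\<And>z. z \<in> halfspaces 0 0 0 \<Longrightarrow> g z = F z"
    using assms(1) unfolding holo_ext_def by blast
  have 1: "z + e \<in> halfspaces a b c" if "z \<in> halfspaces (a + x) (b + y) (c + t)" for z
    using that assms(2-7) by (auto simp: halfspaces_def w_add)
  have 2: "z + e \<in> halfspaces 0 0 0" if "z \<in> halfspaces 0 0 0" for z using that assms(2-7)
    by (auto simp: halfspaces_def w_add)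
  show ?thesis unfolding holo_ext_def
    by (rule exI[of _ "\<lambda>z. g (z + e)"]) (use g 1 2 in \<open>auto intro: holo_at_shift\<close>)
qed

lemma holo_ext_sw: assumes "holo_ext a b c F" shows "holo_ext b a c (\<lambda>z. F (sw z))"
proof -
  obtain g where g: "\<And>z. z \<in> halfspaces a b c \<Longrightarrow> holo_at g z" "\<And>z. z \<in> halfspaces 0 0 0 \<Longrightarrow> g z = F z"
    using assms(1) unfolding holo_ext_def by blast
  have "sw z \<in> halfspaces a b c \<longleftrightarrow> z \<in> halfspaces b a c" for z a b c by (auto simp: halfspaces_def)
  then show ?thesis unfolding holo_ext_def
    by (intro exI[of _ "\<lambda>z. g (sw z)"]) (use g in \<open>auto intro: holo_at_sw\<close>)
qed

text \<open>The bound \<open>-2\<close> keeps the denominators from vanishing identically on the lines on which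
  the functional relation lives.\<close>

inductive denominator :: "(complex^4 \<Rightarrow> complex) \<Rightarrow> bool" where
  denominator_1: "denominator (\<lambda>_. 1)"
| denominator_A: "c \<ge> -2 \<Longrightarrow> denominator h \<Longrightarrow> denominator (\<lambda>z. (wA z + of_real c) * h z)"
| denominator_B: "c \<ge> -2 \<Longrightarrow> denominator h \<Longrightarrow> denominator (\<lambda>z. (wB z + of_real c) * h z)"
| denominator_T: "c \<ge> -2 \<Longrightarrow> denominator h \<Longrightarrow> denominator (\<lambda>z. (wT z + of_real c) * h z)"

lemma denominator_holo_at: "denominator h \<Longrightarrow> holo_at h z"
  by (induction rule: denominator.induct) (auto intro!: holo_at_mult holo_at_add holo_at_w)

lemma denominator_mult: "denominator h \<Longrightarrow> denominator k \<Longrightarrow> denominator (\<lambda>z. h z * k z)"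
  by (induction rule: denominator.induct) (auto simp: mult.assoc intro: denominator.intros)

text \<open>A shift that raises the three forms raises the constants \<open>c\<close>, so the bound
  -2 survives the recursions.\<close>

lemma denominator_shift:
  assumes e: "wA e = of_real x" "wB e = of_real y" "wT e = of_real t" "x \<ge> 0" "y \<ge> 0" "t \<ge> 0"
  shows "denominator h \<Longrightarrow> denominator (\<lambda>z. h (z + e))"
proof (induction rule: denominator.induct)
  case (denominator_A c h)
  have "denominator (\<lambda>z. (wA z + of_real (x + c)) * h (z + e))" using denominator_A e
    by (intro denominator.denominator_A) auto
  then show ?case by (simp add: w_add e add.assoc)
next
  case (denominator_B c h)
  have "denominator (\<lambda>z. (wB z + of_real (y + c)) * h (z + e))" using denominator_B e
    by (intro denominator.denominator_B) auto
  then show ?case by (simp add: w_add e add.assoc)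
next
  case (denominator_T c h)
  have "denominator (\<lambda>z. (wT z + of_real (t + c)) * h (z + e))" using denominator_T e
    by (intro denominator.denominator_T) auto
  then show ?case by (simp add: w_add e add.assoc)
qed (auto intro: denominator.intros)

lemma denominator_sw: "denominator h \<Longrightarrow> denominator (\<lambda>z. h (sw z))"
  by (induction rule: denominator.induct) (auto intro: denominator.intros)

lemma denominator_nonzero_real:
  assumes "denominator h" "\<And>c. c \<ge> -2 \<Longrightarrow> wA z + of_real c \<noteq> 0" "\<And>c. c \<ge> -2 \<Longrightarrow> wB z + of_real c \<noteq> 0"
    "\<And>c. c \<ge> -2 \<Longrightarrow> wT z + of_real c \<noteq> 0"
  shows "h z \<noteq> 0"
  using assms(1) by (induction rule: denominator.induct) (use assms(2-) in auto)

definition mero_ext :: "real \<Rightarrow> real \<Rightarrow> real \<Rightarrow> (complex^4 \<Rightarrow> complex) \<Rightarrow> bool" where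
  "mero_ext a b c F \<longleftrightarrow> (\<exists>h. denominator h \<and> holo_ext a b c (\<lambda>z. h z * F z))"

lemma holo_imp_mero_ext: "holo_ext a b c F \<Longrightarrow> mero_ext a b c F"
  unfolding mero_ext_def by (rule exI[of _ "\<lambda>_. 1"]) (simp add: denominator_1)

lemma mero_ext_mono: "mero_ext a b c F \<Longrightarrow> a' \<le> a \<Longrightarrow> b' \<le> b \<Longrightarrow> c' \<le> c \<Longrightarrow> mero_ext a' b' c' F"
  unfolding mero_ext_def using holo_ext_mono by blast

lemma mero_ext_cong: "mero_ext a b c F \<Longrightarrow> (\<And>z. z \<in> halfspaces 0 0 0 \<Longrightarrow> F z = G z) \<Longrightarrow> mero_ext a b c G"
  unfolding mero_ext_def by (elim exE conjE) (rule exI, rule conjI, assumption, erule holo_ext_cong, simp)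

lemma mero_ext_entire: "(\<And>z. holo_at k z) \<Longrightarrow> mero_ext a b c k"
  by (intro holo_imp_mero_ext holo_extI)

lemma mero_ext_add: assumes "mero_ext a b c F" "mero_ext a b c G" shows "mero_ext a b c (\<lambda>z. F z + G z)"
proof -
  obtain h k where h: "denominator h" "holo_ext a b c (\<lambda>z. h z * F z)" and k: "denominator k"
    "holo_ext a b c (\<lambda>z. k z * G z)"
    using assms unfolding mero_ext_def by blast
  have "holo_ext a b c (\<lambda>z. k z * (h z * F z) + h z * (k z * G z))"
    by (intro holo_ext_add holo_ext_mult h k holo_extI denominator_holo_at)
  then have "holo_ext a b c (\<lambda>z. (h z * k z) * (F z + G z))" by (simp add: algebra_simps)
  then show ?thesis unfolding mero_ext_def using denominator_mult[OF h(1) k(1)] by blast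
qed

lemma mero_ext_mult: assumes "\<And>z. holo_at k z" "mero_ext a b c F" shows "mero_ext a b c (\<lambda>z. k z * F z)"
proof -
  obtain h where h: "denominator h" "holo_ext a b c (\<lambda>z. h z * F z)" using assms unfolding mero_ext_def by blast
  have "holo_ext a b c (\<lambda>z. k z * (h z * F z))" by (intro holo_ext_mult h holo_extI assms)
  then have "holo_ext a b c (\<lambda>z. h z * (k z * F z))" by (simp add: algebra_simps)
  then show ?thesis unfolding mero_ext_def using h by blast
qed

lemma mero_ext_shift:
  assumes "mero_ext a b c F" "wA e = of_real x" "wB e = of_real y" "wT e = of_real t" "x \<ge> 0" "y \<ge> 0" "t \<ge> 0"
    "a' \<le> a + x" "b' \<le> b + y" "c' \<le> c + t"
  shows "mero_ext a' b' c' (\<lambda>z. F (z + e))"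
proof -
  obtain h where h: "denominator h" "holo_ext a b c (\<lambda>z. h z * F z)" using assms(1)
    unfolding mero_ext_def by blast
  show ?thesis
    using denominator_shift[OF assms(2-7) h(1)] holo_ext_mono[OF holo_ext_shift[OF h(2) assms(2-7)] assms(8-10)]
    unfolding mero_ext_def by blast
qed

lemma mero_ext_sw: "mero_ext a b c F \<Longrightarrow> mero_ext b a c (\<lambda>z. F (sw z))"
  unfolding mero_ext_def using denominator_sw holo_ext_sw by blast

text \<open>The one source of denominator factors: an Euler identity expresses
  \<open>(w + k) F\<close> through functions already continued. It is used with
  \<open>k = -1\<close> for \<open>wA\<close> and \<open>k = -2\<close> for \<open>wT\<close>;
  factors in \<open>wB\<close> arise by exchanging the variables.\<close>

lemma mero_ext_divide:
  assumes "mero_ext a b c G" "k \<ge> -2" "w = wA \<or> w = wB \<or> w = wT" "\<And>z. z \<in> halfspaces 0 0 0 \<Longrightarrow> G z = (w z +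
    of_real k) * F z"
  shows "mero_ext a b c F"
proof -
  obtain h where h: "denominator h" "holo_ext a b c (\<lambda>z. h z * G z)" using assms(1)
    unfolding mero_ext_def by blast
  have "holo_ext a b c (\<lambda>z. ((w z + of_real k) * h z) * F z)"
    by (rule holo_ext_cong[OF h(2)]) (simp add: assms(4))
  moreover have "denominator (\<lambda>z. (w z + of_real k) * h z)" using assms(2,3) h(1)
    by (auto intro: denominator.intros)
  ultimately show ?thesis unfolding mero_ext_def by blast
qed

lemma conv_dom_shift: "z \<in> conv_dom \<Longrightarrow> z + ax j \<in> conv_dom"
  using exhaust_4[of j] by (auto simp: conv_dom_def w_add w_ax)

lemma conv_dom_shift2: "z \<in> conv_dom \<Longrightarrow> z - ax 2 + ax 3 \<in> conv_dom" "z \<in> conv_dom \<Longrightarrow> z - ax 2 + ax 4 \<in> conv_dom"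
   "z \<in> conv_dom \<Longrightarrow> z - ax 1 + ax 3 \<in> conv_dom" "z \<in> conv_dom \<Longrightarrow> z - ax 1 + ax 4 \<in> conv_dom"
  by (auto simp: conv_dom_def w_add w_diff w_ax)

lemma halfspaces_minus: "z \<in> halfspaces 0 0 0 \<Longrightarrow> z - ax 1 \<in> conv_dom" "z \<in> halfspaces 0 0 0 \<Longrightarrow> z - ax 2 \<in> conv_dom"
  by (auto simp: halfspaces_def conv_dom_def w_diff w_ax)

section \<open>The cell identities summed over all cells\<close>

context conical begin

text \<open>Only \<open>E\<close> is a single sum: it runs over the boundary row
  \<open>a = 0\<close>, the part that survives telescoping in \<open>a\<close>.\<close>

definition "J P Q z = infsum (cell P Q z) UNIV"
definition "E Q z = infsum (\<lambda>b. edge Q z (0,b)) UNIV"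
definition "Y Q z = infsum (edge Q z) UNIV"
definition "Z z = infsum (pt z) UNIV"

abbreviation "one \<equiv> (\<lambda>_ :: real. 1 :: complex)"

lemma cone: "continuous_on {0..1} one" by simp
lemma cW1: "continuous_on {0..1} W1" by (intro continuous_intros)

lemma summable_cell: "continuous_on {0..1} P \<Longrightarrow> continuous_on {0..1} Q \<Longrightarrow> z \<in> conv_dom \<Longrightarrow>
  cell P Q z summable_on UNIV"
  by (intro dominated_summable dominated_cell)

lemma summable_edge: "continuous_on {0..1} Q \<Longrightarrow> z \<in> conv_dom \<Longrightarrow> edge Q z summable_on UNIV"
  by (intro dominated_summable dominated_edge)

lemma summable_edge1: "continuous_on {0..1} Q \<Longrightarrow> Re (wA z) > 1 \<Longrightarrow> (\<lambda>b. edge Q z (0,b)) summable_on UNIV"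
  by (intro dominated_summable1 dominated_edge)

lemma edge_diff_sum:
  assumes "continuous_on {0..1} Q" "z \<in> conv_dom"
  shows "(\<lambda>(a,b). edge Q z (Suc a,b) - edge Q z (a,b)) summable_on UNIV"
    "infsum (\<lambda>(a,b). edge Q z (Suc a,b) - edge Q z (a,b)) UNIV = - E Q z"
proof -
  note t = infsum_pair_telescope[OF summable_edge[OF assms]]
  have "(\<lambda>m. (case m of (a,b) \<Rightarrow> edge Q z (Suc a,b)) + - edge Q z m) summable_on UNIV"
    by (intro summable_on_add t(2)) (simp add: summable_edge[OF assms] summable_on_uminus)
  then show "(\<lambda>(a,b). edge Q z (Suc a,b) - edge Q z (a,b)) summable_on UNIV"
    by (simp add: case_prod_unfold)
  show "infsum (\<lambda>(a,b). edge Q z (Suc a,b) - edge Q z (a,b)) UNIV = - E Q z"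
    using t(1) by (simp add: E_def)
qed

lemma J_parts:
  assumes "mz P"
  obtains V where "mz V" "\<And>Q z. continuous_on {0..1} Q \<Longrightarrow> z \<in> conv_dom \<Longrightarrow>
    J P Q z = - V 0 * E Q z + z$1 * J V Q (z + ax 1)
      + of_real c3 * z$3 * J V Q (z + ax 3) + of_real c4 * z$4 * J V Q (z + ax 4)"
proof -
  obtain V where V: "mz V" "\<And>Q z a b. continuous_on {0..1} Q \<Longrightarrow>
    cell P Q z (a,b) = V 0 * (edge Q z (Suc a,b) - edge Q z (a,b)) + z$1 * cell V Q (z + ax 1) (a,b)
      + of_real c3 * z$3 * cell V Q (z + ax 3) (a,b) + of_real c4 * z$4 * cell V Q (z + ax 4) (a,b)"
    using cell_parts[OF assms] by blast
  show ?thesis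
  proof (rule that[OF V(1)])
    fix Q z assume Q: "continuous_on {0..1} (Q :: real \<Rightarrow> complex)" and z: "z \<in> conv_dom"
    have s: "cell V Q (z + ax j) summable_on UNIV" for j
      by (intro summable_cell Q conv_dom_shift z) (use V in auto)
    have "J P Q z = infsum (\<lambda>m. V 0 * (case m of (a,b) \<Rightarrow> edge Q z (Suc a,b) - edge Q z (a,b)) +
      z$1 * cell V Q (z + ax 1) m
      + of_real c3 * z$3 * cell V Q (z + ax 3) m + of_real c4 * z$4 * cell V Q (z + ax 4) m + 0 * 0) UNIV"
      unfolding J_def by (rule infsum_cong) (auto simp: V(2)[OF Q])
    then show "J P Q z = - V 0 * E Q z + z$1 * J V Q (z + ax 1)
      + of_real c3 * z$3 * J V Q (z + ax 3) + of_real c4 * z$4 * J V Q (z + ax 4)"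
      unfolding infsum_lincomb5[OF edge_diff_sum(1)[OF Q z] s s s summable_on_0_simp] edge_diff_sum(2)[OF
        Q z] J_def
      by simp
  qed
qed

lemma edge0_shift: "edge Q (z - ax 1) (0,b) = of_real \<alpha> * edge Q z (0,b)"
proof -
  have "integral {0..1} (\<lambda>t. Q t * \<phi> (z - ax 1) (\<alpha> + real 0) (\<beta> + real b + t)) =
     integral {0..1} (\<lambda>t. of_real \<alpha> * (Q t * \<phi> z (\<alpha> + real 0) (\<beta> + real b + t)))"
    by (rule integral_cong) (use phi_shift(5)[OF posx(2)[of 0] posy(1)] in simp)
  then show ?thesis by (simp add: edge_def)
qed

lemma J_euler:
  assumes Q: "continuous_on {0..1} Q" and z: "z \<in> halfspaces 0 0 0"
  shows "(1 - wB z) * J one Q z + of_real d3 * z$3 * J one Q (z - ax 2 + ax 3)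
      + of_real d4 * z$4 * J one Q (z - ax 2 + ax 4) = - of_real \<alpha> * E Q z"
proof -
  note z4 = halfspaces0_conv_dom[OF z]
  have "(1 - wB z) * J one Q z + of_real d3 * z$3 * J one Q (z - ax 2 + ax 3)
      + of_real d4 * z$4 * J one Q (z - ax 2 + ax 4) =
     infsum (\<lambda>m. (1 - wB z) * cell one Q z m + of_real d3 * z$3 * cell one Q (z - ax 2 + ax 3) m
      + of_real d4 * z$4 * cell one Q (z - ax 2 + ax 4) m + 0 * 0 + 0 * 0) UNIV"
    by (subst infsum_lincomb5) (auto intro!: summable_cell Q z4 conv_dom_shift2 simp: J_def)
  also have "\<dots> = infsum (\<lambda>(a,b). edge Q (z - ax 1) (Suc a,b) - edge Q (z - ax 1) (a,b)) UNIV"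
    by (rule infsum_cong) (auto simp: cell_euler[OF Q])
  also have "\<dots> = - E Q (z - ax 1)" by (rule edge_diff_sum(2)[OF Q halfspaces_minus(1)[OF z]])
  \<comment> \<open>On the row \<open>a = 0\<close> the variable \<open>x\<close> is the constant
    \<open>\<alpha>\<close>, so lowering its exponent by one is multiplication by
    \<open>\<alpha>\<close>.\<close>
  also have "E Q (z - ax 1) = of_real \<alpha> * E Q z"
    unfolding E_def edge0_shift by (rule infsum_cmult_right')
  finally show ?thesis by simp
qed

lemma pt_diff_sum:
  assumes "Re (wA z) > 1"
  shows "(\<lambda>b. pt z (0,Suc b) - pt z (0,b)) summable_on UNIV"
    "infsum (\<lambda>b. pt z (0,Suc b) - pt z (0,b)) UNIV = - \<phi> z \<alpha> \<beta>"
proof -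
  have s: "summable (\<lambda>b. norm (pt z (0,b)))" "summable (\<lambda>b. pt z (0,b))"
    using dominated_summable1[OF dominated_pt assms] by auto
  have s': "summable (\<lambda>b. norm (pt z (0,Suc b)))" using s(1) summable_Suc_iff[of "\<lambda>b. norm (pt z (0,b))"] by simp
  have "summable (\<lambda>b. norm (pt z (0,Suc b) - pt z (0,b)))"
    by (rule summable_comparison_test'[OF summable_add[OF s' s(1)], of 0]) (simp add: norm_triangle_ineq4)
  then show "(\<lambda>b. pt z (0,Suc b) - pt z (0,b)) summable_on UNIV"
    "infsum (\<lambda>b. pt z (0,Suc b) - pt z (0,b)) UNIV = - \<phi> z \<alpha> \<beta>"
    using norm_summable_imp_summable_on suminf_telescope'[OF s(2)]
    by (auto simp: infsum_nat_suminf pt_def)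
qed

lemma E_parts:
  assumes "mz Q"
  obtains V where "mz V" "\<And>z. Re (wA z) > 1 \<Longrightarrow>
    E Q z = - V 0 * \<phi> z \<alpha> \<beta> + z$2 * E V (z + ax 2)
      + of_real d3 * z$3 * E V (z + ax 3) + of_real d4 * z$4 * E V (z + ax 4)"
proof -
  obtain V where V: "mz V" "\<And>z a b.
    edge Q z (a,b) = V 0 * (pt z (a,Suc b) - pt z (a,b)) + z$2 * edge V (z + ax 2) (a,b)
      + of_real d3 * z$3 * edge V (z + ax 3) (a,b) + of_real d4 * z$4 * edge V (z + ax 4) (a,b)"
    using edge_parts[OF assms] by blast
  show ?thesis
  proof (rule that[OF V(1)])
    fix z assume z: "Re (wA z) > 1"
    have s: "(\<lambda>b. edge V (z + ax j) (0,b)) summable_on UNIV" for j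
      by (intro summable_edge1) (use V z exhaust_4[of j] in \<open>auto simp: w_add w_ax\<close>)
    have "E Q z = infsum (\<lambda>b. V 0 * (pt z (0,Suc b) - pt z (0,b)) + z$2 * edge V (z + ax 2) (0,b)
      + of_real d3 * z$3 * edge V (z + ax 3) (0,b) + of_real d4 * z$4 * edge V (z + ax 4) (0,b) + 0 * 0) UNIV"
      unfolding E_def by (rule infsum_cong) (simp only: V(2), simp)
    then show "E Q z = - V 0 * \<phi> z \<alpha> \<beta> + z$2 * E V (z + ax 2)
      + of_real d3 * z$3 * E V (z + ax 3) + of_real d4 * z$4 * E V (z + ax 4)"
      unfolding infsum_lincomb5[OF pt_diff_sum(1)[OF z] s s s summable_on_0_simp] pt_diff_sum(2)[OF z] E_def
      by simp
  qed
qed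

text \<open>Telescoping in \<open>b\<close> leaves the corner value of
  \<open>\<phi> (z - ax 2)\<close>. The bound 2 instead of 1 keeps this shifted point in the range
  of convergence.\<close>

lemma E_euler:
  assumes z: "Re (wA z) > 2"
  shows "(1 - wA z) * E one z + of_real (c3 * \<alpha>) * z$3 * E one (z + ax 3)
      + of_real (c4 * \<alpha>) * z$4 * E one (z + ax 4) = - of_real \<beta> * \<phi> z \<alpha> \<beta>"
proof -
  have s: "(\<lambda>b. edge one (z + ax j) (0,b)) summable_on UNIV" "(\<lambda>b. edge one z (0,b)) summable_on UNIV" for j
    by (intro summable_edge1 cone; use z exhaust_4[of j] in \<open>auto simp: w_add w_ax\<close>)+
  have "(1 - wA z) * E one z + of_real (c3 * \<alpha>) * z$3 * E one (z + ax 3)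
      + of_real (c4 * \<alpha>) * z$4 * E one (z + ax 4) =
    infsum (\<lambda>b. (1 - wA z) * edge one z (0,b) + of_real (c3 * \<alpha>) * z$3 * edge one (z + ax 3) (0,b)
      + of_real (c4 * \<alpha>) * z$4 * edge one (z + ax 4) (0,b) + 0 * 0 + 0 * 0) UNIV"
    unfolding infsum_lincomb5[OF s(2) s(1) s(1) summable_on_0_simp summable_on_0_simp] E_def by simp
  also have "\<dots> = infsum (\<lambda>b. pt (z - ax 2) (0,Suc b) - pt (z - ax 2) (0,b)) UNIV"
    by (rule infsum_cong) (use edge_euler[of z 0] in simp)
  also have "\<dots> = - \<phi> (z - ax 2) \<alpha> \<beta>" by (rule pt_diff_sum(2)) (use z in \<open>simp add: w_diff w_ax\<close>)
  finally show ?thesis using phi_shift(6)[of \<alpha> \<beta> z] al be by simp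
qed

lemma E_holo_at: "continuous_on {0..1} Q \<Longrightarrow> Re (wA z) > 1 \<Longrightarrow> holo_at (E Q) z"
  unfolding E_def[abs_def] by (intro dominated_holo_at1 dominated_edge)

lemma J_holo_at: "continuous_on {0..1} P \<Longrightarrow> continuous_on {0..1} Q \<Longrightarrow> z \<in> conv_dom \<Longrightarrow> holo_at (J P Q) z"
  unfolding J_def[abs_def] by (intro dominated_holo_at dominated_cell)

lemma Z_holo_at: "z \<in> conv_dom \<Longrightarrow> holo_at Z z"
  unfolding Z_def[abs_def] by (intro dominated_holo_at dominated_pt)

end

lemma holo_at_coef: "holo_at (\<lambda>z. c * z $ j) z" by (intro holo_at_intros)

lemma mero_ext_scale: "mero_ext a b c F \<Longrightarrow> mero_ext a b c (\<lambda>z. k * F z)"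
  by (rule mero_ext_mult) auto

lemma mero_ext_coef: "mero_ext a b c F \<Longrightarrow> mero_ext a b c (\<lambda>z. k * z $ j * F z)"
  by (rule mero_ext_mult) (rule holo_at_coef)

lemma mero_ext_coef1: "mero_ext a b c F \<Longrightarrow> mero_ext a b c (\<lambda>z. z $ j * F z)"
  by (rule mero_ext_mult) auto

lemma mero_ext_diff: "mero_ext a b c F \<Longrightarrow> mero_ext a b c G \<Longrightarrow> mero_ext a b c (\<lambda>z. F z - G z)"
  using mero_ext_add[OF _ mero_ext_scale[of a b c G "-1"], of F] by simp

text \<open>The gains are read off from \<open>w_ax\<close>. The exchanges such as
  \<open>- ax 2 + ax 3\<close> leave \<open>wT\<close> unchanged, so the Euler identity of
  \<open>J\<close> in one variable never improves \<open>c\<close>; for constant weights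
  \<open>J_one_one_euler\<close> does.\<close>

lemma mero_ext_shift_ax:
  assumes "mero_ext a b c F"
  shows "a' \<le> a \<Longrightarrow> b' \<le> b + 1 \<Longrightarrow> c' \<le> c + 1 \<Longrightarrow> mero_ext a' b' c' (\<lambda>z. F (z + ax 1))"
    "a' \<le> a + 1 \<Longrightarrow> b' \<le> b \<Longrightarrow> c' \<le> c + 1 \<Longrightarrow> mero_ext a' b' c' (\<lambda>z. F (z + ax 2))"
    "a' \<le> a + 1 \<Longrightarrow> b' \<le> b + 1 \<Longrightarrow> c' \<le> c + 1 \<Longrightarrow> mero_ext a' b' c' (\<lambda>z. F (z + ax 3))"
    "a' \<le> a + 1 \<Longrightarrow> b' \<le> b + 1 \<Longrightarrow> c' \<le> c + 1 \<Longrightarrow> mero_ext a' b' c' (\<lambda>z. F (z + ax 4))"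
    "a' \<le> a \<Longrightarrow> b' \<le> b + 1 \<Longrightarrow> c' \<le> c \<Longrightarrow> mero_ext a' b' c' (\<lambda>z. F (z - ax 2 + ax 3))"
    "a' \<le> a \<Longrightarrow> b' \<le> b + 1 \<Longrightarrow> c' \<le> c \<Longrightarrow> mero_ext a' b' c' (\<lambda>z. F (z - ax 2 + ax 4))"
    "a' \<le> a + 1 \<Longrightarrow> b' \<le> b \<Longrightarrow> c' \<le> c \<Longrightarrow> mero_ext a' b' c' (\<lambda>z. F (z - ax 1 + ax 3))"
    "a' \<le> a + 1 \<Longrightarrow> b' \<le> b \<Longrightarrow> c' \<le> c \<Longrightarrow> mero_ext a' b' c' (\<lambda>z. F (z - ax 1 + ax 4))"
proof -
  show "a' \<le> a + 1 \<Longrightarrow> b' \<le> b \<Longrightarrow> c' \<le> c \<Longrightarrow> mero_ext a' b' c' (\<lambda>z. F (z - ax 1 + ax 3))"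
    using mero_ext_shift[OF assms, of "ax 3 - ax 1" 1 0 0 a' b' c'] by (simp add: w_ax w_diff algebra_simps)
  show "a' \<le> a + 1 \<Longrightarrow> b' \<le> b \<Longrightarrow> c' \<le> c \<Longrightarrow> mero_ext a' b' c' (\<lambda>z. F (z - ax 1 + ax 4))"
    using mero_ext_shift[OF assms, of "ax 4 - ax 1" 1 0 0 a' b' c'] by (simp add: w_ax w_diff algebra_simps)
  show "a' \<le> a \<Longrightarrow> b' \<le> b + 1 \<Longrightarrow> c' \<le> c + 1 \<Longrightarrow> mero_ext a' b' c' (\<lambda>z. F (z + ax 1))"
    using mero_ext_shift[OF assms, of "ax 1" 0 1 1 a' b' c'] by (simp add: w_ax)
  show "a' \<le> a + 1 \<Longrightarrow> b' \<le> b \<Longrightarrow> c' \<le> c + 1 \<Longrightarrow> mero_ext a' b' c' (\<lambda>z. F (z + ax 2))"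
    using mero_ext_shift[OF assms, of "ax 2" 1 0 1 a' b' c'] by (simp add: w_ax)
  show "a' \<le> a + 1 \<Longrightarrow> b' \<le> b + 1 \<Longrightarrow> c' \<le> c + 1 \<Longrightarrow> mero_ext a' b' c' (\<lambda>z. F (z + ax 3))"
    using mero_ext_shift[OF assms, of "ax 3" 1 1 1 a' b' c'] by (simp add: w_ax)
  show "a' \<le> a + 1 \<Longrightarrow> b' \<le> b + 1 \<Longrightarrow> c' \<le> c + 1 \<Longrightarrow> mero_ext a' b' c' (\<lambda>z. F (z + ax 4))"
    using mero_ext_shift[OF assms, of "ax 4" 1 1 1 a' b' c'] by (simp add: w_ax)
  show "a' \<le> a \<Longrightarrow> b' \<le> b + 1 \<Longrightarrow> c' \<le> c \<Longrightarrow> mero_ext a' b' c' (\<lambda>z. F (z - ax 2 + ax 3))"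
    using mero_ext_shift[OF assms, of "ax 3 - ax 2" 0 1 0 a' b' c'] by (simp add: w_ax w_diff algebra_simps)
  show "a' \<le> a \<Longrightarrow> b' \<le> b + 1 \<Longrightarrow> c' \<le> c \<Longrightarrow> mero_ext a' b' c' (\<lambda>z. F (z - ax 2 + ax 4))"
    using mero_ext_shift[OF assms, of "ax 4 - ax 2" 0 1 0 a' b' c'] by (simp add: w_ax w_diff algebra_simps)
qed

lemma holo_ext_shift_ax:
  assumes "holo_ext a b c F" "b \<ge> 0" "c \<ge> 0"
  shows "holo_ext (a + 1) b c (\<lambda>z. F (z + ax 2))" "holo_ext (a + 1) b c (\<lambda>z. F (z + ax 3))"
    "holo_ext (a + 1) b c (\<lambda>z. F (z + ax 4))"
proof -
  show "holo_ext (a + 1) b c (\<lambda>z. F (z + ax 2))"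
    using holo_ext_mono[OF holo_ext_shift[OF assms(1), of "ax 2" 1 0 1], of "a + 1" b c] by (simp add: w_ax)
  show "holo_ext (a + 1) b c (\<lambda>z. F (z + ax 3))"
    using holo_ext_mono[OF holo_ext_shift[OF assms(1), of "ax 3" 1 1 1], of "a + 1" b c] by (simp add: w_ax)
  show "holo_ext (a + 1) b c (\<lambda>z. F (z + ax 4))"
    using holo_ext_mono[OF holo_ext_shift[OF assms(1), of "ax 4" 1 1 1], of "a + 1" b c] by (simp add: w_ax)
qed

lemma halfspaces0_w: "z \<in> halfspaces 0 0 0 \<Longrightarrow> Re (wA z) > 4" by (simp add: halfspaces_def)

section \<open>Continuation by induction over the half-spaces\<close>

context conical begin

text \<open>Integration by parts creates no denominators, so this extension is holomorphic. The
  stronger form is what makes the remainder term of the Riemann zeta-function entire.\<close>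

lemma E_holo_ext_mean_zero:
  assumes "mz Q" "b \<ge> 0" "c \<ge> 0" shows "holo_ext (real n) b c (E Q)"
  using assms(1)
proof (induction n arbitrary: Q)
  case 0
  show ?case by (rule holo_extI, rule E_holo_at) (use 0 in \<open>auto simp: halfspaces_def\<close>)
next
  case (Suc n)
  obtain V where V: "mz V" "\<And>z. Re (wA z) > 1 \<Longrightarrow>
    E Q z = - V 0 * \<phi> z \<alpha> \<beta> + z$2 * E V (z + ax 2)
      + of_real d3 * z$3 * E V (z + ax 3) + of_real d4 * z$4 * E V (z + ax 4)"
    using E_parts[OF Suc.prems] by blast
  note cV = holo_ext_shift_ax[OF Suc.IH[OF V(1)] assms(2,3)]
  have "holo_ext (real n + 1) b c (\<lambda>z. - V 0 * \<phi> z \<alpha> \<beta> + z$2 * E V (z + ax 2)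
      + of_real d3 * z$3 * E V (z + ax 3) + of_real d4 * z$4 * E V (z + ax 4))"
    by (intro holo_ext_add holo_ext_mult[where F = "\<lambda>z. z$2"] holo_ext_mult[where F = "\<lambda>z. of_real d3 * z$3"]
        holo_ext_mult[where F = "\<lambda>z. of_real d4 * z$4"] holo_extI[where F =
          "\<lambda>z. - V 0 * \<phi> z \<alpha> \<beta>"] cV holo_extI[where F = "\<lambda>z. z$2"]
        holo_extI[where F = "\<lambda>z. of_real d3 * z$3"] holo_extI[where F =
          "\<lambda>z. of_real d4 * z$4"] holo_at_mult holo_at_const holo_at_coord holo_at_phi)
  then have "holo_ext (real n + 1) b c (E Q)"
    by (rule holo_ext_cong) (use V(2) halfspaces0_w in force)
  then show ?case by (simp add: add.commute)
qed

lemma E_one_mero_ext: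
  assumes "b \<ge> 0" "c \<ge> 0" shows "mero_ext (real n) b c (E one)"
proof (induction n)
  case 0
  show ?case by (rule holo_imp_mero_ext, rule holo_extI, rule E_holo_at)
    (use cone in \<open>auto simp: halfspaces_def\<close>)
next
  case (Suc n)
  note IH = mero_ext_shift_ax[OF Suc.IH]
  have "mero_ext (real n + 1) b c (\<lambda>z. of_real \<beta> * \<phi> z \<alpha> \<beta> + of_real (c3 * \<alpha>) * z$3 * E one (z + ax 3)
      + of_real (c4 * \<alpha>) * z$4 * E one (z + ax 4))"
    by (intro mero_ext_add mero_ext_coef IH mero_ext_scale mero_ext_entire holo_at_phi) (use assms in auto)
  then have "mero_ext (real n + 1) b c (E one)"
  proof (rule mero_ext_divide[where k = "-1" and w = wA])
    fix z assume "z \<in> halfspaces 0 0 0"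
    then have "(1 - wA z) * E one z + of_real (c3 * \<alpha>) * z$3 * E one (z + ax 3)
      + of_real (c4 * \<alpha>) * z$4 * E one (z + ax 4) = - of_real \<beta> * \<phi> z \<alpha> \<beta>"
      using halfspaces0_w[of z] by (intro E_euler) auto
    then show "of_real \<beta> * \<phi> z \<alpha> \<beta> + of_real (c3 * \<alpha>) * z$3 * E one (z + ax 3)
      + of_real (c4 * \<alpha>) * z$4 * E one (z + ax 4) = (wA z + of_real (-1)) * E one z"
      by (simp add: algebra_simps)
  qed auto
  then show ?case by (simp add: add.commute)
qed

lemma E_split: "continuous_on {0..1} Q \<Longrightarrow> Re (wA z) > 1 \<Longrightarrow> E Q z = c * E one z + E (\<lambda>u. Q u - c) z"
proof -
  assume Q: "continuous_on {0..1} Q" and z: "Re (wA z) > 1"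
  have "E Q z = infsum (\<lambda>b. c * edge one z (0,b) + edge (\<lambda>u. Q u - c) z (0,b)) UNIV"
    unfolding E_def by (rule infsum_cong) (rule edge_split_mean[OF Q])
  also have "\<dots> = c * E one z + E (\<lambda>u. Q u - c) z"
    unfolding E_def using Q z
    by (subst infsum_add) (auto intro!: summable_edge1 summable_on_cmult_right continuous_intros
      infsum_cmult_right')
  finally show ?thesis .
qed

lemma mz_minus_mean: "continuous_on {0..1} Q \<Longrightarrow> mz (\<lambda>u. Q u - integral {0..1} Q)"
  by (auto intro!: continuous_intros simp: integral_diff integrable_continuous_interval)

lemma E_mero_ext:
  assumes Q: "continuous_on {0..1} Q" shows "mero_ext a b c (E Q)"
proof -
  obtain n where n: "real n \<ge> a" using real_arch_simple by blast
  define b' where "b' = max b 0" define c' where "c' = max c 0"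
  have "mero_ext (real n) b' c' (\<lambda>z. integral {0..1} Q * E one z + E (\<lambda>u. Q u - integral {0..1} Q) z)"
    by (intro mero_ext_add mero_ext_scale E_one_mero_ext holo_imp_mero_ext E_holo_ext_mean_zero
      mz_minus_mean Q) (auto simp: b'_def c'_def)
  then have "mero_ext (real n) b' c' (E Q)"
    by (rule mero_ext_cong) (use E_split[OF Q] halfspaces0_w in force)
  then show ?thesis by (rule mero_ext_mono) (use n in \<open>auto simp: b'_def c'_def\<close>)
qed

text \<open>All three shifts of \<open>J_parts\<close> raise \<open>wB\<close> and
  \<open>wT\<close>, but \<open>ax 1\<close> leaves \<open>wA\<close> as it is; hence the first
  parameter stays 0. The boundary sums \<open>E\<close> are already continued everywhere.\<close>

lemma J_mero_ext_left:
  assumes "mz P" and Q: "continuous_on {0..1} Q" shows "mero_ext 0 (real n) (real n) (J P Q)"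
  using assms(1)
proof (induction n arbitrary: P)
  case 0
  show ?case by (rule holo_imp_mero_ext, rule holo_extI, rule J_holo_at) (use 0 Q halfspaces0_conv_dom in auto)
next
  case (Suc n)
  obtain V where V: "mz V" "\<And>Q z. continuous_on {0..1} Q \<Longrightarrow> z \<in> conv_dom \<Longrightarrow>
    J P Q z = - V 0 * E Q z + z$1 * J V Q (z + ax 1)
      + of_real c3 * z$3 * J V Q (z + ax 3) + of_real c4 * z$4 * J V Q (z + ax 4)"
    using J_parts[OF Suc.prems] by blast
  note IH = mero_ext_shift_ax[OF Suc.IH[OF V(1)]]
  have "mero_ext 0 (real n + 1) (real n + 1) (\<lambda>z. - V 0 * E Q z + z$1 * J V Q (z + ax 1)
      + of_real c3 * z$3 * J V Q (z + ax 3) + of_real c4 * z$4 * J V Q (z + ax 4))"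
    by (intro mero_ext_add mero_ext_coef mero_ext_coef1 IH mero_ext_scale E_mero_ext Q) auto
  then have "mero_ext 0 (real n + 1) (real n + 1) (J P Q)"
    by (rule mero_ext_cong) (use V(2)[OF Q] halfspaces0_conv_dom in force)
  then show ?case by (simp add: add.commute)
qed

interpretation sw: conical d3 c3 d4 c4 \<beta> \<alpha>
  by unfold_locales (use c3 d3 c4 d4 al be in auto)

lemma phi_sw: "sw.\<phi> z x y = \<phi> (sw z) y x"
  unfolding sw.\<phi>_def \<phi>_def by (simp add: algebra_simps)

lemma cell_sw:
  assumes "continuous_on {0..1} P" "continuous_on {0..1} Q"
  shows "sw.cell P Q z (a,b) = cell Q P (sw z) (b,a)"
proof -
  let ?f = "\<lambda>t u. Q t * P u * \<phi> (sw z) (\<alpha> + real b + t) (\<beta> + real a + u)"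
  have "continuous_on (cbox (0,0) (1,1)) (\<lambda>(t,u). ?f t u)"
    unfolding split_beta cbox_Pair_eq
    by (intro continuous_intros continuous_on_compose2[OF assms(1)] continuous_on_compose2[OF assms(2)])
      (use posx posy in auto)
  from integral_swap_continuous[OF this]
  have "integral {0..1} (\<lambda>t. integral {0..1} (\<lambda>u. ?f t u)) = integral {0..1} (\<lambda>u. integral {0..1} (\<lambda>t. ?f t u))"
    by simp
  moreover have "integral {0..1} (\<lambda>t. ?f t u) = P u * integral {0..1} (\<lambda>t. Q t * \<phi> (sw z) (\<alpha> + real b +
    t) (\<beta> + real a + u))" for u
    by (simp add: mult.assoc mult.left_commute[of _ "P u"])
  ultimately show ?thesis
    unfolding sw.cell_def cell_def prod.case phi_sw by (simp add: mult.assoc)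
qed

lemma J_sw:
  assumes "continuous_on {0..1} P" "continuous_on {0..1} Q"
  shows "sw.J P Q z = J Q P (sw z)"
proof -
  have bij: "bij_betw prod.swap UNIV (UNIV :: (nat \<times> nat) set)" by (simp add: bij_swap)
  have "sw.J P Q z = infsum (\<lambda>m. cell Q P (sw z) (prod.swap m)) UNIV"
    unfolding sw.J_def by (rule infsum_cong) (auto simp: cell_sw[OF assms])
  also have "\<dots> = J Q P (sw z)"
    unfolding J_def using infsum_reindex_bij_betw[OF bij, of "cell Q P (sw z)"] .
  finally show ?thesis .
qed

lemma E_sw_mero_ext: "continuous_on {0..1} Q \<Longrightarrow> mero_ext a b c (\<lambda>z. sw.E Q (sw z))"
  by (rule mero_ext_sw, rule sw.E_mero_ext)

lemma conv_dom_sw: "sw z \<in> conv_dom \<longleftrightarrow> z \<in> conv_dom" by (auto simp: conv_dom_def)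

lemma halfspaces0_sw: "sw z \<in> halfspaces 0 0 0 \<longleftrightarrow> z \<in> halfspaces 0 0 0" by (auto simp: halfspaces_def)

text \<open>Partial integration in \<open>y\<close>, with \<open>J_mero_ext_left\<close> as the base
  case. Its shifts raise \<open>wA\<close> and lose nothing in the other two directions.\<close>

lemma J_mero_ext_mean_zero:
  assumes "mz P" "mz Q" shows "mero_ext (real m) (real n) (real n) (J P Q)"
  using assms(2)
proof (induction m arbitrary: Q)
  case 0 then show ?case using J_mero_ext_left[OF assms(1), of Q n] by simp
next
  case (Suc m)
  obtain V where V: "mz V" "\<And>P z. continuous_on {0..1} P \<Longrightarrow> z \<in> conv_dom \<Longrightarrow>
    sw.J Q P z = - V 0 * sw.E P z + z$1 * sw.J V P (z + ax 1)
      + of_real d3 * z$3 * sw.J V P (z + ax 3) + of_real d4 * z$4 * sw.J V P (z + ax 4)"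
    using sw.J_parts[OF Suc.prems] by blast
  have cP: "continuous_on {0..1} P" and cQ: "continuous_on {0..1} Q" and cV: "continuous_on {0..1} V"
    using assms(1) Suc.prems V(1) by auto
  have eq: "- V 0 * sw.E P (sw z) + z$2 * J P V (z + ax 2)
      + of_real d3 * z$3 * J P V (z + ax 3) + of_real d4 * z$4 * J P V (z + ax 4) = J P Q z"
        if "z \<in> halfspaces 0 0 0" for z
    using V(2)[OF cP, of "sw z"] halfspaces0_conv_dom[OF that]
    by (simp add: conv_dom_sw J_sw[OF cQ cP] J_sw[OF cV cP] sw_add sw_ax)
  note IH = mero_ext_shift_ax[OF Suc.IH[OF V(1)]]
  have "mero_ext (real m + 1) (real n) (real n) (\<lambda>z. - V 0 * sw.E P (sw z) + z$2 * J P V (z + ax 2)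
      + of_real d3 * z$3 * J P V (z + ax 3) + of_real d4 * z$4 * J P V (z + ax 4))"
    by (intro mero_ext_add mero_ext_coef mero_ext_coef1 IH mero_ext_scale E_sw_mero_ext cP) auto
  then have "mero_ext (real m + 1) (real n) (real n) (J P Q)"
    by (rule mero_ext_cong) (rule eq)
  then show ?case by (simp add: add.commute)
qed

lemma J_euler_sw:
  assumes P: "continuous_on {0..1} P" and z: "z \<in> halfspaces 0 0 0"
  shows "(1 - wA z) * J P one z + of_real c3 * z$3 * J P one (z - ax 1 + ax 3)
      + of_real c4 * z$4 * J P one (z - ax 1 + ax 4) = - of_real \<beta> * sw.E P (sw z)"
  using sw.J_euler[OF P, of "sw z"] z
  by (simp add: halfspaces0_sw J_sw[OF cone P] sw_add sw_diff sw_ax)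

text \<open>A constant second weight admits no partial integration without loss; the Euler identity
  in \<open>y\<close> takes its place, each step at the cost of a factor in
  \<open>wA\<close>.\<close>

lemma J_mero_ext_mean_zero_one:
  assumes "mz P" shows "mero_ext (real m) (real n) (real n) (J P one)"
proof (induction m)
  case 0 then show ?case using J_mero_ext_left[OF assms cone, of n] by simp
next
  case (Suc m)
  have P: "continuous_on {0..1} P" using assms by simp
  note IH = mero_ext_shift_ax[OF Suc.IH]
  have "mero_ext (real m + 1) (real n) (real n) (\<lambda>z. of_real \<beta> * sw.E P (sw z) +
    of_real c3 * z$3 * J P one (z - ax 1 + ax 3)
      + of_real c4 * z$4 * J P one (z - ax 1 + ax 4))"
    by (intro mero_ext_add mero_ext_coef IH mero_ext_scale E_sw_mero_ext P) auto
  then have "mero_ext (real m + 1) (real n) (real n) (J P one)"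
    by (rule mero_ext_divide[where k = "-1" and w = wA]) (use J_euler_sw[OF P] in \<open>auto simp: algebra_simps\<close>)
  then show ?case by (simp add: add.commute)
qed

lemma J_form:
  assumes "z \<in> conv_dom"
  shows "of_real c3 * J one one (z - ax 1 + ax 3) + of_real d3 * J one one (z - ax 2 + ax 3) = J one one z"
    "of_real c4 * J one one (z - ax 1 + ax 4) + of_real d4 * J one one (z - ax 2 + ax 4) = J one one z"
proof -
  have *: "c * J one one w + d * J one one w' = J one one z"
    if "w \<in> conv_dom" "w' \<in> conv_dom" "\<And>m. c * cell one one w m + d * cell one one w' m =
      cell one one z m" for c d w w'
  proof -
    have "infsum (\<lambda>m. c * cell one one w m + d * cell one one w' m) UNIV = c * J one one w + d * J one one w'"
      using that unfolding J_def
      by (subst infsum_add) (auto intro!: summable_cell summable_on_cmult_right simp: infsum_cmult_right')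
    then show ?thesis using that(3) by (simp add: J_def)
  qed
  show "of_real c3 * J one one (z - ax 1 + ax 3) + of_real d3 * J one one (z - ax 2 + ax 3) = J one one z"
    "of_real c4 * J one one (z - ax 1 + ax 4) + of_real d4 * J one one (z - ax 2 + ax 4) = J one one z"
    by (intro * conv_dom_shift2 assms cell_form cone)+
qed

text \<open>The sum of the Euler identities in both variables. By \<open>J_form\<close> their
  corrections combine to \<open>(z$3 + z$4) * J one one z\<close>, and only the total degree
  remains. This expresses \<open>J one one\<close> by boundary sums, without recursion.\<close>

lemma J_one_one_euler:
  assumes z: "z \<in> halfspaces 0 0 0"
  shows "of_real \<alpha> * E one z + of_real \<beta> * sw.E one (sw z) = (wT z - 2) * J one one z"
proof -
  define j where "j = J one one z"
  have 1: "(1 - wB z) * j + z$3 * (of_real d3 * J one one (z - ax 2 + ax 3))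
      + z$4 * (of_real d4 * J one one (z - ax 2 + ax 4)) = - of_real \<alpha> * E one z"
    using J_euler[OF cone z] by (simp add: j_def mult_ac)
  have 2: "(1 - wA z) * j + z$3 * (of_real c3 * J one one (z - ax 1 + ax 3))
      + z$4 * (of_real c4 * J one one (z - ax 1 + ax 4)) = - of_real \<beta> * sw.E one (sw z)"
    using J_euler_sw[OF cone z] by (simp add: j_def mult_ac)
  have 3: "of_real c3 * J one one (z - ax 1 + ax 3) = j - of_real d3 * J one one (z - ax 2 + ax 3)"
    "of_real c4 * J one one (z - ax 1 + ax 4) = j - of_real d4 * J one one (z - ax 2 + ax 4)"
    using J_form[OF halfspaces0_conv_dom[OF z]] by (simp_all add: j_def eq_diff_eq)
  have "- of_real \<alpha> * E one z - of_real \<beta> * sw.E one (sw z) = (2 - wT z) * j"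
    using arg_cong2[OF 1 2[unfolded 3], of "(+)"] by (simp add: wA_def wB_def wT_def algebra_simps)
  then show ?thesis unfolding j_def by (simp add: algebra_simps)
qed

lemma J_split_left:
  assumes "continuous_on {0..1} P" "continuous_on {0..1} Q" "z \<in> conv_dom"
  shows "J P Q z = c * J one Q z + J (\<lambda>u. P u - c) Q z"
proof -
  have "J P Q z = infsum (\<lambda>m. c * cell one Q z m + cell (\<lambda>u. P u - c) Q z m) UNIV"
    unfolding J_def by (rule infsum_cong) (rule cell_split_mean[OF assms(1,2)])
  also have "\<dots> = c * J one Q z + J (\<lambda>u. P u - c) Q z"
    unfolding J_def using assms
    by (subst infsum_add) (auto intro!: summable_cell summable_on_cmult_right continuous_intros simp:
      infsum_cmult_right')
  finally show ?thesis .
qed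

lemma J_one_one_mero_ext: "mero_ext a b c (J one one)"
proof (rule mero_ext_divide[where k = "-2" and w = wT])
  show "mero_ext a b c (\<lambda>z. of_real \<alpha> * E one z + of_real \<beta> * sw.E one (sw z))"
    by (intro mero_ext_add mero_ext_scale E_mero_ext E_sw_mero_ext cone)
qed (use J_one_one_euler in auto)

end

context conical begin

interpretation sw: conical d3 c3 d4 c4 \<beta> \<alpha>
  by unfold_locales (use c3 d3 c4 d4 al be in auto)

lemma J_mero_ext_left_mean_zero:
  assumes P: "mz P" and Q: "continuous_on {0..1} Q"
  shows "mero_ext (real n) (real n) (real n) (J P Q)"
proof -
  have cP: "continuous_on {0..1} P" using P by simp
  define c where "c = integral {0..1} Q"
  have cQ: "continuous_on {0..1} (\<lambda>u. Q u - c)" by (intro continuous_intros Q)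
  have "mero_ext (real n) (real n) (real n) (\<lambda>z. c * J P one z + J P (\<lambda>u. Q u - c) z)"
    unfolding c_def by (intro mero_ext_add mero_ext_scale J_mero_ext_mean_zero_one J_mero_ext_mean_zero P
      mz_minus_mean Q)
  then show ?thesis
  proof (rule mero_ext_cong)
    fix z assume z: "z \<in> halfspaces 0 0 0"
    show "c * J P one z + J P (\<lambda>u. Q u - c) z = J P Q z"
      using sw.J_split_left[OF Q cP, of "sw z" c] halfspaces0_conv_dom[OF z]
      by (simp add: conv_dom_sw J_sw[OF Q cP] J_sw[OF cone cP] J_sw[OF cQ cP])
  qed
qed

text \<open>Each weight is split into its mean and a part of mean zero; the four combinations are
  the cases treated above, one of them after exchanging the variables.\<close>

lemma J_mero_ext:
  assumes P: "continuous_on {0..1} P" and Q: "continuous_on {0..1} Q"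
  shows "mero_ext (real n) (real n) (real n) (J P Q)"
proof -
  have one_left: "mero_ext (real n) (real n) (real n) (J one Q)"
  proof -
    define c where "c = integral {0..1} Q"
    have cQ: "continuous_on {0..1} (\<lambda>u. Q u - c)" by (intro continuous_intros Q)
    have "mero_ext (real n) (real n) (real n) (\<lambda>z. sw.J (\<lambda>u. Q u - c) one (sw z))"
      unfolding c_def by (intro mero_ext_sw sw.J_mero_ext_mean_zero_one mz_minus_mean Q)
    then have "mero_ext (real n) (real n) (real n) (J one (\<lambda>u. Q u - c))"
      by (rule mero_ext_cong) (simp add: J_sw[OF cQ cone])
    then have "mero_ext (real n) (real n) (real n) (\<lambda>z. c * J one one z + J one (\<lambda>u. Q u - c) z)"
      by (intro mero_ext_add mero_ext_scale J_one_one_mero_ext)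
    then show ?thesis
    proof (rule mero_ext_cong)
      fix z assume z: "z \<in> halfspaces 0 0 0"
      show "c * J one one z + J one (\<lambda>u. Q u - c) z = J one Q z"
        using sw.J_split_left[OF Q cone, of "sw z" c] halfspaces0_conv_dom[OF z]
        by (simp add: conv_dom_sw J_sw[OF Q cone] J_sw[OF cone cone] J_sw[OF cQ cone])
    qed
  qed
  define c where "c = integral {0..1} P"
  have "mero_ext (real n) (real n) (real n) (\<lambda>z. c * J one Q z + J (\<lambda>u. P u - c) Q z)"
    unfolding c_def by (intro mero_ext_add mero_ext_scale one_left J_mero_ext_left_mean_zero mz_minus_mean P Q)
  then show ?thesis
    by (rule mero_ext_cong) (use J_split_left[OF P Q, of _ c] halfspaces0_conv_dom in auto)
qed

section \<open>From integrals back to lattice sums\<close>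

lemma Y_mero_ext:
  assumes Q: "continuous_on {0..1} Q" shows "mero_ext (real n) (real n) (real n) (Y Q)"
proof -
  note IH = mero_ext_shift_ax[OF J_mero_ext[OF cW1 Q, of n]]
  have "mero_ext (real n) (real n) (real n) (\<lambda>z. J one Q z - z$1 * J W1 Q (z + ax 1)
      - of_real c3 * z$3 * J W1 Q (z + ax 3) - of_real c4 * z$4 * J W1 Q (z + ax 4))"
    by (intro mero_ext_diff mero_ext_coef mero_ext_coef1 IH J_mero_ext cone Q) auto
  then show ?thesis
  proof (rule mero_ext_cong)
    fix z assume z: "z \<in> halfspaces 0 0 0"
    have s: "cell W1 Q (z + ax j) summable_on UNIV" for j
      by (intro summable_cell cW1 Q conv_dom_shift halfspaces0_conv_dom z)
    have s1: "cell one Q z summable_on UNIV" by (intro summable_cell cone Q halfspaces0_conv_dom z)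
    have "Y Q z = infsum (\<lambda>m. 1 * cell one Q z m + (- z$1) * cell W1 Q (z + ax 1) m
      + (- of_real c3 * z$3) * cell W1 Q (z + ax 3) m + (- of_real c4 * z$4) * cell W1 Q (z + ax 4) m +
        0 * 0) UNIV"
      unfolding Y_def by (rule infsum_cong) (auto simp: edge_eq_cell[OF Q])
    then show "J one Q z - z$1 * J W1 Q (z + ax 1)
      - of_real c3 * z$3 * J W1 Q (z + ax 3) - of_real c4 * z$4 * J W1 Q (z + ax 4) = Y Q z"
      unfolding infsum_lincomb5[OF s1 s s s summable_on_0_simp] by (simp add: J_def)
  qed
qed

lemma Z_mero_ext: "mero_ext (real n) (real n) (real n) Z"
proof -
  note IH = mero_ext_shift_ax[OF Y_mero_ext[OF cW1, of n]]
  have "mero_ext (real n) (real n) (real n) (\<lambda>z. Y one z - z$2 * Y W1 (z + ax 2)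
      - of_real d3 * z$3 * Y W1 (z + ax 3) - of_real d4 * z$4 * Y W1 (z + ax 4))"
    by (intro mero_ext_diff mero_ext_coef mero_ext_coef1 IH Y_mero_ext cone) auto
  then show ?thesis
  proof (rule mero_ext_cong)
    fix z assume z: "z \<in> halfspaces 0 0 0"
    have s: "edge W1 (z + ax j) summable_on UNIV" for j
      by (intro summable_edge cW1 conv_dom_shift halfspaces0_conv_dom z)
    have s1: "edge one z summable_on UNIV" by (intro summable_edge cone halfspaces0_conv_dom z)
    have "Z z = infsum (\<lambda>m. 1 * edge one z m + (- z$2) * edge W1 (z + ax 2) m
      + (- of_real d3 * z$3) * edge W1 (z + ax 3) m + (- of_real d4 * z$4) * edge W1 (z + ax 4) m + 0 * 0) UNIV"
      unfolding Z_def by (rule infsum_cong) (auto simp: pt_eq_edge)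
    then show "Y one z - z$2 * Y W1 (z + ax 2)
      - of_real d3 * z$3 * Y W1 (z + ax 3) - of_real d4 * z$4 * Y W1 (z + ax 4) = Z z"
      unfolding infsum_lincomb5[OF s1 s s s summable_on_0_simp] by (simp add: Y_def)
  qed
qed

end

section \<open>Continuation of the zeta-functions\<close>

lemma conv_dom_halfspaces: "conv_dom = halfspaces 3 3 6" by (auto simp: conv_dom_def halfspaces_def)

text \<open>For use with \<open>n = Suc a\<close> or \<open>n = Suc b\<close> on the row
  \<open>a = 0\<close>, the column \<open>b = 0\<close> and the cone
  \<open>a \<le> b \<le> 2 a\<close>: the growing arguments there lie between \<open>n\<close> and
  \<open>7 n\<close>, and one constant serves both signs of the exponent.\<close>

lemma powr_lower_bound:
  fixes n w s :: real assumes "n > 0" "n \<le> w" "w \<le> 7 * n"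
  shows "7 powr (- \<bar>s\<bar>) * n powr (- s) \<le> w powr (- s)"
proof (cases "s \<ge> 0")
  case True
  have "7 powr (- s) * n powr (- s) = (7 * n) powr (- s)" using assms by (simp add: powr_mult)
  also have "\<dots> \<le> w powr (- s)" using assms True by (intro powr_mono2') auto
  finally show ?thesis using True by simp
next
  case False
  have "7 powr s * n powr (- s) \<le> 1 * n powr (- s)"
    using False powr_mono[of s 0 7] by (intro mult_right_mono) auto
  also have "\<dots> \<le> w powr (- s)" using assms False by (simp add: powr_mono2)
  finally show ?thesis using False by simp
qed

definition PSp2_pair :: "nat \<times> nat \<Rightarrow> nat \<times> nat" where "PSp2_pair = (\<lambda>(a,b). (2 * a + 1, b + 1))"

lemma bij_PSp2_pair: "bij_betw PSp2_pair UNIV PSp2_index"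
  unfolding bij_betw_def
proof
  show "inj PSp2_pair" by (auto simp: inj_on_def PSp2_pair_def)
  show "range PSp2_pair = PSp2_index"
  proof (intro subset_antisym subsetI)
    fix m assume "m \<in> PSp2_index"
    then have m: "fst m mod 2 = 1" "snd m \<ge> 1" by (auto simp: PSp2_index_def)
    then have "m = PSp2_pair (fst m div 2, snd m - 1)"
      by (cases m) (auto simp: PSp2_pair_def, presburger)
    then show "m \<in> range PSp2_pair" by blast
  qed (auto simp: PSp2_pair_def PSp2_index_def)
qed

lemma norm_PSp2_term:
  "norm (PSp2_term z (PSp2_pair (a,b))) = real (2*a+1) powr (- Re (z$1)) * real (b+1) powr (- Re (z$2)) *
     real (2*a+b+2) powr (- Re (z$3)) * real (2*a+2*b+3) powr (- Re (z$4))"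
proof -
  have n: "norm (of_nat (Suc k) powr w :: complex) = real (Suc k) powr Re w" for k w
    using norm_powr_real_powr[of "of_nat (Suc k)" w] by (simp del: of_nat_Suc)
  have s: "2 * a + 1 = Suc (2*a)" "b + 1 = Suc b" "Suc (2*a) + Suc b = Suc (Suc (2*a+b))" "Suc (2*a) +
    2 * Suc b = Suc (Suc (Suc (2*a+2*b)))"
     "2*a+b+2 = Suc (Suc (2*a+b))" "2*a+2*b+3 = Suc (Suc (Suc (2*a+2*b)))" by auto
  show ?thesis unfolding PSp2_term_def PSp2_pair_def prod.case s norm_divide norm_mult n
    by (simp add: powr_minus divide_inverse mult_ac del: of_nat_Suc)
qed

text \<open>The definition of \<open>PSp2_zeta\<close> prescribes the value at every point of
  absolute convergence; this confines those points to \<open>conv_dom\<close>, where the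
  continuation can be matched with the series. Each condition comes from comparing a subfamily of
  terms with a divergent power series.\<close>

lemma PSp2_summable_imp_conv_dom:
  assumes "(\<lambda>m. norm (PSp2_term z m)) summable_on PSp2_index"
  shows "z \<in> conv_dom"
proof -
  define T where "T = (\<lambda>m. norm (PSp2_term z (PSp2_pair m)))"
  define s1 s2 s3 s4 where "s1 = Re (z$1)" and "s2 = Re (z$2)" and "s3 = Re (z$3)" and "s4 = Re (z$4)"
  have T: "T summable_on UNIV"
    unfolding T_def using assms summable_on_reindex_bij_betw[OF bij_PSp2_pair, of
      "\<lambda>m. norm (PSp2_term z m)"] by blast
  have Tab: "T (a,b) = real (2*a+1) powr (-s1) * real (b+1) powr (-s2) * real (2*a+b+2) powr (-s3) * real
    (2*a+2*b+3) powr (-s4)" for a b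
    unfolding T_def norm_PSp2_term s1_def s2_def s3_def s4_def ..
  define K where "K = 7 powr (- \<bar>s1\<bar>) * 7 powr (- \<bar>s2\<bar>) * 7 powr (- \<bar>s3\<bar>) * 7 powr (- \<bar>s4\<bar>)"
  have K: "K > 0" by (simp add: K_def)
  have harm: "l > 1" if "(\<lambda>n. K * real (Suc n) powr (- l)) summable_on UNIV" for l
  proof -
    have "summable (\<lambda>n. K * real (Suc n) powr (- l))" using that by (rule summable_on_imp_summable)
    then have "summable (\<lambda>n. real (Suc n) powr (- l))" using K by (subst (asm) summable_cmult_iff) auto
    then have "summable (\<lambda>n. real n powr (- l))" using summable_Suc_iff[of "\<lambda>n. real n powr (- l)"] by simp
    then show ?thesis by (subst (asm) summable_real_powr_iff) auto
  qed
  have A: "s2 + s3 + s4 > 1"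
  proof (rule harm, rule summable_on_comparison_test)
    have "(\<lambda>(a,b). T (a,b)) summable_on Sigma UNIV (\<lambda>_. UNIV)" using T by simp
    from summable_on_SigmaD1[OF this, of 0] show "(\<lambda>b. T (0,b)) summable_on UNIV" by simp
    fix b :: nat
    have "7 powr (- \<bar>s1\<bar>) \<le> (1::real)" using powr_mono[of "- \<bar>s1\<bar>" 0 7] by simp
    then have "K * real (Suc b) powr (-(s2+s3+s4)) \<le> 1 * (7 powr (- \<bar>s2\<bar>) * real (Suc b) powr (-s2)) *
       (7 powr (- \<bar>s3\<bar>) * real (Suc b) powr (-s3)) * (7 powr (- \<bar>s4\<bar>) * real (Suc b) powr (-s4))"
      unfolding K_def by (simp add: powr_add powr_diff powr_minus mult_ac divide_inverse mult_right_mono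
        mult_left_le_one_le)
    also have "\<dots> \<le> real (2*0+1) powr (-s1) * real (b+1) powr (-s2) * real (2*0+b+2) powr (-s3) * real
      (2*0+2*b+3) powr (-s4)"
      by (intro mult_mono powr_lower_bound) auto
    finally show "K * real (Suc b) powr (-(s2+s3+s4)) \<le> T (0,b)" by (simp add: Tab)
  qed (use K in auto)
  have B: "s1 + s3 + s4 > 1"
  proof (rule harm, rule summable_on_comparison_test)
    have i: "inj (\<lambda>a. (a :: nat, 0 :: nat))" by (auto simp: inj_on_def)
    have "T summable_on range (\<lambda>a. (a, 0))" using T by (rule summable_on_subset_banach) auto
    then show "(\<lambda>a. T (a,0)) summable_on UNIV" using summable_on_reindex[OF i, of T] by (simp add: o_def)
    fix a :: nat
    have "7 powr (- \<bar>s2\<bar>) \<le> (1::real)" using powr_mono[of "- \<bar>s2\<bar>" 0 7] by simp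
    then have "K * real (Suc a) powr (-(s1+s3+s4)) \<le> (7 powr (- \<bar>s1\<bar>) * real (Suc a) powr (-s1)) * 1 *
       (7 powr (- \<bar>s3\<bar>) * real (Suc a) powr (-s3)) * (7 powr (- \<bar>s4\<bar>) * real (Suc a) powr (-s4))"
      unfolding K_def by (simp add: powr_add powr_diff powr_minus mult_ac divide_inverse mult_right_mono
        mult_left_le_one_le)
    also have "\<dots> \<le> real (2*a+1) powr (-s1) * real (0+1) powr (-s2) * real (2*a+0+2) powr (-s3) * real
      (2*a+2*0+3) powr (-s4)"
      by (intro mult_mono powr_lower_bound) auto
    finally show "K * real (Suc a) powr (-(s1+s3+s4)) \<le> T (a,0)" by (simp add: Tab)
  qed (use K in auto)
  \<comment> \<open>For each \<open>a\<close> the cone contains \<open>a + 1\<close> values of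
    \<open>b\<close>, with terms of order \<open>Suc a\<close> to the power minus the total
    exponent; summing over \<open>b\<close> costs one, hence the \<open>- 1\<close>.\<close>
  have C: "s1 + s2 + s3 + s4 - 1 > 1"
  proof (rule harm, rule summable_on_comparison_test)
    have S: "T summable_on Sigma UNIV (\<lambda>a. {a..2*a})" using T by (rule summable_on_subset_banach) auto
    show "(\<lambda>a. infsum (\<lambda>b. T (a,b)) {a..2*a}) summable_on UNIV"
      by (rule summable_on_SigmaD[OF S]) simp
    fix a :: nat
    have "K * real (Suc a) powr (-(s1+s2+s3+s4)) \<le> T (a,b)" if b: "b \<in> {a..2*a}" for b
    proof -
      have "K * real (Suc a) powr (-(s1+s2+s3+s4)) =
        (7 powr (- \<bar>s1\<bar>) * real (Suc a) powr (-s1)) * (7 powr (- \<bar>s2\<bar>) * real (Suc a) powr (-s2)) *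
       (7 powr (- \<bar>s3\<bar>) * real (Suc a) powr (-s3)) * (7 powr (- \<bar>s4\<bar>) * real (Suc a) powr (-s4))"
        unfolding K_def by (simp add: powr_add powr_diff powr_minus mult_ac divide_inverse)
      also have "\<dots> \<le> T (a,b)" unfolding Tab using b
        by (intro mult_mono powr_lower_bound) auto
      finally show ?thesis .
    qed
    then have "(\<Sum>b\<in>{a..2*a}. K * real (Suc a) powr (-(s1+s2+s3+s4))) \<le> (\<Sum>b\<in>{a..2*a}. T (a,b))"
      by (intro sum_mono)
    moreover have "real (Suc a) powr (-(s1+s2+s3+s4-1)) = real (Suc a) * real (Suc a) powr (-(s1+s2+s3+s4))"
      by (simp add: powr_diff powr_minus divide_inverse powr_add mult_ac)
    ultimately show "K * real (Suc a) powr (-(s1+s2+s3+s4-1)) \<le> infsum (\<lambda>b. T (a,b)) {a..2*a}"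
      by (simp add: mult_ac)
  qed (use K in auto)
  show ?thesis using A B C by (simp add: conv_dom_def wA_def wB_def wT_def s1_def s2_def s3_def s4_def)
qed

interpretation P: conical 2 1 2 2 "1/2" 1 by unfold_locales auto

lemma PSp2_term_pt: "PSp2_term z (PSp2_pair m) = exp (- (z$1 * of_real (ln 2))) * P.pt z m"
proof -
  obtain a b where m: "m = (a,b)" by (cases m)
  have pw: "1 / (of_nat (Suc k) powr w) = exp (- (w * of_real (ln (real (Suc k)))))" for k and w :: complex
    by (simp add: powr_def exp_minus divide_inverse Ln_of_nat del: of_nat_Suc)
  have "PSp2_term z (PSp2_pair m) = 1 / of_nat (Suc (2*a)) powr (z$1) * (1 / of_nat (Suc b) powr (z$2)) *
     (1 / of_nat (Suc (2*a+b+1)) powr (z$3)) * (1 / of_nat (Suc (2*a+2*b+2)) powr (z$4))"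
    by (simp add: PSp2_term_def PSp2_pair_def m divide_inverse algebra_simps)
  also have "\<dots> = exp (- (z$1 * of_real (ln (real (Suc (2*a)))) + z$2 * of_real (ln (real (Suc b))) +
     z$3 * of_real (ln (real (Suc (2*a+b+1)))) + z$4 * of_real (ln (real (Suc (2*a+2*b+2))))))"
    unfolding pw exp_add[symmetric] by (rule arg_cong[where f = exp]) simp
  also have "ln (real (Suc (2*a))) = ln 2 + ln (1/2 + real a)"
  proof -
    have "real (Suc (2*a)) = 2 * (1/2 + real a)" by simp
    then show ?thesis using ln_mult[of 2 "1/2 + real a"] by (simp only:) simp
  qed
  finally show ?thesis
    by (simp add: m P.pt_def P.\<phi>_def exp_add[symmetric] algebra_simps)
qed

definition PSp2_series :: "complex^4 \<Rightarrow> complex" where "PSp2_series z = infsum (PSp2_term z) PSp2_index"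

lemma PSp2_series_eq: "PSp2_series z = exp (- (z$1 * of_real (ln 2))) * P.Z z"
proof -
  have "PSp2_series z = infsum (\<lambda>m. PSp2_term z (PSp2_pair m)) UNIV"
    unfolding PSp2_series_def using infsum_reindex_bij_betw[OF bij_PSp2_pair, of "PSp2_term z"] by simp
  then show ?thesis by (simp add: PSp2_term_pt P.Z_def infsum_cmult_right')
qed

lemma PSp2_summable:
  assumes "z \<in> conv_dom"
  shows "(\<lambda>m. norm (PSp2_term z m)) summable_on PSp2_index"
proof -
  have "(\<lambda>m. norm (exp (- (z$1 * of_real (ln 2)))) * norm (P.pt z m)) summable_on UNIV"
    by (intro summable_on_cmult_right P.dominated_summable P.dominated_pt assms)
  then have "(\<lambda>m. norm (PSp2_term z (PSp2_pair m))) summable_on UNIV"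
    by (simp add: PSp2_term_pt norm_mult)
  then show ?thesis
    using summable_on_reindex_bij_betw[OF bij_PSp2_pair, of "\<lambda>m. norm (PSp2_term z m)"] by blast
qed

lemma holo_at_exp1: "holo_at (\<lambda>z. exp (- (z$1 * of_real (ln 2)))) z" by (intro holo_at_intros)

lemma PSp2_series_holo_at: assumes "z \<in> conv_dom" shows "holo_at PSp2_series z"
  unfolding PSp2_series_eq[abs_def] by (rule holo_at_mult[OF holo_at_exp1 P.Z_holo_at[OF assms]])

lemma PSp2_series_mero_ext: "mero_ext (real n) (real n) (real n) PSp2_series"
  unfolding PSp2_series_eq[abs_def] by (rule mero_ext_mult[OF holo_at_exp1 P.Z_mero_ext])

lemma halfspaces_Un: "(\<Union>n. halfspaces (real n) (real n) (real n)) = UNIV"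
proof -
  have "\<exists>n. z \<in> halfspaces (real n) (real n) (real n)" for z
  proof -
    obtain n where "real n > max (4 - Re (wA z)) (max (4 - Re (wB z)) (8 - Re (wT z)))"
      using reals_Archimedean2 by blast
    then have "z \<in> halfspaces (real n) (real n) (real n)" by (auto simp: halfspaces_def)
    then show ?thesis by blast
  qed
  then show ?thesis by blast
qed

lemma halfspaces0_nonempty: "halfspaces 0 0 0 \<noteq> {}"
proof -
  have "(\<chi> j. 10) \<in> halfspaces 0 0 0" by (simp add: halfspaces_def wA_def wB_def wT_def)
  then show ?thesis by blast
qed

lemma denominator_nonzero_ex: "denominator h \<Longrightarrow> \<exists>w. h w \<noteq> 0"
proof (rule exI[of _ "\<chi> j. 10"], rule denominator_nonzero_real)
  have *: "complex_of_real x + of_real c \<noteq> 0" if "x > 2" "c \<ge> -2" for x c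
  proof -
    have "x + c \<noteq> 0" using that by linarith
    then show ?thesis by (simp flip: of_real_add)
  qed
  fix c :: real assume "c \<ge> -2"
  then show "wA (\<chi> j. 10) + of_real c \<noteq> 0" "wB (\<chi> j. 10) + of_real c \<noteq> 0" "wT (\<chi> j. 10) + of_real c \<noteq> 0"
    using *[of 30 c] *[of 40 c] by (simp_all add: wA_def wB_def wT_def)
qed auto

text \<open>A candidate \<open>f\<close> is built from the quotients; by uniqueness it is the
  function chosen in \<open>PSp2_zeta_def\<close>. Agreement with the series is needed on all of
  \<open>conv_dom\<close>, not only on the base where the quotients were matched with it.\<close>

theorem PSp2_zeta_continuation:
  shows "\<And>z. z \<in> conv_dom \<Longrightarrow> PSp2_zeta z = infsum (PSp2_term z) PSp2_index"
    "\<And>n. \<exists>h g. denominator h \<and> (\<forall>z\<in>halfspaces (real n) (real n) (real n). holo_at g z) \<and>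
       (\<forall>z\<in>halfspaces (real n) (real n) (real n). h z \<noteq> 0 \<longrightarrow> PSp2_zeta z = g z / h z)"
proof -
  define A where "A n = halfspaces (real n) (real n) (real n)" for n
  have "\<forall>n. \<exists>h g. denominator h \<and> (\<forall>z\<in>A n. holo_at g z) \<and> (\<forall>z\<in>halfspaces 0 0 0. g z = h z * PSp2_series z)"
    using PSp2_series_mero_ext unfolding mero_ext_def holo_ext_def A_def by blast
  from choice[OF this] obtain h where h: "\<forall>n. \<exists>g. denominator (h n) \<and> (\<forall>z\<in>A n. holo_at g z) \<and>
    (\<forall>z\<in>halfspaces 0 0 0. g z = h n z * PSp2_series z)" ..
  from choice[OF h] obtain g where g: "\<forall>n. denominator (h n) \<and> (\<forall>z\<in>A n. holo_at (g n) z) \<and>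
    (\<forall>z\<in>halfspaces 0 0 0. g n z = h n z * PSp2_series z)" ..
  have hg: "\<And>n. denominator (h n)" "\<And>n z. z \<in> A n \<Longrightarrow> holo_at (g n) z" "\<And>n z. z \<in> halfspaces 0 0 0 \<Longrightarrow>
    g n z = h n z * PSp2_series z"
    using g by auto
  have oA: "open (A n)" "convex (A n)" for n by (simp_all add: A_def open_halfspaces convex_halfspaces)
  have "\<exists>f. nicely_meromorphic_vec f \<and> (\<forall>n W k. open W \<longrightarrow> W \<subseteq> A n \<longrightarrow>
       (\<forall>w\<in>W. holo_at k w \<and> k w * h n w = g n w) \<longrightarrow> (\<forall>z\<in>W. f z = k z))"
  proof (rule nicely_meromorphic_vec_exists[of A "halfspaces 0 0 0" g h PSp2_series])
    show "incseq A" by (auto simp: incseq_def A_def halfspaces_def)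
    show "(\<Union>n. A n) = UNIV" unfolding A_def by (rule halfspaces_Un)
    show "open (halfspaces 0 0 0)" by (rule open_halfspaces)
    show "halfspaces 0 0 0 \<noteq> {}" by (rule halfspaces0_nonempty)
    show "halfspaces 0 0 0 \<subseteq> A 0" by (simp add: A_def)
    show "holo_at (h n) z" for n z by (rule denominator_holo_at[OF hg(1)])
    show "\<exists>w. h n w \<noteq> 0" for n by (rule denominator_nonzero_ex[OF hg(1)])
  qed (use oA hg in auto)
  then obtain f where f1: "nicely_meromorphic_vec f" and f2: "\<forall>n W k. open W \<longrightarrow> W \<subseteq> A n \<longrightarrow>
       (\<forall>w\<in>W. holo_at k w \<and> k w * h n w = g n w) \<longrightarrow> (\<forall>z\<in>W. f z = k z)" by blast
  have fdom: "f z = PSp2_series z" if z: "z \<in> conv_dom" for z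
  \<comment> \<open>The index 6 suffices because \<open>conv_dom = halfspaces 3 3 6\<close>.\<close>
  proof (rule f2[rule_format, of conv_dom 6 PSp2_series z])
    show "open conv_dom" unfolding conv_dom_halfspaces by (rule open_halfspaces)
    show sub: "conv_dom \<subseteq> A 6" unfolding conv_dom_halfspaces A_def by (rule halfspaces_mono) auto
    fix w assume w: "w \<in> conv_dom"
    have "PSp2_series w * h 6 w = g 6 w"
    proof -
      have "g 6 w - h 6 w * PSp2_series w = 0"
      proof (rule holo_at_identity_convex[of conv_dom _ "halfspaces 0 0 0"])
        show "open conv_dom" "convex conv_dom" unfolding conv_dom_halfspaces
          by (rule open_halfspaces convex_halfspaces)+
        show "halfspaces 0 0 0 \<subseteq> conv_dom" using halfspaces0_conv_dom by blast
        show "holo_at (\<lambda>w. g 6 w - h 6 w * PSp2_series w) x" if "x \<in> conv_dom" for x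
          by (intro holo_at_diff holo_at_mult denominator_holo_at[OF hg(1)] hg(2) PSp2_series_holo_at)
            (use that sub in auto)
      qed (use hg(3) open_halfspaces halfspaces0_nonempty w in auto)
      then show ?thesis by (simp add: mult.commute)
    qed
    then show "holo_at PSp2_series w \<and> PSp2_series w * h 6 w = g 6 w" using PSp2_series_holo_at[OF w] by blast
  qed (use z in auto)
  have ex: "nicely_meromorphic_vec f \<and> (\<forall>z. (\<lambda>m. norm (PSp2_term z m)) summable_on PSp2_index \<longrightarrow>
          f z = infsum (PSp2_term z) PSp2_index)"
    using f1 fdom PSp2_summable_imp_conv_dom unfolding PSp2_series_def by blast
  have some: "nicely_meromorphic_vec PSp2_zeta \<and> (\<forall>z. (\<lambda>m. norm (PSp2_term z m)) summable_on PSp2_index \<longrightarrow>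
          PSp2_zeta z = infsum (PSp2_term z) PSp2_index)"
    unfolding PSp2_zeta_def
    by (rule someI[of "\<lambda>f. nicely_meromorphic_vec f \<and> (\<forall>z. (\<lambda>m. norm (PSp2_term z m)) summable_on PSp2_index \<longrightarrow>
          f z = infsum (PSp2_term z) PSp2_index)", OF ex])
  have eq: "PSp2_zeta = f"
    by (rule nicely_meromorphic_vec_unique[of _ _ "halfspaces 0 0 0"])
       (use some ex PSp2_summable halfspaces0_conv_dom open_halfspaces halfspaces0_nonempty in auto)
  show "PSp2_zeta z = infsum (PSp2_term z) PSp2_index" if "z \<in> conv_dom" for z
    using fdom[OF that] by (simp add: eq PSp2_series_def)
  show "\<exists>h g. denominator h \<and> (\<forall>z\<in>halfspaces (real n) (real n) (real n). holo_at g z) \<and>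
       (\<forall>z\<in>halfspaces (real n) (real n) (real n). h z \<noteq> 0 \<longrightarrow> PSp2_zeta z = g z / h z)" for n
  proof (rule exI[of _ "h n"], rule exI[of _ "g n"], intro conjI ballI impI)
    show "denominator (h n)" by (rule hg)
    fix z assume z: "z \<in> halfspaces (real n) (real n) (real n)"
    then show "holo_at (g n) z" using hg(2) by (simp add: A_def)
    assume nz: "h n z \<noteq> 0"
    have op: "open {z. h n z \<noteq> 0}"
      using continuous_at_imp_continuous_on[of UNIV "h n"] holo_at_isCont[OF denominator_holo_at[OF hg(1)]]
      by (simp add: open_Collect_neq)
    show "PSp2_zeta z = g n z / h n z" unfolding eq
    proof (rule f2[rule_format, of "A n \<inter> {z. h n z \<noteq> 0}" n "\<lambda>z. g n z / h n z"])
      fix w assume "w \<in> A n \<inter> {z. h n z \<noteq> 0}"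
      then show "holo_at (\<lambda>z. g n z / h n z) w \<and> g n w / h n w * h n w = g n w"
        using hg denominator_holo_at by (auto intro!: holo_at_divide)
    qed (use op oA z nz in \<open>auto simp: A_def\<close>)
  qed
qed

section \<open>The Riemann zeta-function as a row sum\<close>

interpretation R: conical 1 1 1 1 1 1 by unfold_locales auto

text \<open>Only sums along \<open>x = 1\<close> occur here, so the first coordinate does not affect the value;
  it only has to make the series converge.\<close>

definition zpt :: "complex \<Rightarrow> complex^4" where
  "zpt s = (\<chi> j. if j = 1 then 100 else if j = 2 then s else 0)"

lemma zpt_nth: "zpt s $ 1 = 100" "zpt s $ 2 = s" "zpt s $ 3 = 0" "zpt s $ 4 = 0"
  by (simp_all add: zpt_def)

lemma zpt_line: "zpt s = zpt 0 + s *s ax 2"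
  by (simp add: vec_eq_iff forall_4 zpt_nth ax_nth)

lemma zpt_shift: "zpt s + ax 2 = zpt (s + 1)"
  by (simp add: vec_eq_iff forall_4 zpt_nth ax_nth)

lemma w_zpt: "wA (zpt s) = s" "wB (zpt s) = 100" "wT (zpt s) = 100 + s"
  by (simp_all add: wA_def wB_def wT_def zpt_nth)

lemma phi_zpt: "R.\<phi> (zpt s) 1 1 = 1" unfolding R.\<phi>_def zpt_nth by simp

lemma pt_zpt: "R.pt (zpt s) (0,b) = 1 / of_nat (Suc b) powr s"
  by (simp add: R.pt_def R.\<phi>_def zpt_nth powr_def exp_minus divide_inverse Ln_of_nat add.commute del: of_nat_Suc)
    (simp add: add.commute)

definition zetaser :: "complex \<Rightarrow> complex" where "zetaser s = (\<Sum>n. 1 / of_nat (Suc n) powr s)"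

lemma zetaser_summable:
  assumes "Re s > 1"
  shows "summable (\<lambda>n. norm (1 / of_nat (Suc n) powr s :: complex))"
  using R.dominated_summable1(1)[OF R.dominated_pt, of "zpt s"] assms by (simp only: pt_zpt w_zpt)

lemma zetaser_infsum:
  assumes "Re s > 1"
  shows "zetaser s = infsum (\<lambda>b. R.pt (zpt s) (0,b)) UNIV"
  unfolding zetaser_def pt_zpt by (rule infsum_nat_suminf[OF zetaser_summable[OF assms], symmetric])

lemma zetaser_holomorphic: "zetaser holomorphic_on {s. Re s > 1}"
proof -
  have "(\<lambda>s. infsum (\<lambda>b. R.pt (zpt 0 + s *s ax 2) (0,b)) UNIV) holomorphic_on {s. Re s > 1}"
    by (rule holo_at_line_holomorphic, rule R.dominated_holo_at1[OF R.dominated_pt])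
       (simp add: zpt_line[symmetric] w_zpt)
  then show ?thesis
    by (rule holomorphic_transform) (simp add: zetaser_infsum zpt_line[symmetric])
qed

text \<open>The first Bernoulli polynomial \<open>u - 1/2\<close>, spelled as \<open>W1\<close>
  minus its mean so that \<open>R.E_split\<close> matches it literally.\<close>

definition M0 :: "real \<Rightarrow> complex" where "M0 u = of_real u - 1 - (- 1 / 2)"

lemma mz_M0: "continuous_on {0..1} M0 \<and> integral {0..1} M0 = 0"
proof -
  have "((\<lambda>u. complex_of_real u - 1 - (-1/2)) has_integral ((of_real 1 ^ 2 - of_real 1) / 2 - (of_real 0
    ^ 2 - of_real 0) / 2)) {0..1}"
    by (rule fundamental_theorem_of_calculus[of 0 1 "\<lambda>u. (complex_of_real u ^ 2 - of_real u) / 2"])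
       (auto intro!: derivative_eq_intros simp: has_vector_derivative_def fun_eq_iff scaleR_conv_of_real
         field_simps)
  then show ?thesis unfolding M0_def[abs_def] by (auto intro!: continuous_intros simp: integral_unique)
qed

lemma E_one_zpt: "Re s > 2 \<Longrightarrow> R.E (\<lambda>_. 1) (zpt s) = 1 / (s - 1)"
proof -
  assume s: "Re s > 2"
  have "(1 - s) * R.E (\<lambda>_. 1) (zpt s) = - 1"
    using R.E_euler[of "zpt s"] s by (simp add: w_zpt zpt_nth phi_zpt)
  moreover have "s \<noteq> 1" using s by auto
  ultimately show ?thesis by (simp add: field_simps)
qed

text \<open>The Euler-Maclaurin formula for zeta. The half-plane is chosen for convenience, inside
  the range of \<open>E_one_zpt\<close>; an open set is enough for the continuation.\<close>

lemma zetaser_eq: "Re s > 3 \<Longrightarrow> zetaser s = 1 / (s - 1) + 1 / 2 - s * R.E M0 (zpt (s + 1))"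
proof -
  assume s: "Re s > 3"
  have s0: "s \<noteq> 0" using s by auto
  have w: "Re (wA (zpt s)) > 1" "Re (wA (zpt (s + 1))) > 1" using s by (simp_all add: w_zpt)
  have sm: "(\<lambda>b. R.edge (\<lambda>_. 1) (zpt s) (0,b)) summable_on UNIV" "(\<lambda>b. R.edge R.W1 (zpt (s +
    1)) (0,b)) summable_on UNIV"
    by (intro R.summable_edge1 R.cW1 R.cone w)+
  have "zetaser s = infsum (\<lambda>b. R.edge (\<lambda>_. 1) (zpt s) (0,b) + (- s) * R.edge R.W1 (zpt (s + 1)) (0,b)) UNIV"
    using s by (subst zetaser_infsum) (auto simp: R.pt_eq_edge zpt_nth zpt_shift)
  also have "\<dots> = R.E (\<lambda>_. 1) (zpt s) + (- s) * R.E R.W1 (zpt (s + 1))"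
    unfolding R.E_def by (subst infsum_add[OF sm(1) summable_on_cmult_right[OF sm(2)]]) (simp only:
      infsum_cmult_right')
  also have "R.E R.W1 (zpt (s + 1)) = (- 1 / 2) * R.E (\<lambda>_. 1) (zpt (s + 1)) + R.E M0 (zpt (s + 1))"
    unfolding M0_def[abs_def] by (rule R.E_split[OF R.cW1 w(2)])
  also have "R.E (\<lambda>_. 1) (zpt (s + 1)) = 1 / s" using E_one_zpt[of "s + 1"] s by simp
  also have "R.E (\<lambda>_. 1) (zpt s) = 1 / (s - 1)" using E_one_zpt s by simp
  finally show ?thesis using s0 by (simp add: algebra_simps)
qed

text \<open>\<open>E_holo_ext_mean_zero\<close> continues the remainder to each half-plane; the
  pieces agree on overlaps and glue to an entire function.\<close>

lemma E_M0_entire: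
  obtains H where "H holomorphic_on UNIV" "\<And>s. Re s > 3 \<Longrightarrow> H s = R.E M0 (zpt (s + 1))"
proof -
  have "\<forall>n. \<exists>g. g holomorphic_on {s. Re s > 3 - real n} \<and> (\<forall>s. Re s > 3 \<longrightarrow> g s = R.E M0 (zpt (s + 1)))"
  proof
    fix n
    have "holo_ext (real n) 0 (real n) (R.E M0)" using R.E_holo_ext_mean_zero[OF mz_M0, of 0 "real n" n] by simp
    then obtain g where g: "\<And>z. z \<in> halfspaces (real n) 0 (real n) \<Longrightarrow> holo_at g z"
      "\<And>z. z \<in> halfspaces 0 0 0 \<Longrightarrow> g z = R.E M0 z"
      unfolding holo_ext_def by blast
    have "(\<lambda>s. g (zpt 1 + s *s ax 2)) holomorphic_on {s. Re s > 3 - real n}"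
    proof (rule holo_at_line_holomorphic, rule g(1))
      fix s assume "s \<in> {s. Re s > 3 - real n}"
      moreover have "zpt 1 + s *s ax 2 = zpt (s + 1)" by (simp add: vec_eq_iff forall_4 zpt_nth ax_nth)
      ultimately show "zpt 1 + s *s ax 2 \<in> halfspaces (real n) 0 (real n)" by (simp add: halfspaces_def w_zpt)
    qed
    moreover have "g (zpt 1 + s *s ax 2) = R.E M0 (zpt (s + 1))" if "Re s > 3" for s
    proof -
      have e: "zpt 1 + s *s ax 2 = zpt (s + 1)" by (simp add: vec_eq_iff forall_4 zpt_nth ax_nth)
      show ?thesis unfolding e by (rule g(2)) (use that in \<open>simp add: halfspaces_def w_zpt\<close>)
    qed
    ultimately show "\<exists>g. g holomorphic_on {s. Re s > 3 - real n} \<and> (\<forall>s. Re s > 3 \<longrightarrow> g s = R.E M0 (zpt (s +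
      1)))" by blast
  qed
  from choice[OF this] obtain G where G: "\<forall>n. G n holomorphic_on {s. Re s > 3 - real n} \<and> (\<forall>s. Re s > 3 \<longrightarrow>
    G n s = R.E M0 (zpt (s + 1)))" ..
  have cons: "G n s = G m s" if "n \<le> m" "Re s > 3 - real n" for n m s
  proof (rule analytic_continuation_open[of "{s. Re s > 3}" "{s. Re s > 3 - real n}" "G n" "G m"])
    show "G m holomorphic_on {s. 3 - real n < Re s}"
      using G that(1) by (auto intro: holomorphic_on_subset)
    show "{s. 3 < Re s} \<noteq> {}" by (auto intro!: exI[of _ "4 :: complex"])
    show "connected {s. 3 - real n < Re s}" by (intro convex_connected convex_halfspace_Re_gt)
  qed (use G that in \<open>auto intro: open_halfspace_Re_gt\<close>)
  \<comment> \<open>This index \<open>n\<close> satisfies \<open>Re s > 3 - real n\<close>, so the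
    piece chosen is defined at \<open>s\<close>.\<close>
  define H where "H s = G (nat \<lceil>4 - Re s\<rceil>) s" for s
  have HG: "H s = G n s" if "Re s > 3 - real n" for n s
  proof -
    have k: "Re s > 3 - real (nat \<lceil>4 - Re s\<rceil>)" by linarith
    show ?thesis unfolding H_def using cons[of n "nat \<lceil>4 - Re s\<rceil>" s] cons[of "nat \<lceil>4 - Re s\<rceil>" n s] that k
      by (metis nat_le_linear)
  qed
  have "H field_differentiable at s" for s
  proof -
    obtain n where n: "Re s > 3 - real n" using reals_Archimedean2[of "3 - Re s"] by (auto simp: algebra_simps)
    have "H holomorphic_on {s. Re s > 3 - real n}"
      by (rule holomorphic_transform[of "G n"]) (use G HG in auto)
    then show ?thesis using n by (auto intro: holomorphic_on_imp_differentiable_at open_halfspace_Re_gt)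
  qed
  then have "H holomorphic_on UNIV" by (simp add: holomorphic_on_def)
  moreover have "H s = R.E M0 (zpt (s + 1))" if "Re s > 3" for s using HG[of 0 s] G that by auto
  ultimately show ?thesis using that by blast
qed

text \<open>The only pole is that of \<open>1 / (s - 1)\<close>. The chosen function is compared
  with this continuation in two moves: meromorphic functions agreeing near 2 agree on every small
  punctured disc, and niceness then fixes the values at the centres.\<close>

theorem riemann_zeta_properties:
  "\<And>s. Re s > 1 \<Longrightarrow> riemann_zeta s = (\<Sum>n. 1 / of_nat (Suc n) powr s)"
  "riemann_zeta holomorphic_on - {1}"
proof -
  obtain H where H: "H holomorphic_on UNIV" "\<And>s. Re s > 3 \<Longrightarrow> H s = R.E M0 (zpt (s + 1))" using E_M0_entire
    by blast
  define f where "f s = 1 / (s - 1) + 1 / 2 - s * H s" for s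
  have fhol: "f holomorphic_on - {1}"
    unfolding f_def by (intro holomorphic_intros holomorphic_on_subset[OF H(1)]) auto
  have fser: "f s = zetaser s" if "Re s > 1" for s
  proof (rule analytic_continuation_open[of "{s. Re s > 3}" "{s. Re s > 1}" f zetaser])
    show "{s. 3 < Re s} \<noteq> {}" by (auto intro!: exI[of _ "4 :: complex"])
    show "connected {s. 1 < Re s}" by (intro convex_connected convex_halfspace_Re_gt)
    show "f holomorphic_on {s. 1 < Re s}" by (rule holomorphic_on_subset[OF fhol]) auto
    show "zetaser holomorphic_on {s. 1 < Re s}" by (rule zetaser_holomorphic)
  qed (use that H(2) zetaser_eq in \<open>auto intro: open_halfspace_Re_gt simp: f_def\<close>)
  have fan: "f analytic_on {s}" if "s \<noteq> 1" for s
  proof (rule analytic_on_subset)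
    show "f analytic_on - {1}" using fhol by (subst analytic_on_open) auto
  qed (use that in auto)
  have fmer: "f meromorphic_on UNIV"
    unfolding f_def using H(1)
    by (intro meromorphic_intros) (auto intro!: analytic_on_imp_meromorphic_on simp: analytic_on_open)
  define f0 where "f0 = remove_sings f"
  have f0: "f0 nicely_meromorphic_on UNIV" unfolding f0_def by (rule remove_sings_nicely_meromorphic[OF fmer])
  have f0f: "f0 s = f s" if "s \<noteq> 1" for s
    unfolding f0_def using fan[OF that] by (rule remove_sings_at_analytic)
  have P0: "f0 nicely_meromorphic_on UNIV \<and> (\<forall>s. Re s > 1 \<longrightarrow> f0 s = (\<Sum>n. 1 / of_nat (Suc n) powr s))"
  proof (intro conjI allI impI f0)
    fix s :: complex assume s: "Re s > 1"
    then have "s \<noteq> 1" by auto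
    then show "f0 s = (\<Sum>n. 1 / of_nat (Suc n) powr s)" using f0f fser[OF s] by (simp add: zetaser_def)
  qed
  have P: "riemann_zeta nicely_meromorphic_on UNIV \<and> (\<forall>s. Re s > 1 \<longrightarrow> riemann_zeta s =
    (\<Sum>n. 1 / of_nat (Suc n) powr s))"
    unfolding riemann_zeta_def
    by (rule someI[of "\<lambda>f. f nicely_meromorphic_on UNIV \<and> (\<forall>s. Re s > 1 \<longrightarrow> f s =
      (\<Sum>n. 1 / of_nat (Suc n) powr s))", OF P0])
  then show ser: "riemann_zeta s = (\<Sum>n. 1 / of_nat (Suc n) powr s)" if "Re s > 1" for s using that by blast
  define d where "d s = riemann_zeta s - f0 s" for s
  have dm: "d meromorphic_on UNIV"
    unfolding d_def using P f0 by (intro meromorphic_intros) (auto simp: nicely_meromorphic_on_def)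
  have "\<forall>\<^sub>F s in at 2. Re s > 1"
    by (rule eventually_at_in_open'[of "{s. Re s > 1}", simplified]) (auto intro: open_halfspace_Re_gt)
  then have d2: "\<forall>\<^sub>F s in at 2. d s = 0"
    by eventually_elim (use P P0 in \<open>simp add: d_def\<close>)
  have "remove_sings d s = 0" for s
  proof (rule frequently_eq_meromorphic_imp_constant[of "remove_sings d" 0 2 UNIV])
    have "\<forall>\<^sub>F s in at 2. remove_sings d s = d s"
      using dm by (intro eventually_remove_sings_eq_at meromorphic_on_isolated_singularity) (auto intro:
        meromorphic_on_subset)
    with d2 have "\<forall>\<^sub>F s in at 2. remove_sings d s = 0" by eventually_elim simp
    then show "\<exists>\<^sub>F s in at 2. remove_sings d s = 0" by (rule eventually_frequently[rotated]) simp
    show "remove_sings d nicely_meromorphic_on UNIV" by (rule remove_sings_nicely_meromorphic[OF dm])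
  qed auto
  then have d0: "\<forall>\<^sub>F w in at s. d w = 0" for s
    using eventually_remove_sings_eq_at[of d s] dm
    by (metis (mono_tags, lifting) UNIV_I eventually_mono meromorphic_on_isolated_singularity
      meromorphic_on_subset subset_UNIV)
  have "riemann_zeta s = f s" if s: "s \<noteq> 1" for s
  proof -
    have "f0 \<midarrow>s\<rightarrow> f s"
    proof -
      have "f \<midarrow>s\<rightarrow> f s" using fan[OF s] analytic_at_imp_isCont isContD by blast
      moreover have "\<forall>\<^sub>F w in at s. w \<noteq> 1" by (rule eventually_neq_at_within)
      then have "\<forall>\<^sub>F w in at s. f w = f0 w" by eventually_elim (simp add: f0f)
      ultimately show ?thesis by (rule Lim_transform_eventually)
    qed
    moreover have "\<forall>\<^sub>F w in at s. f0 w = riemann_zeta w" using d0[of s] by eventually_elim (simp add: d_def)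
    \<comment> \<open>A finite limit excludes a pole, and at a point that is not a pole a nicely
      meromorphic function takes its limit.\<close>
    ultimately have lim: "riemann_zeta \<midarrow>s\<rightarrow> f s" by (rule Lim_transform_eventually)
    then have "\<not> is_pole riemann_zeta s"
      using not_tendsto_and_filterlim_at_infinity[OF at_neq_bot lim] by (auto simp: is_pole_def)
    then have "riemann_zeta \<midarrow>s\<rightarrow> riemann_zeta s" using P unfolding nicely_meromorphic_on_def by blast
    then show ?thesis using lim LIM_unique by blast
  qed
  then show "riemann_zeta holomorphic_on - {1}"
    by (intro holomorphic_transform[OF fhol]) auto
qed

section \<open>Bernoulli numbers and power sums over a parity class\<close>

text \<open>Logarithmic derivative of the reflection formula
  \<open>\<Gamma>(1 + w) \<Gamma>(1 - w) sin (\<pi> w) = \<pi> w\<close>. The denominators are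
  cleared so that it holds at 0 as well and can be read as an identity of power series.\<close>

lemma cot_Digamma:
  fixes z :: complex
  assumes z: "norm z < 1"
  shows "sin (of_real pi * z) * (z * (Digamma (1 + z) - Digamma (1 - z)) - 1) =
    - (of_real pi * z) * cos (of_real pi * z)"
proof (cases "z = 0")
  case False
  define B where "B = ball (0::complex) 1"
  define G where "G z = Gamma (1 + z) * Gamma (1 - z)" for z :: complex
  have ni: "1 + w \<notin> \<int>\<^sub>\<le>\<^sub>0" "1 - w \<notin> \<int>\<^sub>\<le>\<^sub>0" if "norm w < 1" for w :: complex
  proof -
    have "x \<notin> \<int>\<^sub>\<le>\<^sub>0" if "Re x > 0" for x :: complex using that by (auto simp: nonpos_Ints_def)
    moreover have "\<bar>Re w\<bar> < 1" using that abs_Re_le_cmod[of w] by linarith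
    ultimately show "1 + w \<notin> \<int>\<^sub>\<le>\<^sub>0" "1 - w \<notin> \<int>\<^sub>\<le>\<^sub>0" by force+
  qed
  have Gs: "G w * sin (of_real pi * w) = of_real pi * w" if w: "norm w < 1" for w
  proof (cases "w = 0")
    case False
    have wni: "w \<notin> \<int>\<^sub>\<le>\<^sub>0"
    proof
      assume "w \<in> \<int>\<^sub>\<le>\<^sub>0"
      then obtain n where "w = - of_nat n" by (auto elim!: nonpos_Ints_cases')
      then have "norm w = real n" by simp
      then show False using w False \<open>w = - of_nat n\<close> by simp
    qed
    have "sin (of_real pi * w) \<noteq> 0"
    proof
      assume "sin (of_real pi * w) = 0"
      then obtain n :: int where "of_real pi * w = of_int n * of_real pi" by (auto simp: sin_eq_0)
      then have "w = of_int n" by (simp add: mult.commute)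
      then show False using w False by (simp add: norm_of_int)
    qed
    moreover have "Gamma (1 + w) = w * Gamma w" using Gamma_plus1[OF wni] by (simp add: add.commute)
    ultimately show ?thesis using Gamma_reflection_complex[of w] by (simp add: G_def field_simps)
  qed simp
  have zB: "z \<in> B" using z by (simp add: B_def)
  have dG: "((\<lambda>w. G w * sin (of_real pi * w)) has_field_derivative
     (G z * (Digamma (1 + z) - Digamma (1 - z))) * sin (of_real pi * z) +
       of_real pi * cos (of_real pi * z) * G z) (at z)"
    unfolding G_def using ni[OF z]
    by (auto intro!: derivative_eq_intros simp: algebra_simps)
  have "((\<lambda>w. of_real pi * w) has_field_derivative of_real pi) (at z)" by (auto intro!: derivative_eq_intros)
  then have "((\<lambda>w. G w * sin (of_real pi * w)) has_field_derivative of_real pi) (at z)"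
    by (rule DERIV_cong_ev[OF refl _ refl, THEN iffD1, rotated])
       (rule eventually_mono[OF eventually_nhds_in_open[of B z]], use Gs zB in \<open>auto simp: B_def\<close>)
  then have "(G z * (Digamma (1 + z) - Digamma (1 - z))) * sin (of_real pi * z) +
    of_real pi * cos (of_real pi * z) * G z = of_real pi"
    using DERIV_unique[OF dG] by blast
  moreover have "G z \<noteq> 0" using Gs[OF z] False by auto
  moreover have "of_real pi * z = G z * sin (of_real pi * z)" using Gs[OF z] by simp
  moreover have "G z * (sin (of_real pi * z) * (z * (Digamma (1 + z) - Digamma (1 - z)) - 1) +
    (of_real pi * z) * cos (of_real pi * z)) =
    z * ((G z * (Digamma (1 + z) - Digamma (1 - z))) * sin (of_real pi * z) +
      of_real pi * cos (of_real pi * z) * G z) - G z * sin (of_real pi * z)"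
    by (simp add: algebra_simps)
  ultimately have "G z * (sin (of_real pi * z) * (z * (Digamma (1 + z) - Digamma (1 - z)) - 1) +
    (of_real pi * z) * cos (of_real pi * z)) = 0"
    by simp
  then show ?thesis using \<open>G z \<noteq> 0\<close> by (simp add: eq_neg_iff_add_eq_0)
qed simp

definition zsum :: "nat \<Rightarrow> complex" where "zsum j = (\<Sum>k. inverse ((1 + of_nat k) ^ j))"

lemma Digamma_fps:
  "(\<lambda>z :: complex. Digamma (1 + z)) has_fps_expansion Abs_fps (\<lambda>n.
    if n = 0 then - euler_mascheroni else (-1) ^ Suc n * zsum (Suc n))"
proof -
  have an: "Digamma analytic_on {1 :: complex}"
    by (rule analytic_on_Polygamma) (auto simp: nonpos_Ints_def)
  have 1: "(1::complex) \<notin> \<int>\<^sub>\<le>\<^sub>0" by (auto simp: nonpos_Ints_def)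
  have "fps_expansion Digamma (1::complex) = Abs_fps (\<lambda>n.
    if n = 0 then - euler_mascheroni else (-1) ^ Suc n * zsum (Suc n))"
    by (simp add: fps_expansion_def fps_eq_iff higher_deriv_Polygamma[OF 1] Polygamma_def[of
      "Suc _"] zsum_def gr0_conv_Suc del: power_Suc)
       (auto simp: Polygamma_def zsum_def)
  then show ?thesis using analytic_at_imp_has_fps_expansion[OF an] by simp
qed

text \<open>The power series of \<open>(1 - \<pi> z cot (\<pi> z)) / z\<close>.\<close>

definition cotcoef :: "complex fps" where "cotcoef = Abs_fps (\<lambda>n. if odd n then 2 * zsum (Suc n) else 0)"

lemma Digamma_diff_fps:
  "(\<lambda>z :: complex. Digamma (1 + z) - Digamma (1 - z)) has_fps_expansion cotcoef"
proof -
  have u: "(\<lambda>z :: complex. - z) has_fps_expansion - fps_X" by (intro fps_expansion_intros)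
  have "((\<lambda>z :: complex. Digamma (1 + z)) \<circ> (\<lambda>z. - z)) has_fps_expansion
     (Abs_fps (\<lambda>n. if n = 0 then - euler_mascheroni else (-1) ^ Suc n * zsum (Suc n)) oo - fps_X)"
    by (rule has_fps_expansion_compose[OF Digamma_fps u]) simp
  from has_fps_expansion_diff[OF Digamma_fps this]
  have "(\<lambda>z :: complex. Digamma (1 + z) - Digamma (1 - z)) has_fps_expansion
    Abs_fps (\<lambda>n. if n = 0 then - euler_mascheroni else (-1) ^ Suc n * zsum (Suc n)) -
    (Abs_fps (\<lambda>n. if n = 0 then - euler_mascheroni else (-1) ^ Suc n * zsum (Suc n)) oo - fps_X)"
    by (simp add: o_def)
  moreover have "Abs_fps (\<lambda>n. if n = 0 then - euler_mascheroni else (-1) ^ Suc n * zsum (Suc n)) -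
    (Abs_fps (\<lambda>n. if n = 0 then - euler_mascheroni else (-1) ^ Suc n * zsum (Suc n)) oo - fps_X) = cotcoef"
    unfolding fps_compose_uminus' cotcoef_def fps_eq_iff by auto
  ultimately show ?thesis by simp
qed

lemma cot_fps:
  "fps_sin (of_real pi) * (fps_X * cotcoef - 1) = - (fps_const (of_real pi) * fps_X) * fps_cos (of_real
    pi :: complex)"
proof (rule fps_expansion_unique_complex)
  show "(\<lambda>z. sin (of_real pi * z) * (z * (Digamma (1 + z) - Digamma (1 - z)) - 1)) has_fps_expansion
    fps_sin (of_real pi) * (fps_X * cotcoef - 1)"
    by (intro fps_expansion_intros Digamma_diff_fps)
  have "(\<lambda>z. - (of_real pi * z) * cos (of_real pi * z)) has_fps_expansion
     - (fps_const (of_real pi) * fps_X) * fps_cos (of_real pi :: complex)"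
    by (intro fps_expansion_intros)
  then show "(\<lambda>z. sin (of_real pi * z) * (z * (Digamma (1 + z) - Digamma (1 - z)) - 1)) has_fps_expansion
     - (fps_const (of_real pi) * fps_X) * fps_cos (of_real pi :: complex)"
    by (rule has_fps_expansion_cong[OF _ refl, THEN iffD1, rotated])
       (rule eventually_mono[OF eventually_nhds_in_open[of "ball 0 1" 0]], use cot_Digamma in auto)
qed

section \<open>Bernoulli numbers and zeta values\<close>

definition bern :: "complex fps" where "bern = fps_X / (fps_exp 1 - 1)"

lemma exp_minus_one_nz: "(fps_exp c - 1 :: complex fps) \<noteq> 0" if "c \<noteq> 0"
proof
  assume "fps_exp c - 1 = (0 :: complex fps)"
  then have "fps_nth (fps_exp c - 1) 1 = 0" by simp
  then show False using that by simp
qed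

lemma fps_dvd_X: "fps_nth D 0 = 0 \<Longrightarrow> fps_nth D 1 \<noteq> 0 \<Longrightarrow> (D :: complex fps) dvd fps_X * E"
proof -
  assume "fps_nth D 0 = 0" "fps_nth D 1 \<noteq> 0"
  then have "subdegree D = 1" by (intro subdegreeI) auto
  then have "D dvd fps_X" by (subst fps_dvd_iff) auto
  then show ?thesis by simp
qed

lemma bern_mult: "bern * (fps_exp 1 - 1) = fps_X"
proof -
  have "(fps_exp 1 - 1 :: complex fps) dvd fps_X * 1" by (rule fps_dvd_X) auto
  then show ?thesis unfolding bern_def by simp
qed

lemma bern_comp_mult: "(bern oo (fps_const c * fps_X)) * (fps_exp c - 1) = fps_const c * fps_X"
proof -
  have "(bern * (fps_exp 1 - 1)) oo (fps_const c * fps_X) = fps_const c * fps_X" unfolding bern_mult by simp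
  then show ?thesis by (subst (asm) fps_compose_mult_distrib) (simp_all add: fps_compose_sub_distrib)
qed

text \<open>Euler's evaluation of the even zeta values, from
  \<open>c X / (exp (c X) - 1) = \<pi> X cot (\<pi> X) - \<pi> \<i> X\<close> with
  \<open>c = 2 \<pi> \<i>\<close>. At odd indices it records the vanishing of the Bernoulli
  numbers.\<close>

lemma bern_zsum:
  "(2 * of_real pi * \<i>) ^ Suc (Suc n) * fps_nth bern (Suc (Suc n)) =
    - (if even n then 2 * zsum (Suc (Suc n)) else 0)"
proof -
  define c :: complex where "c = 2 * of_real pi * \<i>"
  define S where "S = 1 - fps_const (of_real pi * \<i>) * fps_X - fps_X * cotcoef"
  define e where "e = fps_exp (\<i> * of_real pi)"
  define s where "s = fps_sin (of_real pi :: complex)"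
  define k where "k = fps_cos (of_real pi :: complex)"
  define I where "I = fps_const \<i>"
  have I: "I * I = - 1" by (simp add: I_def)
  have e: "e = k + I * s" unfolding e_def k_def s_def I_def by (rule fps_exp_ii_sin_cos)
  have e2: "fps_exp c = e * e" unfolding e_def c_def fps_exp_add_mult[symmetric] by (simp add: algebra_simps)
  have ks: "k * k + s * s = 1"
    unfolding k_def s_def using fps_sin_cos_sum_of_squares[of "of_real pi :: complex"]
      by (simp add: power2_eq_square)
  define P where "P = fps_const (of_real pi :: complex)"
  have cf: "s * (1 - fps_X * cotcoef) = P * fps_X * k"
    using cot_fps unfolding s_def k_def P_def by (simp add: algebra_simps)
  have S: "S = 1 - P * I * fps_X - fps_X * cotcoef" unfolding S_def P_def I_def by simp
  \<comment> \<open>This is \<open>exp (2 \<pi> \<i> X) - 1 = 2 \<i> sin (\<pi> X) exp (\<pi> \<i>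
    X)\<close>; it brings in the sine factor that \<open>cot_fps\<close> needs.\<close>
  have e21: "e * e - 1 = 2 * I * s * e"
  proof -
    have "e * e - 1 - 2 * I * s * e = (k * k + s * s - 1) - (I * I + 1) * (s * s)- 2 * I * I * s * s +
      (2 * I * I) * s * s"
      unfolding e by (simp add: algebra_simps)
    also have "\<dots> = 0" using ks I by simp
    finally show ?thesis by simp
  qed
  have "S * (e * e - 1) = 2 * I * e * (s * (1 - fps_X * cotcoef) - P * I * fps_X * s)"
    unfolding S e21 by (simp add: algebra_simps)
  also have "\<dots> = 2 * I * P * fps_X * (e * (k - I * s))" unfolding cf by (simp add: algebra_simps)
  also have "e * (k - I * s) = k * k + s * s - (I * I + 1) * (s * s)" unfolding e by (simp add: algebra_simps)
  also have "\<dots> = 1" using ks I by simp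
  also have "2 * I * P * fps_X * 1 = fps_const c * fps_X"
    unfolding I_def P_def c_def by (simp add: numeral_fps_const)
  finally have "S * (fps_exp c - 1) = (bern oo (fps_const c * fps_X)) * (fps_exp c - 1)"
    unfolding bern_comp_mult by (simp only: e2)
  then have "S = bern oo (fps_const c * fps_X)" using exp_minus_one_nz[of c] by (simp add: c_def)
  then have "fps_nth S (Suc (Suc n)) = c ^ Suc (Suc n) * fps_nth bern (Suc (Suc n))" by simp
  moreover have "fps_nth S (Suc (Suc n)) = - (if even n then 2 * zsum (Suc (Suc n)) else 0)"
    unfolding S_def cotcoef_def by simp
  ultimately show ?thesis by (simp add: c_def)
qed

lemma bern_one: "fps_nth bern 0 = 1" "fps_nth bern 1 = - 1 / 2"
proof -
  have 1: "fps_nth (bern * (fps_exp 1 - 1)) 1 = 1" unfolding bern_mult by simp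
  then show b0: "fps_nth bern 0 = 1" by (simp add: fps_mult_nth)
  have 2: "fps_nth (bern * (fps_exp 1 - 1)) 2 = 0" unfolding bern_mult by simp
  have "{0..2} = {0, 1, 2 :: nat}" by auto
  then show "fps_nth bern 1 = - 1 / 2" using 2 b0
    by (simp add: fps_mult_nth numeral_2_eq_2 fact_Suc eq_neg_iff_add_eq_0 add.commute divide_simps)
qed

lemma bernoulli_poly_0: "bernoulli_poly j 0 = fact j * fps_nth bern j"
  by (simp add: bernoulli_poly_def bern_def)

text \<open>From \<open>t exp (t/2) / (exp t - 1) = 2 (t/2) / (exp (t/2) - 1) - t / (exp t -
  1)\<close>, which holds because \<open>exp t - 1\<close> is a difference of squares.\<close>

lemma bernoulli_poly_half: "bernoulli_poly j (1/2) = fact j * ((2 * (1/2) ^ j - 1) * fps_nth bern j)"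
proof -
  define C where "C = bern oo (fps_const (1/2) * fps_X)"
  have C: "C * (fps_exp (1/2) - 1) = fps_const (1/2) * fps_X" unfolding C_def by (rule bern_comp_mult)
  have e2: "fps_exp 1 = fps_exp (1/2) * fps_exp (1/2 :: complex)" unfolding fps_exp_add_mult[symmetric] by simp
  have h2: "2 * fps_const (1/2 :: complex) = 1" by (simp add: numeral_fps_const)
  have D: "(fps_exp 1 - 1 :: complex fps) = (fps_exp (1/2) - 1) * (fps_exp (1/2) + 1)"
    unfolding e2 by (simp add: algebra_simps)
  have "(2 * C - bern) * (fps_exp 1 - 1) = 2 * (C * (fps_exp (1/2) - 1)) * (fps_exp (1/2) +
    1) - bern * (fps_exp 1 - 1)"
    unfolding D by (simp add: algebra_simps)
  also have "\<dots> = (2 * fps_const (1/2)) * fps_X * (fps_exp (1/2) + 1) - fps_X" unfolding C bern_mult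
    by (simp add: algebra_simps)
  also have "\<dots> = fps_X * fps_exp (1/2)" unfolding h2 by (simp add: algebra_simps)
  finally have "fps_X * fps_exp (1/2) / (fps_exp 1 - 1) = 2 * C - bern"
    using exp_minus_one_nz[of 1] by (metis nonzero_mult_div_cancel_right one_neq_zero)
  then have "fps_nth (fps_X * fps_exp (1/2) / (fps_exp 1 - 1)) j = fps_nth (C + C - bern) j"
    by (simp only: mult_2)
  also have "\<dots> = fps_nth C j + fps_nth C j - fps_nth bern j" by simp
  also have "\<dots> = (2 * (1/2) ^ j - 1) * fps_nth bern j"
    unfolding fps_nth_compose_linear[of bern "1/2" j, folded C_def] by (simp add: algebra_simps)
  finally show ?thesis unfolding bernoulli_poly_def by simp
qed

text \<open>For \<open>j \<ge> 2\<close> the sums of \<open>1 / x ^ j\<close> over the odd integers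
  and over the nonzero even integers are \<open>- betac j\<close> and \<open>- gammac j\<close>: the
  two Bernoulli combinations of the theorem come from the two parities.\<close>

definition betac :: "nat \<Rightarrow> complex" where
  "betac j = (2 * of_real pi * \<i>) ^ j / fact j * ((bernoulli_poly j 0 - bernoulli_poly j (1/2)) / 2)"
definition gammac :: "nat \<Rightarrow> complex" where
  "gammac j = (2 * of_real pi * \<i>) ^ j / fact j * ((bernoulli_poly j 0 + bernoulli_poly j (1/2)) / 2)"

lemma betac_eq: "betac j = (1 - (1/2) ^ j) * ((2 * of_real pi * \<i>) ^ j * fps_nth bern j)"
  and gammac_eq: "gammac j = (1/2) ^ j * ((2 * of_real pi * \<i>) ^ j * fps_nth bern j)"
proof -
  have *: "c / fact j * ((fact j * b - fact j * ((2 * h - 1) * b)) / 2) = (1 - h) * (c * b)"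
    "c / fact j * ((fact j * b + fact j * ((2 * h - 1) * b)) / 2) = h * (c * b)" for c b h :: complex
    by (simp_all add: field_simps)
  show "betac j = (1 - (1/2) ^ j) * ((2 * of_real pi * \<i>) ^ j * fps_nth bern j)"
    "gammac j = (1/2) ^ j * ((2 * of_real pi * \<i>) ^ j * fps_nth bern j)"
    unfolding betac_def gammac_def bernoulli_poly_0 bernoulli_poly_half by (rule *)+
qed

text \<open>The values outside the range of the power sums. \<open>betac 0 = 0\<close> lets sums
  start at index 0, \<open>gammac 0 = 1\<close> accounts for a pole in the class, and
  \<open>betac 1 = gammac 1\<close> lets terms of exponent 1 cancel between different
  parities.\<close>

lemma betac_0: "betac 0 = 0" and gammac_0: "gammac 0 = 1" and betac_1: "betac 1 = gammac 1"
  by (simp_all add: betac_eq gammac_eq bern_one)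

section \<open>Sums over the integers and over a parity class\<close>

lemma int_has_sum:
  fixes f :: "int \<Rightarrow> 'a::{real_normed_vector}"
  assumes a: "((\<lambda>n. f (int n + 1)) has_sum a) UNIV" and b: "((\<lambda>n. f (- (int n + 1))) has_sum b) UNIV"
  shows "(f has_sum (f 0 + (a + b))) UNIV"
proof -
  have ia: "inj (\<lambda>n. int n + 1)" and ib: "inj (\<lambda>n. - (int n + 1))" by (auto simp: inj_on_def)
  have A: "(f has_sum a) (range (\<lambda>n. int n + 1))" using a by (subst has_sum_reindex[OF ia]) (simp add: o_def)
  have B: "(f has_sum b) (range (\<lambda>n. - (int n + 1)))" using b by (subst has_sum_reindex[OF ib]) (simp add: o_def)
  have AB: "(f has_sum (a + b)) (range (\<lambda>n. int n + 1) \<union> range (\<lambda>n. - (int n + 1)))"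
    by (rule has_sum_Un_disjoint[OF A B]) auto
  have "x \<in> insert 0 (range (\<lambda>n. int n + 1) \<union> range (\<lambda>n. - (int n + 1)))" for x :: int
  proof (cases x "0 :: int" rule: linorder_cases)
    case less
    then have "x = - (int (nat (- x - 1)) + 1)" by simp
    then show ?thesis by blast
  next
    case greater
    then have "x = int (nat (x - 1)) + 1" by simp
    then show ?thesis by blast
  qed simp
  then have U: "UNIV = insert 0 (range (\<lambda>n. int n + 1) \<union> range (\<lambda>n. - (int n + 1)))" by blast
  show ?thesis unfolding U by (rule has_sum_insert[OF _ AB]) auto
qed

lemma int_summable:
  fixes f :: "int \<Rightarrow> 'a::{real_normed_vector}"
  assumes "(\<lambda>n. f (int n + 1)) summable_on UNIV" "(\<lambda>n. f (- (int n + 1))) summable_on UNIV"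
  shows "f summable_on UNIV"
  using int_has_sum[OF has_sum_infsum[OF assms(1)] has_sum_infsum[OF assms(2)]] has_sum_imp_summable by blast

text \<open>With \<open>rcp 0 = 0\<close> the sums below automatically leave out the poles.\<close>

definition rcp :: "int \<Rightarrow> complex" where "rcp x = inverse (of_int x)"

lemma rcp_0 [simp]: "rcp 0 = 0" by (simp add: rcp_def)
lemma rcp_minus: "rcp (- x) = - rcp x" by (simp add: rcp_def)
lemma norm_rcp_le: "norm (rcp x) \<le> 1"
proof (cases "x = 0")
  case False
  then have "1 \<le> \<bar>real_of_int x\<bar>"
    by (metis abs_of_nonneg int_one_le_iff_zero_less linorder_not_less of_int_1_le_iff of_int_abs
    zero_less_abs_iff)
  then show ?thesis by (simp add: rcp_def norm_inverse inverse_le_1_iff)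
qed simp

lemma summable_rcp2: "(\<lambda>x. norm (rcp x) ^ 2) summable_on UNIV"
proof -
  have "summable (\<lambda>n. inverse (real n ^ 2))" by (rule inverse_power_summable) simp
  then have s: "summable (\<lambda>n. inverse (real (Suc n) ^ 2))" by (subst summable_Suc_iff)
  have e: "norm (rcp (int n + 1)) ^ 2 = inverse (real (Suc n) ^ 2)" "norm (rcp (- (int n + 1))) ^ 2 =
    inverse (real (Suc n) ^ 2)" for n
  proof -
    have "rcp (int n + 1) = of_real (inverse (real (Suc n)))" by (simp add: rcp_def)
    then show 1: "norm (rcp (int n + 1)) ^ 2 = inverse (real (Suc n) ^ 2)"
      by (simp only: norm_of_real) (simp add: power_inverse)
    show "norm (rcp (- (int n + 1))) ^ 2 = inverse (real (Suc n) ^ 2)"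
      unfolding rcp_minus norm_minus_cancel by (rule 1)
  qed
  have "(\<lambda>n. inverse (real (Suc n) ^ 2)) summable_on UNIV"
    using s by (intro norm_summable_imp_summable_on) simp
  then show ?thesis by (intro int_summable) (simp_all only: e)
qed

lemma bij_add_int: "bij_betw (\<lambda>x. x + D) UNIV (UNIV :: int set)"
  by (rule bij_betwI[of _ _ _ "\<lambda>x. x - D"]) auto

lemma summable_rcp_prod:
  assumes "i \<ge> 1" "j \<ge> 1"
  shows "(\<lambda>x. rcp x ^ i * rcp (x + D) ^ j) summable_on A"
proof -
  have s2: "(\<lambda>x. norm (rcp (x + D)) ^ 2) summable_on UNIV"
    using summable_on_reindex_bij_betw[OF bij_add_int, of "\<lambda>x. norm (rcp x) ^ 2" D] summable_rcp2 by simp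
  have "(\<lambda>x. norm (rcp x ^ i * rcp (x + D) ^ j)) summable_on UNIV"
  proof (rule Infinite_Sum.abs_summable_on_comparison_test'[OF summable_on_add[OF summable_rcp2 s2]])
    fix x
    have le: "norm (rcp y ^ k) \<le> norm (rcp y)" if "k \<ge> 1" for y k
      using power_decreasing[of 1 k "norm (rcp y)"] norm_rcp_le[of y] that by (simp add: norm_power)
    have "norm (rcp x ^ i * rcp (x + D) ^ j) \<le> norm (rcp x) * norm (rcp (x + D))"
      unfolding norm_mult using le assms by (intro mult_mono) auto
    also have "\<dots> \<le> norm (rcp x) ^ 2 + norm (rcp (x + D)) ^ 2"
      using sum_squares_bound[of "norm (rcp x)" "norm (rcp (x +
        D))"] mult_nonneg_nonneg[OF norm_ge_zero[of "rcp x"] norm_ge_zero[of "rcp (x + D)"]]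
      by linarith
    finally show "norm (rcp x ^ i * rcp (x + D) ^ j) \<le> norm (rcp x) ^ 2 + norm (rcp (x + D)) ^ 2" .
  qed
  then have "(\<lambda>x. rcp x ^ i * rcp (x + D) ^ j) summable_on UNIV" by (rule Infinite_Sum.abs_summable_summable)
  then show ?thesis by (rule summable_on_subset_banach) simp
qed

lemma has_sum_delta:
  "((\<lambda>x. if x = a then c else 0 :: complex) has_sum (if a \<in> A then c else 0)) A"
proof -
  have "((\<lambda>x. if x = a then c else 0 :: complex) has_sum (if a \<in> A then c else 0)) (A \<inter> {a})"
    by (rule has_sum_finiteI) auto
  then show ?thesis by (rule has_sum_cong_neutral[THEN iffD1, rotated -1]) auto
qed

lemma has_sum_sum_finite:
  fixes f :: "'i \<Rightarrow> 'a \<Rightarrow> complex"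
  assumes "\<And>i. i \<in> I \<Longrightarrow> (f i has_sum s i) A"
  shows "((\<lambda>x. \<Sum>i\<in>I. f i x) has_sum (\<Sum>i\<in>I. s i)) A"
  using assms by (induction I rule: infinite_finite_induct) (auto intro: has_sum_add has_sum_0)

lemma rcp_pow_has_sum:
  assumes j: "j \<ge> 2"
  shows "((\<lambda>x. rcp x ^ j) has_sum (- ((2 * of_real pi * \<i>) ^ j * fps_nth bern j))) UNIV"
proof -
  define k where "k = j - 2"
  have k: "j = Suc (Suc k)" using j by (simp add: k_def)
  have pos: "rcp (int n + 1) ^ j = inverse ((1 + of_nat n) ^ j)" for n
  proof -
    have "of_int (int n + 1) = (1 + of_nat n :: complex)" by simp
    then show ?thesis by (simp only: rcp_def power_inverse)
  qed
  have "summable (\<lambda>n. inverse (real n ^ j))" by (rule inverse_power_summable) (use j in simp)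
  then have "summable (\<lambda>n. inverse (real (Suc n) ^ j))" by (subst summable_Suc_iff)
  moreover have "norm (rcp (int n + 1) ^ j) = inverse (real (Suc n) ^ j)" for n
  proof -
    have "rcp (int n + 1) = of_real (inverse (real (Suc n)))" by (simp add: rcp_def)
    then show ?thesis by (simp only: norm_power norm_of_real) (simp add: power_inverse)
  qed
  ultimately have sn: "summable (\<lambda>n. norm (rcp (int n + 1) ^ j))" by simp
  have p: "((\<lambda>n. rcp (int n + 1) ^ j) has_sum zsum j) UNIV"
    using norm_summable_imp_has_sum[OF sn summable_sums[OF summable_norm_cancel[OF sn]]] unfolding zsum_def pos .
  have m: "((\<lambda>n. rcp (- (int n + 1)) ^ j) has_sum ((- 1) ^ j * zsum j)) UNIV"
    using has_sum_cmult_right[OF p, of "(- 1) ^ j"] unfolding rcp_minus power_minus[of "rcp _"] .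
  have "((\<lambda>x. rcp x ^ j) has_sum (rcp 0 ^ j + (zsum j + (- 1) ^ j * zsum j))) UNIV"
    by (rule int_has_sum[OF p m])
  moreover have "rcp 0 ^ j + (zsum j + (- 1) ^ j * zsum j) = - ((2 * of_real pi * \<i>) ^ j * fps_nth bern j)"
    unfolding k bern_zsum by simp
  ultimately show ?thesis by simp
qed

definition parity_class :: "int \<Rightarrow> int set" where "parity_class d = {x. even (x - d)}"

text \<open>The sum of \<open>rcp x ^ j\<close> over \<open>parity_class d\<close> for \<open>j \<ge> 2\<close>. For \<open>j \<le> 1\<close> it is no such sum: at \<open>j = 0\<close>
  it accounts for the terms left out at the poles, and the terms with \<open>j = 1\<close> cancel in pairs.\<close>

definition parity_sum :: "int \<Rightarrow> nat \<Rightarrow> complex" where "parity_sum d j =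
  (if even d then - gammac j else - betac j)"

lemma parity_class_pow_has_sum:
  assumes j: "j \<ge> 2"
  shows "((\<lambda>x. rcp x ^ j) has_sum parity_sum d j) (parity_class d)"
proof -
  have inj: "inj (\<lambda>k. 2 * k :: int)" by (auto simp: inj_on_def)
  have "((\<lambda>k. rcp (2 * k) ^ j) has_sum ((1/2) ^ j * - ((2 * of_real pi * \<i>) ^ j * fps_nth bern j))) UNIV"
  proof -
    have "rcp (2 * k) = 1/2 * rcp k" for k unfolding rcp_def of_int_mult inverse_mult_distrib by simp
    then have "rcp (2 * k) ^ j = (1/2) ^ j * rcp k ^ j" for k by (simp only: power_mult_distrib)
    then show ?thesis using has_sum_cmult_right[OF rcp_pow_has_sum[OF j], of "(1/2) ^ j"] by (simp only:)
  qed
  then have ev: "((\<lambda>x. rcp x ^ j) has_sum (- gammac j)) (range (\<lambda>k. 2 * k))"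
    by (subst has_sum_reindex[OF inj]) (simp add: o_def gammac_eq)
  have r: "range (\<lambda>k. 2 * k :: int) = {x. even x}" by (auto elim!: evenE)
  show ?thesis
  proof (cases "even d")
    case True
    then have "parity_class d = range (\<lambda>k. 2 * k)" unfolding r by (auto simp: parity_class_def)
    then show ?thesis using ev True by (simp add: parity_sum_def)
  next
    case False
    then have Kd: "parity_class d = UNIV - range (\<lambda>k. 2 * k)" unfolding r by (auto simp: parity_class_def)
    have "((\<lambda>x. rcp x ^ j) has_sum (- ((2 * of_real pi * \<i>) ^ j * fps_nth bern j) - (- gammac j))) (UNIV
      - range (\<lambda>k. 2 * k))"
      by (rule has_sum_Diff[OF rcp_pow_has_sum[OF j] ev]) simp
    moreover have "- ((2 * of_real pi * \<i>) ^ j * fps_nth bern j) - (- gammac j) = - betac j"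
      unfolding betac_eq gammac_eq by (simp add: algebra_simps)
    ultimately show ?thesis using False Kd by (simp add: parity_sum_def)
  qed
qed

text \<open>Summability is known beforehand, so the value can be computed along the two half-lines,
  where the partial sums telescope.\<close>

lemma int_telescope1:
  fixes g :: "int \<Rightarrow> complex"
  assumes s: "(\<lambda>k. g k - g (k + 1)) summable_on UNIV"
    and l: "(\<lambda>n. g (int n)) \<longlonglongrightarrow> 0" "(\<lambda>n. g (- int n)) \<longlonglongrightarrow> 0"
  shows "((\<lambda>k. g k - g (k + 1)) has_sum 0) UNIV"
proof -
  have sub: "(\<lambda>n. g (h n) - g (h n + 1)) summable_on UNIV" if "inj h" for h :: "nat \<Rightarrow> int"
  proof -
    have "(\<lambda>k. g k - g (k + 1)) summable_on (range h)" using s by (rule summable_on_subset_banach) simp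
    then show ?thesis by (subst (asm) summable_on_reindex[OF that]) (simp add: o_def)
  qed
  have l1: "(\<lambda>n. g (int n + 1)) \<longlonglongrightarrow> 0" using LIMSEQ_Suc[OF l(1)] by (simp add: add.commute)
  have "(\<lambda>n. g (int n + 1) - g (int (Suc n) + 1)) sums (g (int 0 + 1) - 0)"
    by (rule telescope_sums'[OF l1])
  then have t1: "(\<lambda>n. g (int n + 1) - g ((int n + 1) + 1)) sums g 1" by (simp add: add_ac)
  have "(\<lambda>n. g (- int (Suc n)) - g (- int n)) sums (0 - g (- int 0))"
    by (rule telescope_sums[OF l(2)])
  then have t2: "(\<lambda>n. g (- (int n + 1)) - g (- (int n + 1) + 1)) sums (- g 0)" by (simp add: add_ac)
  have h1: "((\<lambda>n. g (int n + 1) - g ((int n + 1) + 1)) has_sum g 1) UNIV"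
    using has_sum_infsum[OF sub[of "\<lambda>n. int n + 1"]] has_sum_imp_sums t1 sums_unique2
      by (fastforce simp: inj_on_def)
  have h2: "((\<lambda>n. g (- (int n + 1)) - g (- (int n + 1) + 1)) has_sum (- g 0)) UNIV"
    using has_sum_infsum[OF sub[of "\<lambda>n. - (int n + 1)"]] has_sum_imp_sums t2 sums_unique2
      by (fastforce simp: inj_on_def)
  from int_has_sum[OF h1 h2] show ?thesis by simp
qed

lemma int_telescope:
  fixes g :: "int \<Rightarrow> complex"
  assumes s: "(\<lambda>k. g k - g (k + 1)) summable_on UNIV"
    and l: "(\<lambda>n. g (int n)) \<longlonglongrightarrow> 0" "(\<lambda>n. g (- int n)) \<longlonglongrightarrow> 0"
  shows "((\<lambda>k. g k - g (k + int m)) has_sum 0) UNIV"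
proof (induction m)
  case (Suc m)
  have "((\<lambda>k. g (k + int m) - g (k + int m + 1)) has_sum 0) UNIV"
    using has_sum_reindex_bij_betw[OF bij_add_int[of "int m"], of "\<lambda>k. g k - g (k +
      1)" 0] int_telescope1[OF assms] by blast
  from has_sum_add[OF Suc.IH this] show ?case by (simp add: add_ac)
qed (simp add: has_sum_0)

lemma rcp_tendsto: "(\<lambda>n. rcp (a * int n + b)) \<longlonglongrightarrow> 0" if "a \<noteq> 0"
proof -
  have "(\<lambda>n. inverse (real_of_int a * real n + real_of_int b)) \<longlonglongrightarrow> 0"
    using that by (cases "a > 0") real_asymp+
  then have "(\<lambda>n. complex_of_real (inverse (real_of_int a * real n + real_of_int b))) \<longlonglongrightarrow> of_real 0"
    by (rule tendsto_of_real)
  then show ?thesis by (simp add: rcp_def)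
qed

lemma summable_rcp_diff: "D \<noteq> 0 \<Longrightarrow> (\<lambda>x. rcp x - rcp (x + D)) summable_on A"
proof -
  assume D: "D \<noteq> 0"
  \<comment> \<open>The product of two factors is summable; at the points 0 and \<open>- D\<close>,
    where \<open>rcp\<close> returns 0 instead of a pole, the identity has to be corrected.\<close>
  have eq: "rcp x - rcp (x + D) = of_int D * (rcp x ^ 1 * rcp (x + D) ^ 1) + (if x =
    - D then rcp (- D) else 0) + (if x = 0 then - rcp D else 0)" for x
  proof -
    consider "x = 0" | "x = - D" "x \<noteq> 0" | "x \<noteq> 0" "x + D \<noteq> 0" by fastforce
    then show ?thesis
    proof cases
      case 3
      then have "of_int x \<noteq> (0::complex)" "of_int (x + D) \<noteq> (0::complex)" by (simp_all del: of_int_add)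
      then show ?thesis using 3 by (auto simp: rcp_def field_simps)
    qed (use D in auto)
  qed
  have f: "(\<lambda>x. if x = a then c else 0 :: complex) summable_on A" for a :: int and c
    by (rule has_sum_imp_summable[OF has_sum_delta])
  show ?thesis unfolding eq
    by (intro summable_on_add summable_on_cmult_right summable_rcp_prod f) auto
qed

text \<open>For odd \<open>D\<close> the shifted terms lie in the other class, so the sum does not
  telescope directly. The reflection \<open>x \<mapsto> - x\<close> maps the class to itself and the
  summand to \<open>rcp (x - D) - rcp x\<close>; adding both gives a shift by \<open>2 D\<close>
  inside one class, which telescopes. So twice the sum is 0.\<close>

lemma parity_class_rcp_diff_has_sum:
  assumes D: "D > 0"
  shows "((\<lambda>x. rcp x - rcp (x + D)) has_sum 0) (parity_class d)"
proof -
  define S where "S = infsum (\<lambda>x. rcp x - rcp (x + D)) (parity_class d)"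
  have S: "((\<lambda>x. rcp x - rcp (x + D)) has_sum S) (parity_class d)"
    unfolding S_def by (rule has_sum_infsum[OF summable_rcp_diff]) (use D in simp)
  have bm: "bij_betw uminus (parity_class d) (parity_class d)"
    by (rule bij_betwI[of _ _ _ uminus]) (auto simp: parity_class_def)
  have S': "((\<lambda>x. rcp (x - D) - rcp x) has_sum S) (parity_class d)"
  proof -
    have "((\<lambda>x. rcp (- x) - rcp (- x + D)) has_sum S) (parity_class d)"
      using has_sum_reindex_bij_betw[OF bm, of "\<lambda>x. rcp x - rcp (x + D)" S] S by blast
    moreover have "rcp (- x) - rcp (- x + D) = rcp (x - D) - rcp x" for x
      using rcp_minus[of "x - D"] by (simp add: rcp_minus)
    ultimately show ?thesis by (simp only:)
  qed
  have SS: "((\<lambda>x. rcp (x - D) - rcp (x + D)) has_sum (S + S)) (parity_class d)"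
    using has_sum_add[OF S' S] by simp
  define g where "g k = rcp (d + 2 * k - D)" for k
  have bd: "bij_betw (\<lambda>k. d + 2 * k) UNIV (parity_class d)"
  proof (rule bij_betwI[of _ _ _ "\<lambda>x. (x - d) div 2"])
    show "d + 2 * ((y - d) div 2) = y" if "y \<in> parity_class d" for y using that by (simp add: parity_class_def)
  qed (auto simp: parity_class_def)
  have "((\<lambda>k. g k - g (k + int (nat D))) has_sum (S + S)) UNIV"
    using has_sum_reindex_bij_betw[OF bd, of "\<lambda>x. rcp (x - D) - rcp (x + D)" "S + S"] SS D
    by (simp add: g_def algebra_simps)
  moreover have "((\<lambda>k. g k - g (k + int (nat D))) has_sum 0) UNIV"
  proof (rule int_telescope)
    have "(\<lambda>x. rcp x - rcp (x + 2)) summable_on (\<lambda>k. d + 2 * k - D) ` UNIV"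
      by (rule summable_rcp_diff) simp
    then show "(\<lambda>k. g k - g (k + 1)) summable_on UNIV"
      by (subst (asm) summable_on_reindex) (auto simp: inj_on_def o_def g_def algebra_simps)
    show "(\<lambda>n. g (int n)) \<longlonglongrightarrow> 0" "(\<lambda>n. g (- int n)) \<longlonglongrightarrow> 0"
      unfolding g_def using rcp_tendsto[of 2 "d - D"] rcp_tendsto[of "-2" "d - D"]
        by (simp_all add: algebra_simps)
  qed
  ultimately have "S + S = 0" by (rule has_sum_unique)
  then have "S = 0" by simp
  then show ?thesis using S by simp
qed

section \<open>Partial fractions\<close>

text \<open>Coefficients in the expansion of \<open>X^i Y^j\<close> for \<open>X = 1/x\<close>,
  \<open>Y = 1/(x + D)\<close>: \<open>pfA\<close> belongs to the powers of \<open>X\<close>,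
  \<open>pfB\<close> to those of \<open>Y\<close>. Both formulas are also used at index 0, where
  they give the corrections at the poles.\<close>

definition pfA :: "nat \<Rightarrow> nat \<Rightarrow> nat \<Rightarrow> complex" where
  "pfA i j a = (- 1) ^ (i - a) * of_nat ((i + j - 1 - a) choose (j - 1))"
definition pfB :: "nat \<Rightarrow> nat \<Rightarrow> nat \<Rightarrow> complex" where
  "pfB i j b = (- 1) ^ i * of_nat ((i + j - 1 - b) choose (i - 1))"

lemma partial_fraction_left1:
  fixes X Y \<delta> :: complex assumes "X * Y = \<delta> * (X - Y)"
  shows "X * Y ^ j = \<delta> ^ j * X - (\<Sum>b=1..j. \<delta> ^ (Suc j - b) * Y ^ b)"
proof (induction j)
  case (Suc j)
  have "X * Y ^ Suc j = (X * Y ^ j) * Y" by simp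
  also have "\<dots> = \<delta> ^ j * (X * Y) - (\<Sum>b=1..j. \<delta> ^ (Suc j - b) * Y ^ Suc b)"
    unfolding Suc.IH by (simp add: algebra_simps sum_distrib_left)
  also have "(\<Sum>b=1..j. \<delta> ^ (Suc j - b) * Y ^ Suc b) = (\<Sum>b=2..Suc j. \<delta> ^ (Suc (Suc j) - b) * Y ^ b)"
    by (subst numeral_2_eq_2, subst One_nat_def, subst sum.atLeast_Suc_atMost_Suc_shift) simp
  also have "\<delta> ^ j * (X * Y) = \<delta> ^ Suc j * X - \<delta> ^ Suc j * Y" unfolding assms by (simp add: algebra_simps)
  also have "\<delta> ^ Suc j * X - \<delta> ^ Suc j * Y - (\<Sum>b=2..Suc j. \<delta> ^ (Suc (Suc j) - b) * Y ^ b) =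
    \<delta> ^ Suc j * X - (\<Sum>b=1..Suc j. \<delta> ^ (Suc (Suc j) - b) * Y ^ b)"
    by (subst (2) sum.atLeast_Suc_atMost) (simp_all add: numeral_2_eq_2)
  finally show ?case .
qed simp

lemma partial_fraction_right1:
  fixes X Y \<delta> :: complex assumes "X * Y = \<delta> * (X - Y)"
  shows "X ^ i * Y = (\<Sum>a=1..i. (- 1) ^ (i - a) * \<delta> ^ (Suc i - a) * X ^ a) + (- 1) ^ i * \<delta> ^ i * Y"
proof (induction i)
  case (Suc i)
  have "X ^ Suc i * Y = (X ^ i * Y) * X" by simp
  also have "\<dots> = (\<Sum>a=1..i. (- 1) ^ (i - a) * \<delta> ^ (Suc i - a) * X ^ Suc a) + (- 1) ^ i * \<delta> ^ i * (X * Y)"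
    unfolding Suc.IH by (simp add: algebra_simps sum_distrib_left)
  also have "(\<Sum>a=1..i. (- 1) ^ (i - a) * \<delta> ^ (Suc i - a) * X ^ Suc a) =
    (\<Sum>a=2..Suc i. (- 1) ^ (Suc i - a) * \<delta> ^ (Suc (Suc i) - a) * X ^ a)"
    by (subst numeral_2_eq_2, subst One_nat_def, subst sum.atLeast_Suc_atMost_Suc_shift) simp
  also have "(- 1) ^ i * \<delta> ^ i * (X * Y) = (- 1) ^ i * \<delta> ^ Suc i * X + (- 1) ^ Suc i * \<delta> ^ Suc i * Y"
    unfolding assms by (simp add: algebra_simps)
  also have "(\<Sum>a=2..Suc i. (- 1) ^ (Suc i - a) * \<delta> ^ (Suc (Suc i) - a) * X ^ a) +
    ((- 1) ^ i * \<delta> ^ Suc i * X + (- 1) ^ Suc i * \<delta> ^ Suc i * Y) =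
    (\<Sum>a=1..Suc i. (- 1) ^ (Suc i - a) * \<delta> ^ (Suc (Suc i) - a) * X ^ a) + (- 1) ^ Suc i * \<delta> ^ Suc i * Y"
    by (subst (2) sum.atLeast_Suc_atMost) (simp_all add: numeral_2_eq_2)
  finally show ?case .
qed simp

text \<open>Induction by \<open>X^i Y^j = \<delta> (X^i Y^(j-1) - X^(i-1) Y^j)\<close>; on the
  coefficients this is Pascal's rule.\<close>

lemma partial_fraction:
  fixes X Y \<delta> :: complex assumes XY: "X * Y = \<delta> * (X - Y)" and "i \<ge> 1" "j \<ge> 1"
  shows "X ^ i * Y ^ j = (\<Sum>a=1..i. pfA i j a * \<delta> ^ (i + j - a) * X ^ a) + (\<Sum>b=1..j. pfB i j b * \<delta> ^ (i +
    j - b) * Y ^ b)"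
  using assms(2,3)
proof (induction "i + j" arbitrary: i j rule: less_induct)
  case less
  consider "i = 1" | "j = 1" | "i \<ge> 2" "j \<ge> 2" using less.prems by linarith
  then show ?case
  proof cases
    case 1
    then show ?thesis using partial_fraction_left1[OF XY, of j] by (simp add: pfA_def pfB_def sum_negf)
  next
    case 2
    then show ?thesis using partial_fraction_right1[OF XY, of i] less.prems by (simp add: pfA_def pfB_def)
  next
    case 3
    define i' j' where "i' = i - 2" and "j' = j - 2"
    have ij: "i = Suc (Suc i')" "j = Suc (Suc j')" using 3 by (simp_all add: i'_def j'_def)
    have 1: "X ^ i * Y ^ Suc j' = (\<Sum>a=1..i. pfA i (Suc j') a * \<delta> ^ (i + Suc j' - a) * X ^ a) +
      (\<Sum>b=1..Suc j'. pfB i (Suc j') b * \<delta> ^ (i + Suc j' - b) * Y ^ b)"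
      by (rule less.hyps) (simp_all add: ij)
    have 2: "X ^ Suc i' * Y ^ j = (\<Sum>a=1..Suc i'. pfA (Suc i') j a * \<delta> ^ (Suc i' + j - a) * X ^ a) +
      (\<Sum>b=1..j. pfB (Suc i') j b * \<delta> ^ (Suc i' + j - b) * Y ^ b)"
      by (rule less.hyps) (simp_all add: ij)
    \<comment> \<open>The added term carries a zero binomial coefficient, so both expansions can be
      summed over the same range.\<close>
    have e1: "(\<Sum>a=1..Suc i'. pfA (Suc i') j a * \<delta> ^ (Suc i' + j - a) * X ^ a) =
      (\<Sum>a=1..i. pfA (Suc i') j a * \<delta> ^ (Suc i' + j - a) * X ^ a)"
      by (simp add: ij pfA_def binomial_eq_0)
    have e2: "(\<Sum>b=1..Suc j'. pfB i (Suc j') b * \<delta> ^ (i + Suc j' - b) * Y ^ b) =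
      (\<Sum>b=1..j. pfB i (Suc j') b * \<delta> ^ (i + Suc j' - b) * Y ^ b)"
      by (simp add: ij pfB_def binomial_eq_0)
    have cA: "\<delta> * (pfA i (Suc j') a * \<delta> ^ (i + Suc j' - a)) - \<delta> * (pfA (Suc i') j a * \<delta> ^ (Suc i' +
      j - a)) = pfA i j a * \<delta> ^ (i + j - a)"
      if a: "a \<in> {1..i}" for a
    proof (cases "a = i")
      case True
      then show ?thesis by (simp add: pfA_def ij binomial_eq_0)
    next
      case False
      define t where "t = Suc i' - a"
      have t: "a + t = Suc i'" "i - a = Suc t" "i + Suc j' - a = Suc (Suc (t + j'))" "Suc i' + j - a =
        Suc (Suc (t + j'))"
         "i + j - a = Suc (Suc (Suc (t + j')))" "i + Suc j' - 1 - a = Suc (t + j')" "Suc i' + j - 1 - a =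
           Suc (t + j')" "i + j - 1 - a = Suc (Suc (t + j'))"
        using a False by (auto simp: t_def ij)
      show ?thesis unfolding pfA_def t t_def[symmetric] by (simp add: ij algebra_simps)
    qed
    have cB: "\<delta> * (pfB i (Suc j') b * \<delta> ^ (i + Suc j' - b)) - \<delta> * (pfB (Suc i') j b * \<delta> ^ (Suc i' +
      j - b)) = pfB i j b * \<delta> ^ (i + j - b)"
      if b: "b \<in> {1..j}" for b
    proof (cases "b = j")
      case True
      then show ?thesis by (simp add: pfB_def ij binomial_eq_0)
    next
      case False
      define t where "t = Suc j' - b"
      have t: "b + t = Suc j'" "i + Suc j' - b = Suc (Suc (t + i'))" "Suc i' + j - b = Suc (Suc (t + i'))"
         "i + j - b = Suc (Suc (Suc (t + i')))" "i + Suc j' - 1 - b = Suc (t + i')" "Suc i' + j - 1 - b =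
           Suc (t + i')" "i + j - 1 - b = Suc (Suc (t + i'))"
        using b False by (auto simp: t_def ij)
      show ?thesis unfolding pfB_def t by (simp add: ij algebra_simps)
    qed
    have "X ^ i * Y ^ j = X ^ Suc i' * Y ^ Suc j' * (X * Y)" by (simp add: ij)
    also have "\<dots> = \<delta> * (X ^ i * Y ^ Suc j') - \<delta> * (X ^ Suc i' * Y ^ j)" unfolding XY
      by (simp add: ij algebra_simps)
    also have "\<dots> = (\<Sum>a=1..i. (\<delta> * (pfA i (Suc j') a * \<delta> ^ (i +
      Suc j' - a)) - \<delta> * (pfA (Suc i') j a * \<delta> ^ (Suc i' + j - a))) * X ^ a)
      + (\<Sum>b=1..j. (\<delta> * (pfB i (Suc j') b * \<delta> ^ (i + Suc j' - b)) - \<delta> * (pfB (Suc i') j b * \<delta> ^ (Suc i' +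
        j - b))) * Y ^ b)"
      unfolding 1 2 e1 e2 left_diff_distrib sum_subtractf by (simp add: sum_distrib_left algebra_simps)
    also have "\<dots> = (\<Sum>a=1..i. pfA i j a * \<delta> ^ (i + j - a) * X ^ a) + (\<Sum>b=1..j. pfB i j b * \<delta> ^ (i +
      j - b) * Y ^ b)"
      by (intro arg_cong2[where f = "(+)"] sum.cong refl) (simp_all only: cA cB)
    finally show ?thesis .
  qed
qed

lemma hockey_stick:
  assumes "i \<ge> 1" shows "(\<Sum>b=1..j. (i + j - 1 - b) choose (i - 1)) = (i + j - 1) choose i"
proof (induction j)
  case (Suc j)
  obtain i' where i: "i = Suc i'" using assms by (cases i) auto
  have "(\<Sum>b=1..Suc j. (i + Suc j - 1 - b) choose (i - 1)) = ((i' + j) choose i') + (\<Sum>b=2..Suc j. (i +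
    Suc j - 1 - b) choose (i - 1))"
    by (subst sum.atLeast_Suc_atMost) (simp_all add: numeral_2_eq_2 i)
  also have "(\<Sum>b=2..Suc j. (i + Suc j - 1 - b) choose (i - 1)) = (\<Sum>b=1..j. (i + j - 1 - b) choose (i - 1))"
    by (subst numeral_2_eq_2, subst One_nat_def, subst sum.atLeast_Suc_atMost_Suc_shift) (simp add: i)
  finally show ?case unfolding Suc.IH by (simp add: i)
qed (use assms in simp)

text \<open>At the pole \<open>x = 0\<close> the powers of \<open>X\<close> vanish under
  \<open>rcp 0 = 0\<close> and the powers of \<open>Y\<close> add up to this value. It is the
  coefficient formula at index 0, so the correction at the pole is one more term of the same
  shape.\<close>

lemma pfB_sum: "i \<ge> 1 \<Longrightarrow> j \<ge> 1 \<Longrightarrow> (\<Sum>b=1..j. pfB i j b) = pfA i j 0"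
proof -
  assume ij: "i \<ge> 1" "j \<ge> 1"
  have "(\<Sum>b=1..j. pfB i j b) = (- 1) ^ i * of_nat (\<Sum>b=1..j. (i + j - 1 - b) choose (i - 1))"
    by (simp add: pfB_def sum_distrib_left)
  also have "\<dots> = pfA i j 0"
    unfolding hockey_stick[OF ij(1)] pfA_def using binomial_symmetric[of i "i + j - 1"] ij by simp
  finally show ?thesis .
qed

text \<open>The same at the pole of the second factor, where \<open>X = - \<delta>\<close>; hence
  the alternating sign.\<close>

lemma pfA_sum: "i \<ge> 1 \<Longrightarrow> j \<ge> 1 \<Longrightarrow> (\<Sum>a=1..i. pfA i j a * (- 1) ^ a) = pfB i j 0"
proof -
  assume ij: "i \<ge> 1" "j \<ge> 1"
  have "(\<Sum>a=1..i. pfA i j a * (- 1) ^ a) = (\<Sum>a=1..i. (- 1) ^ i * of_nat ((j + i - 1 - a) choose (j - 1)))"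
    by (rule sum.cong) (auto simp: pfA_def add.commute mult.commute mult.left_commute power_add[symmetric])
  also have "\<dots> = (- 1) ^ i * of_nat (\<Sum>a=1..i. (j + i - 1 - a) choose (j - 1))"
    by (simp add: sum_distrib_left)
  also have "\<dots> = pfB i j 0"
    unfolding hockey_stick[OF ij(2)] pfB_def using binomial_symmetric[of j "j + i - 1"] ij
      by (simp add: add.commute)
  finally show ?thesis .
qed

lemma rcp_prod: assumes "x \<noteq> 0" "x + D \<noteq> 0" "D \<noteq> 0" shows "rcp x * rcp (x + D) = rcp D * (rcp x - rcp (x + D))"
proof -
  have "of_int x \<noteq> (0::complex)" "of_int (x + D) \<noteq> (0::complex)" "of_int D \<noteq> (0::complex)" using assms
    by (simp_all del: of_int_add)
  then show ?thesis by (simp add: rcp_def field_simps)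
qed

lemma parity_class_shift: "bij_betw (\<lambda>x. x + D) (parity_class d) (parity_class (d + D))"
  by (rule bij_betwI[of _ _ _ "\<lambda>x. x - D"]) (auto simp: parity_class_def algebra_simps)

text \<open>\<open>odd (d + D)\<close> keeps the second pole out of the class. The terms of exponent
  1 are not summable by themselves, but their coefficients are opposite, so they form a difference
  with sum 0.\<close>

lemma two_factor_sum:
  assumes D: "D > 0" and odd: "odd (d + D)" and i: "i \<ge> 1" and j: "j \<ge> 1"
  shows "((\<lambda>x. rcp x ^ i * rcp (x + D) ^ j) has_sum
    ((\<Sum>a=0..i. pfA i j a * rcp D ^ (i + j - a) * parity_sum d a) + (\<Sum>b=1..j. pfB i j b * rcp D ^ (i +
      j - b) * parity_sum 1 b))) (parity_class d)"
proof -
  define A where "A a = pfA i j a * rcp D ^ (i + j - a)" for a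
  define B where "B b = pfB i j b * rcp D ^ (i + j - b)" for b
  define R where "R x = (\<Sum>a=1..i. A a * rcp x ^ a) + (\<Sum>b=1..j. B b * rcp (x + D) ^ b)" for x
  have R0: "R 0 = A 0"
  proof -
    have "R 0 = (\<Sum>b=1..j. B b * rcp D ^ b)" by (simp add: R_def)
    also have "\<dots> = (\<Sum>b=1..j. pfB i j b) * rcp D ^ (i + j)"
      unfolding sum_distrib_right by (rule sum.cong) (auto simp: B_def mult.assoc power_add[symmetric])
    finally show ?thesis unfolding pfB_sum[OF i j] by (simp add: A_def)
  qed
  have B1: "B 1 = - A 1"
  proof -
    obtain i' where i': "i = Suc i'" using i by (cases i) auto
    obtain j' where "j = Suc j'" using j by (cases j) auto
    with i' show ?thesis using binomial_symmetric[of i' "i' + j'"] by (simp add: A_def B_def pfA_def pfB_def)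
  qed
  have F: "rcp x ^ i * rcp (x + D) ^ j = R x + (if x = 0 then - R 0 else 0)" if x: "x \<in> parity_class d" for x
  proof (cases "x = 0")
    case True then show ?thesis using i by simp
  next
    case False
    have "x + D \<noteq> 0"
    proof
      assume "x + D = 0"
      then have "x = - D" by simp
      then show False using x odd by (auto simp: parity_class_def)
    qed
    then show ?thesis using partial_fraction[OF rcp_prod[OF False] i j] False D
      by (simp add: R_def A_def B_def)
  qed
  have R': "R x = A 1 * (rcp x - rcp (x + D)) + (\<Sum>a=2..i. A a * rcp x ^ a) + (\<Sum>b=2..j. B b * rcp (x +
    D) ^ b)" for x
    unfolding R_def using i j B1
    by (subst (1 2) sum.atLeast_Suc_atMost) (simp_all add: numeral_2_eq_2 algebra_simps)
  have sB: "((\<lambda>x. rcp (x + D) ^ b) has_sum parity_sum 1 b) (parity_class d)" if "b \<ge> 2" for b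
    using has_sum_reindex_bij_betw[OF parity_class_shift[of D d], of "\<lambda>x. rcp x ^ b"
      "parity_sum 1 b"] parity_class_pow_has_sum[OF that, of "d + D"] odd
    by (simp add: parity_sum_def)
  have "((\<lambda>x. A 1 * (rcp x - rcp (x + D)) + (\<Sum>a=2..i. A a * rcp x ^ a) + (\<Sum>b=2..j. B b * rcp (x +
    D) ^ b) + (if x = 0 then - R 0 else 0))
    has_sum (A 1 * 0 + (\<Sum>a=2..i. A a * parity_sum d a) + (\<Sum>b=2..j. B b * parity_sum 1 b) +
      (if 0 \<in> parity_class d then - R 0 else 0))) (parity_class d)"
    by (intro has_sum_add has_sum_cmult_right parity_class_rcp_diff_has_sum D has_sum_sum_finite
      parity_class_pow_has_sum sB has_sum_delta) auto
  moreover have "(if 0 \<in> parity_class d then - R 0 else 0) = A 0 * parity_sum d 0"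
    by (simp add: R0 parity_class_def parity_sum_def gammac_0 betac_0)
  moreover have "A 0 * parity_sum d 0 + (\<Sum>a=2..i. A a * parity_sum d a) + (\<Sum>b=2..j. B b * parity_sum 1 b) =
    (\<Sum>a=0..i. A a * parity_sum d a) + (\<Sum>b=1..j. B b * parity_sum 1 b)"
  proof -
    have "(\<Sum>a=0..i. A a * parity_sum d a) = A 0 * parity_sum d 0 + (A 1 * parity_sum d 1 +
      (\<Sum>a=2..i. A a * parity_sum d a))"
      using i by (subst sum.atLeast_Suc_atMost, simp,
        subst sum.atLeast_Suc_atMost) (simp_all add: numeral_2_eq_2)
    moreover have "(\<Sum>b=1..j. B b * parity_sum 1 b) = B 1 * parity_sum 1 1 + (\<Sum>b=2..j. B b * parity_sum 1 b)"
      using j by (subst sum.atLeast_Suc_atMost) (simp_all add: numeral_2_eq_2)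
    \<comment> \<open>With \<open>B 1 = - A 1\<close> this makes the two formal terms of exponent 1
      cancel, so they may be included although \<open>parity_sum\<close> is not a sum there.\<close>
    moreover have "parity_sum d 1 = parity_sum 1 1" using betac_1 by (simp add: parity_sum_def)
    ultimately show ?thesis using B1 by (simp add: algebra_simps)
  qed
  ultimately have "((\<lambda>x. R x + (if x = 0 then - R 0 else 0)) has_sum
     ((\<Sum>a=0..i. A a * parity_sum d a) + (\<Sum>b=1..j. B b * parity_sum 1 b))) (parity_class d)"
    unfolding R' by (simp add: algebra_simps)
  then show ?thesis unfolding A_def B_def
    by (rule has_sum_cong[THEN iffD1, rotated]) (simp only: F)
qed

text \<open>The first two factors are expanded, then each resulting power is paired with the third.
  Odd \<open>k\<close> never meets the poles 0 and \<open>- 2 N\<close>; only \<open>k = - N\<close>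
  can occur, for odd \<open>N\<close>.\<close>

lemma three_factor_sum:
  assumes N: "N > 0" and p: "p \<ge> 1" and q: "q \<ge> 1" and r: "r \<ge> 1"
  shows "((\<lambda>k. rcp k ^ p * rcp (k + N) ^ q * rcp (k + 2 * N) ^ r) has_sum
     ((\<Sum>i=0..p. pfA p q i * rcp N ^ (p + q - i) * (\<Sum>a=0..i. pfA i r a * rcp (2 * N) ^ (i +
       r - a) * parity_sum 1 a))
    + (\<Sum>i=1..p. pfA p q i * rcp N ^ (p + q - i) * (\<Sum>c=1..r. pfB i r c * rcp (2 * N) ^ (i +
      r - c) * parity_sum 1 c))
    + (\<Sum>j=0..q. pfB p q j * rcp N ^ (p + q - j) * (\<Sum>a=0..j. pfA j r a * rcp N ^ (j +
      r - a) * parity_sum (1 + N) a))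
    + (\<Sum>j=1..q. pfB p q j * rcp N ^ (p + q - j) * (\<Sum>c=1..r. pfB j r c * rcp N ^ (j +
      r - c) * parity_sum 1 c)))) (parity_class 1)"
proof -
  define a where "a i = pfA p q i * rcp N ^ (p + q - i)" for i
  define b where "b j = pfB p q j * rcp N ^ (p + q - j)" for j
  have G: "rcp k ^ p * rcp (k + N) ^ q * rcp (k + 2 * N) ^ r =
     (\<Sum>i=1..p. a i * (rcp k ^ i * rcp (k + 2 * N) ^ r)) + (\<Sum>j=1..q. b j * (rcp (k + N) ^ j * rcp (k +
       2 * N) ^ r))
     + (if k = - N then - (b 0 * rcp N ^ r) else 0)" if k: "k \<in> parity_class 1" for k
  proof -
    have "rcp k ^ p * rcp (k + N) ^ q = (\<Sum>i=1..p. a i * rcp k ^ i) + (\<Sum>j=1..q. b j * rcp (k + N) ^ j)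
     + (if k = - N then - b 0 else 0)"
    proof (cases "k = - N")
      case True
      have "(\<Sum>i=1..p. a i * rcp (- N) ^ i) = (\<Sum>i=1..p. pfA p q i * (- 1) ^ i) * rcp N ^ (p + q)"
        unfolding sum_distrib_right
      proof (rule sum.cong)
        fix i assume "i \<in> {1..p}"
        then have "rcp N ^ (p + q) = rcp N ^ (p + q - i) * rcp N ^ i" by (simp add: power_add[symmetric])
        then show "a i * rcp (- N) ^ i = pfA p q i * (- 1) ^ i * rcp N ^ (p + q)"
          by (simp add: a_def rcp_minus power_minus[of "rcp N"])
      qed simp
      then show ?thesis using True q unfolding pfA_sum[OF p q] by (simp add: b_def)
    next
      case False
      have "k \<noteq> 0" using k by (auto simp: parity_class_def)
      then show ?thesis using partial_fraction[OF rcp_prod[of k N] p q] False N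
        by (simp add: a_def b_def)
    qed
    then show ?thesis by (simp add: distrib_right sum_distrib_right mult.assoc)
  qed
  have U: "((\<lambda>k. rcp k ^ i * rcp (k + 2 * N) ^ r) has_sum
    ((\<Sum>a=0..i. pfA i r a * rcp (2 * N) ^ (i + r - a) * parity_sum 1 a) +
      (\<Sum>c=1..r. pfB i r c * rcp (2 * N) ^ (i + r - c) * parity_sum 1 c))) (parity_class 1)"
    if "i \<ge> 1" for i by (rule two_factor_sum) (use N r that in auto)
  have W: "((\<lambda>k. rcp (k + N) ^ j * rcp (k + 2 * N) ^ r) has_sum
    ((\<Sum>a=0..j. pfA j r a * rcp N ^ (j + r - a) * parity_sum (1 + N) a) +
      (\<Sum>c=1..r. pfB j r c * rcp N ^ (j + r - c) * parity_sum 1 c))) (parity_class 1)"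
    if "j \<ge> 1" for j
  proof -
    have "((\<lambda>k. rcp k ^ j * rcp (k + N) ^ r) has_sum
    ((\<Sum>a=0..j. pfA j r a * rcp N ^ (j + r - a) * parity_sum (1 + N) a) +
      (\<Sum>c=1..r. pfB j r c * rcp N ^ (j + r - c) * parity_sum 1 c))) (parity_class (1 + N))"
      by (rule two_factor_sum) (use N r that in auto)
    moreover have "k + N + N = k + 2 * N" for k by simp
    ultimately show ?thesis
      using has_sum_reindex_bij_betw[OF parity_class_shift[of N 1], of "\<lambda>k. rcp k ^ j * rcp (k + N) ^ r"]
        by (simp only:)
  qed
  \<comment> \<open>The correction at \<open>k = - N\<close> is exactly the missing term
    \<open>j = 0\<close> of the third sum; \<open>parity_sum (1 + N) 0\<close> is -1 or 0 according
    to whether \<open>N\<close> is odd or even.\<close>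
  have e1: "(if - N \<in> parity_class 1 then - (b 0 * rcp N ^ r) else 0) =
    b 0 * (\<Sum>a=0..0. pfA 0 r a * rcp N ^ (0 + r - a) * parity_sum (1 + N) a)"
    by (simp add: parity_class_def parity_sum_def gammac_0 betac_0 pfA_def)
  \<comment> \<open>The term \<open>i = 0\<close> is added for uniformity; it is 0 because
    \<open>betac 0 = 0\<close>.\<close>
  have e2: "(\<Sum>i=1..p. a i * (\<Sum>c=0..i. pfA i r c * rcp (2 * N) ^ (i + r - c) * parity_sum 1 c)) =
     (\<Sum>i=0..p. a i * (\<Sum>c=0..i. pfA i r c * rcp (2 * N) ^ (i + r - c) * parity_sum 1 c))"
    by (subst (2) sum.atLeast_Suc_atMost) (simp_all add: parity_sum_def betac_0)
  have e3: "(\<Sum>j=0..q. b j * (\<Sum>a=0..j. pfA j r a * rcp N ^ (j + r - a) * parity_sum (1 + N) a)) =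
    b 0 * (\<Sum>a=0..0. pfA 0 r a * rcp N ^ (0 + r - a) * parity_sum (1 + N) a) +
      (\<Sum>j=1..q. b j * (\<Sum>a=0..j. pfA j r a * rcp N ^ (j + r - a) * parity_sum (1 + N) a))"
    by (subst sum.atLeast_Suc_atMost) simp_all
  have total: "(\<Sum>i=1..p. a i * ((\<Sum>a=0..i. pfA i r a * rcp (2 * N) ^ (i + r - a) * parity_sum 1 a) +
    (\<Sum>c=1..r. pfB i r c * rcp (2 * N) ^ (i + r - c) * parity_sum 1 c)))
     + (\<Sum>j=1..q. b j * ((\<Sum>a=0..j. pfA j r a * rcp N ^ (j + r - a) * parity_sum (1 + N) a) +
       (\<Sum>c=1..r. pfB j r c * rcp N ^ (j + r - c) * parity_sum 1 c)))
     + (if - N \<in> parity_class 1 then - (b 0 * rcp N ^ r) else 0) =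
     (\<Sum>i=0..p. a i * (\<Sum>a=0..i. pfA i r a * rcp (2 * N) ^ (i + r - a) * parity_sum 1 a))
    + (\<Sum>i=1..p. a i * (\<Sum>c=1..r. pfB i r c * rcp (2 * N) ^ (i + r - c) * parity_sum 1 c))
    + (\<Sum>j=0..q. b j * (\<Sum>a=0..j. pfA j r a * rcp N ^ (j + r - a) * parity_sum (1 + N) a))
    + (\<Sum>j=1..q. b j * (\<Sum>c=1..r. pfB j r c * rcp N ^ (j + r - c) * parity_sum 1 c))"
    unfolding distrib_left sum.distrib e1 e2 e3 by (simp only: add_ac)
  have "((\<lambda>k. (\<Sum>i=1..p. a i * (rcp k ^ i * rcp (k + 2 * N) ^ r)) + (\<Sum>j=1..q. b j * (rcp (k +
    N) ^ j * rcp (k + 2 * N) ^ r))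
     + (if k = - N then - (b 0 * rcp N ^ r) else 0)) has_sum
     ((\<Sum>i=1..p. a i * ((\<Sum>a=0..i. pfA i r a * rcp (2 * N) ^ (i + r - a) * parity_sum 1 a) +
       (\<Sum>c=1..r. pfB i r c * rcp (2 * N) ^ (i + r - c) * parity_sum 1 c)))
     + (\<Sum>j=1..q. b j * ((\<Sum>a=0..j. pfA j r a * rcp N ^ (j + r - a) * parity_sum (1 + N) a) +
       (\<Sum>c=1..r. pfB j r c * rcp N ^ (j + r - c) * parity_sum 1 c)))
     + (if - N \<in> parity_class 1 then - (b 0 * rcp N ^ r) else 0))) (parity_class 1)"
    by (intro has_sum_add has_sum_cmult_right has_sum_sum_finite U W has_sum_delta) auto
  then have "((\<lambda>k. (\<Sum>i=1..p. a i * (rcp k ^ i * rcp (k + 2 * N) ^ r)) + (\<Sum>j=1..q. b j * (rcp (k +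
    N) ^ j * rcp (k + 2 * N) ^ r))
     + (if k = - N then - (b 0 * rcp N ^ r) else 0)) has_sum
     ((\<Sum>i=0..p. a i * (\<Sum>a=0..i. pfA i r a * rcp (2 * N) ^ (i + r - a) * parity_sum 1 a))
    + (\<Sum>i=1..p. a i * (\<Sum>c=1..r. pfB i r c * rcp (2 * N) ^ (i + r - c) * parity_sum 1 c))
    + (\<Sum>j=0..q. b j * (\<Sum>a=0..j. pfA j r a * rcp N ^ (j + r - a) * parity_sum (1 + N) a))
    + (\<Sum>j=1..q. b j * (\<Sum>c=1..r. pfB j r c * rcp N ^ (j + r - c) * parity_sum 1 c)))) (parity_class 1)"
    unfolding total .
  then show ?thesis unfolding a_def b_def
    by (rule has_sum_cong[THEN iffD1, rotated]) (simp only: G a_def b_def)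
qed

section \<open>The functional relation\<close>

lemma vector4 [simp]:
  "vec_nth (vector [a, b, c, d] :: complex^4) 1 = a" "vec_nth (vector [a, b, c, d] :: complex^4) 2 = b"
  "vec_nth (vector [a, b, c, d] :: complex^4) 3 = c" "vec_nth (vector [a, b, c, d] :: complex^4) 4 = d"
  unfolding vector_def by simp_all

lemma w_vector4: "wA (vector [a, b, c, d]) = b + c + d" "wB (vector [a, b, c, d]) = a + c + d"
  "wT (vector [a, b, c, d]) = a + b + c + d"
  by (simp_all add: wA_def wB_def wT_def)

definition lattice_term :: "nat \<Rightarrow> nat \<Rightarrow> nat \<Rightarrow> complex \<Rightarrow> nat \<times> int \<Rightarrow> complex" where
  "lattice_term p q r s = (\<lambda>(n,k). 1 / of_nat n powr s * (rcp k ^ p * rcp (k + int n) ^ q * rcp (k +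
    2 * int n) ^ r))"

lemma rcp_nat: "rcp (int m) = 1 / of_nat m" by (simp add: rcp_def divide_inverse)

lemma rcp_neg_nat: "rcp (- int m) = - (1 / of_nat m)" by (simp add: rcp_minus rcp_nat)

lemma powr_nat_exp: "(of_nat (Suc m) :: complex) powr of_nat k = of_nat (Suc m) ^ k"
  by (rule powr_nat') (simp del: of_nat_Suc)

text \<open>In each sector \<open>n\<close>, \<open>k\<close>, \<open>k + n\<close>,
  \<open>k + 2 n\<close> are, up to sign, a permutation of the four forms in \<open>m1\<close>,
  \<open>m2\<close>. The permutation gives the order of the exponents, and the negative ones among
  the last three give the power of -1.\<close>

lemma lattice_term_sectors:
  assumes "m1 \<ge> 1" "m2 \<ge> 1"
  shows "lattice_term p q r s (m2, int m1) = PSp2_term (vector [of_nat p, s, of_nat q, of_nat r]) (m1, m2)"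
    "lattice_term p q r s (m1 + m2, - int m1) = (- 1) ^ p * PSp2_term (vector [of_nat p, of_nat q, s,
      of_nat r]) (m1, m2)"
    "lattice_term p q r s (m1 + m2, - int (m1 + 2 * m2)) = (- 1) ^ (p + q) * PSp2_term (vector [of_nat r,
      of_nat q, s, of_nat p]) (m1, m2)"
    "lattice_term p q r s (m2, - int (m1 + 2 * m2)) = (- 1) ^ (p + q + r) * PSp2_term (vector [of_nat r,
      s, of_nat q, of_nat p]) (m1, m2)"
proof -
  have pw: "(of_nat k :: complex) powr of_nat j = of_nat k ^ j" if "k \<ge> 1" for j k
    using that powr_nat_exp[of "k - 1" j] by (simp del: of_nat_Suc)
  have ar: "int m1 + int m2 = int (m1 + m2)" "int m1 + 2 * int m2 = int (m1 + 2 * m2)"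
    "- int m1 + int (m1 + m2) = int m2" "- int m1 + 2 * int (m1 + m2) = int (m1 + 2 * m2)"
    "- int (m1 + 2 * m2) + int (m1 + m2) = - int m2" "- int (m1 + 2 * m2) + 2 * int (m1 + m2) = int m1"
    "- int (m1 + 2 * m2) + int m2 = - int (m1 + m2)" "- int (m1 + 2 * m2) + 2 * int m2 = - int m1" by simp_all
  note defs = lattice_term_def PSp2_term_def prod.case vector4 ar rcp_nat rcp_neg_nat
  have p: "(of_nat m1 :: complex) powr of_nat j = of_nat m1 ^ j" "(of_nat m2 :: complex) powr of_nat j =
    of_nat m2 ^ j"
    "(of_nat (m1 + m2) :: complex) powr of_nat j = of_nat (m1 + m2) ^ j" "(of_nat (m1 +
      2 * m2) :: complex) powr of_nat j = of_nat (m1 + 2 * m2) ^ j" for j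
    using assms by (intro pw; simp)+
  have mn: "(- x) ^ j = (- 1) ^ j * x ^ j" for x :: complex and j by (rule power_minus)
  show "lattice_term p q r s (m2, int m1) = PSp2_term (vector [of_nat p, s, of_nat q, of_nat r]) (m1, m2)"
    unfolding defs p by (simp add: power_divide power_inverse divide_inverse mult_ac del: of_nat_add of_nat_mult)
  show "lattice_term p q r s (m1 + m2, - int m1) = (- 1) ^ p * PSp2_term (vector [of_nat p, of_nat q, s,
    of_nat r]) (m1, m2)"
    unfolding defs p mn[of "1 / of_nat m1"]
      by (simp add: power_divide power_inverse divide_inverse mult_ac del: of_nat_add of_nat_mult)
  show "lattice_term p q r s (m1 + m2, - int (m1 + 2 * m2)) = (- 1) ^ (p +
    q) * PSp2_term (vector [of_nat r, of_nat q, s, of_nat p]) (m1, m2)"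
    unfolding defs p mn[of "1 / of_nat m2"] mn[of "1 / of_nat (m1 + 2 * m2)"] power_add
    by (simp add: power_divide power_inverse divide_inverse mult_ac del: of_nat_add of_nat_mult)
  show "lattice_term p q r s (m2, - int (m1 + 2 * m2)) = (- 1) ^ (p + q +
    r) * PSp2_term (vector [of_nat r, s, of_nat q, of_nat p]) (m1, m2)"
    unfolding defs p mn[of "1 / of_nat m1"] mn[of "1 / of_nat (m1 + m2)"] mn[of "1 / of_nat (m1 +
      2 * m2)"] power_add
    by (simp add: power_divide power_inverse divide_inverse mult_ac del: of_nat_add of_nat_mult)
qed

lemma lattice_term_has_sum:
  assumes "p \<ge> 1" "q \<ge> 1" "r \<ge> 1" and s: "Re s > 4"
  shows "(lattice_term p q r s has_sum
     (PSp2_zeta (vector [of_nat p, s, of_nat q, of_nat r])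
     + (-1) ^ p * PSp2_zeta (vector [of_nat p, of_nat q, s, of_nat r])
     + (-1) ^ (p + q) * PSp2_zeta (vector [of_nat r, of_nat q, s, of_nat p])
     + (-1) ^ (p + q + r) * PSp2_zeta (vector [of_nat r, s, of_nat q, of_nat p])))
     (Sigma {1..} (\<lambda>_. parity_class 1))"
proof -
  have has: "(PSp2_term z has_sum PSp2_zeta z) PSp2_index" if "z \<in> conv_dom" for z
    unfolding PSp2_zeta_continuation(1)[OF that]
    by (rule has_sum_infsum, rule Infinite_Sum.abs_summable_summable, rule PSp2_summable[OF that])
  have pqr: "real p \<ge> 1" "real q \<ge> 1" "real r \<ge> 1" using assms by auto
  have d: "vector [of_nat p, s, of_nat q, of_nat r] \<in> conv_dom" "vector [of_nat p, of_nat q, s,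
    of_nat r] \<in> conv_dom"
    "vector [of_nat r, of_nat q, s, of_nat p] \<in> conv_dom" "vector [of_nat r, s, of_nat q, of_nat p] \<in> conv_dom"
    unfolding conv_dom_def mem_Collect_eq w_vector4 using pqr s by auto
  define f1 where "f1 = (\<lambda>(m1 :: nat, m2 :: nat). (m2, int m1))"
  define f2 where "f2 = (\<lambda>(m1 :: nat, m2 :: nat). (m1 + m2, - int m1))"
  define f3 where "f3 = (\<lambda>(m1 :: nat, m2 :: nat). (m1 + m2, - int (m1 + 2 * m2)))"
  define f4 where "f4 = (\<lambda>(m1 :: nat, m2 :: nat). (m2, - int (m1 + 2 * m2)))"
  note fs = f1_def f2_def f3_def f4_def
  have sec: "(lattice_term p q r s has_sum (c * PSp2_zeta z)) (f ` PSp2_index)"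
    if "inj_on f PSp2_index" "\<And>m. m \<in> PSp2_index \<Longrightarrow> lattice_term p q r s (f m) = c * PSp2_term z m"
      "z \<in> conv_dom" for f c z
  proof -
    have "((\<lambda>m. lattice_term p q r s (f m)) has_sum (c * PSp2_zeta z)) PSp2_index"
      by (rule has_sum_cong[THEN iffD2, OF _ has_sum_cmult_right[OF has[OF that(3)]]]) (rule that(2))
    then show ?thesis by (subst has_sum_reindex[OF that(1)]) (simp add: o_def)
  qed
  have s1: "(lattice_term p q r s has_sum (1 * PSp2_zeta (vector [of_nat p, s, of_nat q,
    of_nat r]))) (f1 ` PSp2_index)"
    by (rule sec) (auto simp: inj_on_def PSp2_index_def f1_def lattice_term_sectors d(1))
  have s2: "(lattice_term p q r s has_sum ((-1) ^ p * PSp2_zeta (vector [of_nat p, of_nat q, s,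
    of_nat r]))) (f2 ` PSp2_index)"
    by (rule sec) (auto simp: inj_on_def PSp2_index_def f2_def lattice_term_sectors d(2) simp del: of_nat_add)
  have s3: "(lattice_term p q r s has_sum ((-1) ^ (p + q) * PSp2_zeta (vector [of_nat r, of_nat q, s,
    of_nat p]))) (f3 ` PSp2_index)"
    by (rule sec[OF _ _ d(3)]) (auto simp: inj_on_def PSp2_index_def f3_def lattice_term_sectors simp
      del: of_nat_add of_nat_mult)
  have s4: "(lattice_term p q r s has_sum ((-1) ^ (p + q + r) * PSp2_zeta (vector [of_nat r, s, of_nat q,
    of_nat p]))) (f4 ` PSp2_index)"
    by (rule sec[OF _ _ d(4)]) (auto simp: inj_on_def PSp2_index_def f4_def lattice_term_sectors simp
      del: of_nat_add of_nat_mult)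
  have rg: "snd x > 0" if "x \<in> f1 ` PSp2_index" for x using that by (auto simp: f1_def PSp2_index_def)
  have rg2: "- int (fst x) < snd x \<and> snd x < 0" if "x \<in> f2 ` PSp2_index" for x using that
    by (auto simp: f2_def PSp2_index_def)
  have rg3: "- 2 * int (fst x) < snd x \<and> snd x < - int (fst x)" if "x \<in> f3 ` PSp2_index" for x using that
    by (auto simp: f3_def PSp2_index_def)
  have rg4: "snd x < - 2 * int (fst x)" if "x \<in> f4 ` PSp2_index" for x using that
    by (auto simp: f4_def PSp2_index_def)
  have d12: "f1 ` PSp2_index \<inter> f2 ` PSp2_index = {}" using rg rg2 by (metis disjoint_iff order_less_asym)
  have d123: "(f1 ` PSp2_index \<union> f2 ` PSp2_index) \<inter> f3 ` PSp2_index = {}"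
  proof -
    have False if "x \<in> f1 ` PSp2_index \<union> f2 ` PSp2_index" "x \<in> f3 ` PSp2_index" for x
      using that rg[of x] rg2[of x] rg3[of x] by auto
    then show ?thesis by blast
  qed
  have d1234: "(f1 ` PSp2_index \<union> f2 ` PSp2_index \<union> f3 ` PSp2_index) \<inter> f4 ` PSp2_index = {}"
  proof -
    have False if "x \<in> f1 ` PSp2_index \<union> f2 ` PSp2_index \<union> f3 ` PSp2_index" "x \<in> f4 ` PSp2_index" for x
      using that rg[of x] rg2[of x] rg3[of x] rg4[of x] by auto
    then show ?thesis by blast
  qed
  define I where "I = f1 ` PSp2_index \<union> f2 ` PSp2_index \<union> f3 ` PSp2_index \<union> f4 ` PSp2_index"
  have "(lattice_term p q r s has_sum
     (1 * PSp2_zeta (vector [of_nat p, s, of_nat q, of_nat r])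
     + (-1) ^ p * PSp2_zeta (vector [of_nat p, of_nat q, s, of_nat r])
     + (-1) ^ (p + q) * PSp2_zeta (vector [of_nat r, of_nat q, s, of_nat p])
     + (-1) ^ (p + q + r) * PSp2_zeta (vector [of_nat r, s, of_nat q, of_nat p]))) I"
    unfolding I_def by (intro has_sum_Un_disjoint s1 s2 s3 s4 d12 d123 d1234)
  then show ?thesis unfolding mult_1_left
  proof (rule has_sum_cong_neutral[THEN iffD1, rotated -1])
    show "lattice_term p q r s x = 0" if x: "x \<in> Sigma {1..} (\<lambda>_. parity_class 1) - I" for x
    proof -
      obtain n k where nk: "x = (n,k)" "n \<ge> 1" "odd k" using x by (auto simp: parity_class_def)
      have inI: "y \<in> PSp2_index" if "y = (nat m1, nat m2)" "m1 > 0" "m2 > 0" "odd m1" for y m1 m2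
      proof -
        have "odd (nat m1)" using that by (simp add: even_nat_iff)
        then show ?thesis using that by (auto simp: PSp2_index_def odd_iff_mod_2_eq_one)
      qed
      have "k = - int n"
      proof (rule ccontr)
        assume ne: "k \<noteq> - int n"
        have k0: "k \<noteq> 0" "k \<noteq> - 2 * int n" using nk(3) by auto
        consider "k > 0" | "- int n < k" "k < 0" | "- 2 * int n < k" "k < - int n" | "k < - 2 * int n"
          using ne k0 by linarith
        then have "x \<in> I"
        proof cases
          case 1
          have "f1 (nat k, nat (int n)) = x" using 1 nk by (simp add: f1_def)
          moreover have "(nat k, nat (int n)) \<in> PSp2_index" by (rule inI[OF refl]) (use 1 nk in auto)
          ultimately show ?thesis unfolding I_def by blast
        next
          case 2
          have "f2 (nat (- k), nat (int n + k)) = x" using 2 nk by (simp add: f2_def nat_add_distrib[symmetric])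
          moreover have "(nat (- k), nat (int n + k)) \<in> PSp2_index" by (rule inI[OF refl]) (use 2 nk in auto)
          ultimately show ?thesis unfolding I_def by blast
        next
          case 3
          have "f3 (nat (k + 2 * int n), nat (- k - int n)) = x" using 3 nk
            by (simp add: f3_def nat_add_distrib[symmetric])
          moreover have "(nat (k + 2 * int n), nat (- k - int n)) \<in> PSp2_index" by (rule inI[OF refl])
            (use 3 nk in auto)
          ultimately show ?thesis unfolding I_def by blast
        next
          case 4
          have "f4 (nat (- k - 2 * int n), nat (int n)) = x" using 4 nk by (simp add: f4_def)
          moreover have "(nat (- k - 2 * int n), nat (int n)) \<in> PSp2_index" by (rule inI[OF refl])
            (use 4 nk in auto)
          ultimately show ?thesis unfolding I_def by blast
        qed
        then show False using x by simp
      qed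
      \<comment> \<open>The pairs with odd \<open>k\<close> outside the sectors have
        \<open>k = - n\<close>; there the summand is 0 by \<open>rcp 0 = 0\<close> and
        \<open>q \<ge> 1\<close>.\<close>
      then show ?thesis using nk assms(2) by (simp add: lattice_term_def)
    qed
    have "I \<subseteq> Sigma {1..} (\<lambda>_. parity_class 1)"
      unfolding I_def by (auto simp: fs PSp2_index_def parity_class_def odd_iff_mod_2_eq_one) presburger+
    then show "lattice_term p q r s x = 0" if "x \<in> I - Sigma {1..} (\<lambda>_. parity_class 1)" for x using that
      by blast
  qed auto
qed

lemma zeta_has_sum:
  assumes "Re w > 1"
  shows "((\<lambda>n. 1 / of_nat n powr w) has_sum riemann_zeta w) {1..}"
proof -
  have i: "inj Suc" by simp
  have r: "range Suc = {1..}" by (auto simp: image_iff) (metis Suc_le_D)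
  have "((\<lambda>n. 1 / of_nat (Suc n) powr w) has_sum riemann_zeta w) UNIV"
    unfolding riemann_zeta_properties(1)[OF assms]
    by (rule norm_summable_imp_has_sum[OF zetaser_summable[OF assms] summable_sums[OF
      summable_norm_cancel[OF zetaser_summable[OF assms]]]])
  then show ?thesis unfolding r[symmetric] by (subst has_sum_reindex[OF i]) (simp add: o_def)
qed

lemma zeta_even_has_sum:
  assumes "Re w > 1"
  shows "((\<lambda>n. if even n then 1 / of_nat n powr w else 0) has_sum (2 powr (- w) * riemann_zeta w)) {1..}"
proof -
  have "((\<lambda>n. 1 / of_nat (2 * n) powr w) has_sum (2 powr (- w) * riemann_zeta w)) {1..}"
  proof (rule has_sum_cong[THEN iffD2, OF _ has_sum_cmult_right[OF zeta_has_sum[OF assms]]])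
    fix n :: nat
    show "1 / of_nat (2 * n) powr w = 2 powr (- w) * (1 / of_nat n powr w)"
      using powr_times_real[of 2 "of_nat n" w] by (simp add: powr_minus divide_inverse)
  qed
  then have "((\<lambda>n. 1 / of_nat n powr w) has_sum (2 powr (- w) * riemann_zeta w)) ((\<lambda>n. 2 * n) ` {1..})"
    by (subst has_sum_reindex) (auto simp: o_def inj_on_def)
  then show ?thesis
    by (rule has_sum_cong_neutral[THEN iffD1, rotated -1]) (auto elim!: evenE simp: image_iff)
qed

text \<open>Alternating sums arise because the parity class of \<open>k + n\<close>, for odd
  \<open>k\<close>, depends on the parity of \<open>n\<close>.\<close>

lemma zeta_alt_has_sum:
  assumes "Re w > 1"
  shows "((\<lambda>n. (- 1) ^ n * (1 / of_nat n powr w)) has_sum ((2 powr (1 - w) - 1) * riemann_zeta w)) {1..}"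
proof -
  have "((\<lambda>n. 2 * (if even n then 1 / of_nat n powr w else 0) + (- 1) * (1 / of_nat n powr w)) has_sum
    (2 * (2 powr (- w) * riemann_zeta w) + (- 1) * riemann_zeta w)) {1..}"
    by (intro has_sum_add has_sum_cmult_right zeta_has_sum zeta_even_has_sum assms)
  moreover have "2 * (if even n then 1 / of_nat n powr w else 0) + (- 1) * (1 / of_nat n powr w) =
    (- 1) ^ n * (1 / of_nat n powr w)" for n
    by (simp add: minus_one_power_iff)
  moreover have "2 * (2 powr (- w) * riemann_zeta w) + (- 1) * riemann_zeta w =
    (2 powr (1 - w) - 1) * riemann_zeta w"
    by (simp add: powr_diff powr_minus divide_inverse algebra_simps)
  ultimately show ?thesis by (simp only:)
qed

section \<open>The sum over odd k at fixed n, and the relation for large real part of s\<close>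

text \<open>The four Bernoulli sums with free families \<open>x\<close>, \<open>y\<close> in place
  of the zeta values. Being linear in them, the expression serves both at fixed \<open>n\<close>,
  with plain and alternating negative powers of \<open>n\<close>, and after summation over
  \<open>n\<close>.\<close>

definition bernoulli_terms :: "nat \<Rightarrow> nat \<Rightarrow> nat \<Rightarrow> (nat \<Rightarrow> complex) \<Rightarrow> (nat \<Rightarrow> complex) \<Rightarrow> complex" where
  "bernoulli_terms p q r x y =
    (\<Sum>\<xi>=0..p. \<Sum>\<omega>=0..p - \<xi>. of_nat ((\<omega> + r - 1) choose \<omega>) * of_nat ((p + q - 1 - \<xi> - \<omega>) choose (q - 1))
       * ((-1) ^ (p - \<xi>) / 2 ^ (r + \<omega>)) * (betac \<xi> * x \<xi>))
    + (\<Sum>\<xi>=0..q. \<Sum>\<omega>=0..q - \<xi>. of_nat ((\<omega> + r - 1) choose \<omega>) * of_nat ((p + q - 1 - \<xi> - \<omega>) choose (p - 1))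
       * ((-1) ^ p * (-1) ^ \<omega>) * ((betac \<xi> + gammac \<xi>) / 2 * x \<xi> - (gammac \<xi> - betac \<xi>) / 2 * y \<xi>))
    + (\<Sum>\<xi>=0..r. \<Sum>\<omega>=0..p - 1. of_nat ((\<omega> + r - \<xi>) choose \<omega>) * of_nat ((p + q - 2 - \<omega>) choose (q - 1))
       * ((-1) ^ p / 2 ^ (r - \<xi> + \<omega> + 1)) * (betac \<xi> * x \<xi>))
    + (\<Sum>\<xi>=0..r. \<Sum>\<omega>=0..q - 1. of_nat ((\<omega> + r - \<xi>) choose \<omega>) * of_nat ((p + q - 2 - \<omega>) choose (p - 1))
       * (- ((-1) ^ p * (-1) ^ \<omega>)) * (betac \<xi> * x \<xi>))"

lemma has_sum_diff':
  fixes f g :: "'a \<Rightarrow> complex"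
  assumes "(f has_sum a) A" "(g has_sum b) A"
  shows "((\<lambda>x. f x - g x) has_sum (a - b)) A"
proof -
  have "((\<lambda>x. - g x) has_sum - b) A" using assms(2) by (simp add: has_sum_uminus)
  from has_sum_add[OF assms(1) this] show ?thesis by simp
qed

lemma bernoulli_terms_has_sum:
  assumes x: "\<And>\<xi>. \<xi> \<le> max p (max q r) \<Longrightarrow> ((\<lambda>n. x n \<xi>) has_sum X \<xi>) A"
    and y: "\<And>\<xi>. \<xi> \<le> max p (max q r) \<Longrightarrow> ((\<lambda>n. y n \<xi>) has_sum Y \<xi>) A"
  shows "((\<lambda>n. bernoulli_terms p q r (x n) (y n)) has_sum bernoulli_terms p q r X Y) A"
  unfolding bernoulli_terms_def
  by (intro has_sum_add has_sum_sum_finite has_sum_cmult_right has_sum_diff' x y) auto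

lemma sum_triangle:
  fixes F :: "nat \<Rightarrow> nat \<Rightarrow> complex"
  shows "(\<Sum>i=0..m. \<Sum>a=0..i. F i a) = (\<Sum>a=0..m. \<Sum>b=0..m - a. F (a + b) a)"
proof -
  have "(\<Sum>i=0..m. \<Sum>a=0..i. F i a) = (\<Sum>(i,a)\<in>Sigma {0..m} (\<lambda>i. {0..i}). F i a)" by (rule sum.Sigma) auto
  also have "\<dots> = (\<Sum>(a,b)\<in>Sigma {0..m} (\<lambda>a. {0..m - a}). F (a + b) a)"
    by (rule sum.reindex_bij_witness[where j="\<lambda>(i,a). (a, i - a)" and i="\<lambda>(a,b). (a + b, a)"]) auto
  also have "\<dots> = (\<Sum>a=0..m. \<Sum>b=0..m - a. F (a + b) a)" by (rule sum.Sigma[symmetric]) auto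
  finally show ?thesis .
qed

lemma sum_rectangle:
  fixes F :: "nat \<Rightarrow> nat \<Rightarrow> complex"
  assumes "m \<ge> 1" "\<And>i. F i 0 = 0"
  shows "(\<Sum>i=1..m. \<Sum>c=1..r. F i c) = (\<Sum>c=0..r. \<Sum>b=0..m - 1. F (Suc b) c)"
proof -
  have "(\<Sum>c=1..r. F i c) = (\<Sum>c=0..r. F i c)" for i
    using assms(2) by (simp add: sum.atLeast_Suc_atMost[of 0 r])
  then have "(\<Sum>i=1..m. \<Sum>c=1..r. F i c) = (\<Sum>c=0..r. \<Sum>i=1..m. F i c)" by (simp only:) (rule sum.swap)
  also have "\<dots> = (\<Sum>c=0..r. \<Sum>b=0..m - 1. F (Suc b) c)"
    using assms(1) sum.shift_bounds_cl_Suc_ivl[of "\<lambda>i. F i _" 0 "m - 1"] by simp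
  finally show ?thesis .
qed

text \<open>\<open>three_factor_sum\<close> in the indices of the theorem: \<open>\<xi>\<close> is
  the exponent of the power sum, and the outer index is \<open>\<xi> + \<omega>\<close> in its first
  and third sum, \<open>\<omega> + 1\<close> in its second and fourth.\<close>

lemma sum_over_parity_class:
  assumes n: "n \<ge> 1" and p: "p \<ge> 1" and q: "q \<ge> 1" and r: "r \<ge> 1"
  shows "((\<lambda>k. lattice_term p q r s (n, k)) has_sum
     - bernoulli_terms p q r (\<lambda>\<xi>. 1 / of_nat n powr (s + of_nat p + of_nat q + of_nat r - of_nat \<xi>))
         (\<lambda>\<xi>. (- 1) ^ n * (1 / of_nat n powr (s + of_nat p + of_nat q + of_nat r - of_nat \<xi>)))) (parity_class 1)"
proof -
  define e where "e \<xi> = 1 / (of_nat n :: complex) powr (s + of_nat p + of_nat q + of_nat r - of_nat \<xi>)" for \<xi>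
  define c where "c = 1 / (of_nat n :: complex) powr s"
  have n0: "(of_nat n :: complex) \<noteq> 0" using n by simp
  \<comment> \<open>Homogeneity: in every term the powers of \<open>1 / n\<close> add up to
    \<open>p + q + r - \<xi>\<close>.\<close>
  have ee: "c * (rcp (int n) ^ a * rcp (int n) ^ b) = e \<xi>" if "a + b + \<xi> = p + q + r" for a b \<xi>
  proof -
    have "s + of_nat p + of_nat q + of_nat r - of_nat \<xi> = s + of_nat (a + b)"
    proof -
      have "(of_nat p + of_nat q + of_nat r :: complex) = of_nat (a + b) + of_nat \<xi>"
        unfolding of_nat_add[symmetric] that ..
      then show ?thesis by (simp add: algebra_simps del: of_nat_add)
    qed
    moreover have "(of_nat n :: complex) powr of_nat (a + b) = of_nat n ^ (a + b)"
      using powr_nat_exp[of "n - 1" "a + b"] n by (simp del: of_nat_Suc of_nat_add)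
    ultimately show ?thesis using n0
      unfolding e_def c_def rcp_nat power_add[symmetric]
        by (simp only:) (simp add: powr_add power_divide del: of_nat_add)
  qed
  have iv2: "rcp (2 * int n) ^ m = rcp (int n) ^ m / 2 ^ m" for m
  proof -
    have "rcp (2 * int n) = rcp (int n) / 2" by (simp add: rcp_def)
    then show ?thesis by (simp only: power_divide)
  qed
  have sc1: "parity_sum 1 a = - betac a" for a by (simp add: parity_sum_def)
  have sgn: "(-1 :: complex) ^ (p - (\<xi> + \<omega>)) * (-1) ^ \<omega> = (-1) ^ (p - \<xi>)" if "\<xi> + \<omega> \<le> p" for \<xi> \<omega>
  proof -
    have "p - (\<xi> + \<omega>) + \<omega> = p - \<xi>" using that by simp
    then show ?thesis unfolding power_add[symmetric] by (rule arg_cong)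
  qed
  have sgn': "(-1 :: complex) ^ (p - Suc \<omega>) * (-1) ^ Suc \<omega> = (-1) ^ p" if "\<omega> \<le> p - 1" for \<omega>
  proof -
    have "p - Suc \<omega> + Suc \<omega> = p" using that p by simp
    then show ?thesis unfolding power_add[symmetric] by (rule arg_cong)
  qed
  have ch: "(\<omega> + r - 1) choose (r - 1) = (\<omega> + r - 1) choose \<omega>" for \<omega>
    using binomial_symmetric[of "r - 1" "\<omega> + r - 1"] r by simp
  \<comment> \<open>\<open>parity_sum (1 + int n)\<close> is \<open>- betac\<close> for even and
    \<open>- gammac\<close> for odd \<open>n\<close>; writing it as a mean plus
    \<open>(- 1) ^ n\<close> times half the difference produces the alternating zeta values.\<close>
  have sc2: "parity_sum (1 + int n) \<xi> * e \<xi> = - ((betac \<xi> +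
    gammac \<xi>) / 2 * e \<xi> - (gammac \<xi> - betac \<xi>) / 2 * ((- 1) ^ n * e \<xi>))" for \<xi>
    
  proof -
    have "parity_sum (1 + int n) \<xi> = - ((betac \<xi> + gammac \<xi>) / 2 - (gammac \<xi> - betac \<xi>) / 2 * (- 1) ^ n)"
      by (cases "even n") (simp_all add: parity_sum_def minus_one_power_iff flip: add_divide_distrib
        diff_divide_distrib)
    then show ?thesis by (simp only: mult_minus_left left_diff_distrib mult.assoc)
  qed
  have t1: "c * (\<Sum>i=0..p. pfA p q i * rcp (int n) ^ (p +
    q - i) * (\<Sum>a=0..i. pfA i r a * rcp (2 * int n) ^ (i + r - a) * parity_sum 1 a))
    = - (\<Sum>\<xi>=0..p. \<Sum>\<omega>=0..p - \<xi>. of_nat ((\<omega> + r - 1) choose \<omega>) * of_nat ((p + q - 1 - \<xi> - \<omega>) choose (q - 1))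
       * ((-1) ^ (p - \<xi>) / 2 ^ (r + \<omega>)) * (betac \<xi> * e \<xi>))"
    unfolding sum_distrib_left sum_triangle sum_negf[symmetric]
  proof (intro sum.cong refl)
    fix \<xi> \<omega> assume "\<xi> \<in> {0..p}" "\<omega> \<in> {0..p - \<xi>}"
    then have le: "\<xi> + \<omega> \<le> p" by auto
    have A: "\<xi> + \<omega> + r - \<xi> = r + \<omega>" "\<xi> + \<omega> - \<xi> = \<omega>" "\<xi> + \<omega> + r - 1 - \<xi> = \<omega> + r - 1" "p + q - 1 - (\<xi> +
      \<omega>) = p + q - 1 - \<xi> - \<omega>" using r by auto
    have "c * (pfA p q (\<xi> + \<omega>) * rcp (int n) ^ (p + q - (\<xi> + \<omega>)) * (pfA (\<xi> +
      \<omega>) r \<xi> * rcp (2 * int n) ^ (\<xi> + \<omega> + r - \<xi>) * parity_sum 1 \<xi>))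
      = - (of_nat ((\<omega> + r - 1) choose \<omega>) * of_nat ((p + q - 1 - \<xi> - \<omega>) choose (q - 1))
       * (((-1) ^ (p - (\<xi> + \<omega>)) * (-1) ^ \<omega>) / 2 ^ (r + \<omega>)) * (betac \<xi> * (c * (rcp (int n) ^ (p + q - (\<xi> +
         \<omega>)) * rcp (int n) ^ (r + \<omega>)))))"
      unfolding pfA_def A ch iv2 sc1 by simp
    also have "c * (rcp (int n) ^ (p + q - (\<xi> + \<omega>)) * rcp (int n) ^ (r + \<omega>)) = e \<xi>" by (rule ee) (use le in simp)
    finally show "c * (pfA p q (\<xi> + \<omega>) * rcp (int n) ^ (p + q - (\<xi> + \<omega>)) * (pfA (\<xi> +
      \<omega>) r \<xi> * rcp (2 * int n) ^ (\<xi> + \<omega> + r - \<xi>) * parity_sum 1 \<xi>))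
      = - (of_nat ((\<omega> + r - 1) choose \<omega>) * of_nat ((p + q - 1 - \<xi> - \<omega>) choose (q - 1))
       * ((-1) ^ (p - \<xi>) / 2 ^ (r + \<omega>)) * (betac \<xi> * e \<xi>))" unfolding sgn[OF le] .
  qed
  have t2: "c * (\<Sum>i=1..p. pfA p q i * rcp (int n) ^ (p +
    q - i) * (\<Sum>c=1..r. pfB i r c * rcp (2 * int n) ^ (i + r - c) * parity_sum 1 c))
    = - (\<Sum>\<xi>=0..r. \<Sum>\<omega>=0..p - 1. of_nat ((\<omega> + r - \<xi>) choose \<omega>) * of_nat ((p + q - 2 - \<omega>) choose (q - 1))
       * ((-1) ^ p / 2 ^ (r - \<xi> + \<omega> + 1)) * (betac \<xi> * e \<xi>))"
    unfolding sum_distrib_left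
  proof (subst sum_rectangle[OF p], simp add: sc1 betac_0, unfold sum_negf[symmetric], intro sum.cong refl)
    fix \<xi> \<omega> assume "\<xi> \<in> {0..r}" "\<omega> \<in> {0..p - 1}"
    then have le: "\<xi> \<le> r" "\<omega> \<le> p - 1" by auto
    have A: "Suc \<omega> + r - \<xi> = r - \<xi> + \<omega> + 1" "Suc \<omega> + r - 1 - \<xi> = \<omega> + r - \<xi>" "Suc \<omega> - 1 = \<omega>"
      "p + q - 1 - Suc \<omega> = p + q - 2 - \<omega>" using le r by auto
    have "c * (pfA p q (Suc \<omega>) * rcp (int n) ^ (p +
      q - Suc \<omega>) * (pfB (Suc \<omega>) r \<xi> * rcp (2 * int n) ^ (Suc \<omega> + r - \<xi>) * parity_sum 1 \<xi>))
      = - (of_nat ((\<omega> + r - \<xi>) choose \<omega>) * of_nat ((p + q - 2 - \<omega>) choose (q - 1))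
       * (((-1) ^ (p - Suc \<omega>) * (-1) ^ Suc \<omega>) / 2 ^ (r - \<xi> + \<omega> +
         1)) * (betac \<xi> * (c * (rcp (int n) ^ (p + q - Suc \<omega>) * rcp (int n) ^ (r - \<xi> + \<omega> + 1)))))"
      unfolding pfA_def pfB_def A iv2 sc1 by simp
    also have "c * (rcp (int n) ^ (p + q - Suc \<omega>) * rcp (int n) ^ (r - \<xi> + \<omega> + 1)) = e \<xi>" by (rule ee)
      (use le p in simp)
    finally show "c * (pfA p q (Suc \<omega>) * rcp (int n) ^ (p +
      q - Suc \<omega>) * (pfB (Suc \<omega>) r \<xi> * rcp (2 * int n) ^ (Suc \<omega> + r - \<xi>) * parity_sum 1 \<xi>))
      = - (of_nat ((\<omega> + r - \<xi>) choose \<omega>) * of_nat ((p + q - 2 - \<omega>) choose (q - 1))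
       * ((-1) ^ p / 2 ^ (r - \<xi> + \<omega> + 1)) * (betac \<xi> * e \<xi>))" unfolding sgn'[OF le(2)] .
  qed
  have t3: "c * (\<Sum>j=0..q. pfB p q j * rcp (int n) ^ (p +
    q - j) * (\<Sum>a=0..j. pfA j r a * rcp (int n) ^ (j + r - a) * parity_sum (1 + int n) a))
    = - (\<Sum>\<xi>=0..q. \<Sum>\<omega>=0..q - \<xi>. of_nat ((\<omega> + r - 1) choose \<omega>) * of_nat ((p + q - 1 - \<xi> - \<omega>) choose (p - 1))
       * ((-1) ^ p * (-1) ^ \<omega>) * ((betac \<xi> + gammac \<xi>) / 2 * e \<xi> - (gammac \<xi> - betac \<xi>) / 2 * ((- 1) ^ n
         * e \<xi>)))"
    unfolding sum_distrib_left sum_triangle sum_negf[symmetric]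
  proof (intro sum.cong refl)
    fix \<xi> \<omega> assume "\<xi> \<in> {0..q}" "\<omega> \<in> {0..q - \<xi>}"
    then have le: "\<xi> + \<omega> \<le> q" by auto
    have A: "\<xi> + \<omega> + r - \<xi> = r + \<omega>" "\<xi> + \<omega> - \<xi> = \<omega>" "\<xi> + \<omega> + r - 1 - \<xi> = \<omega> + r - 1" "p + q - 1 - (\<xi> +
      \<omega>) = p + q - 1 - \<xi> - \<omega>" using r by auto
    have "c * (pfB p q (\<xi> + \<omega>) * rcp (int n) ^ (p + q - (\<xi> + \<omega>)) * (pfA (\<xi> + \<omega>) r \<xi> * rcp (int n) ^ (\<xi> +
      \<omega> + r - \<xi>) * parity_sum (1 + int n) \<xi>))
      = (of_nat ((\<omega> + r - 1) choose \<omega>) * of_nat ((p + q - 1 - \<xi> - \<omega>) choose (p - 1))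
       * ((-1) ^ p * (-1) ^ \<omega>) * (parity_sum (1 + int n) \<xi> * (c * (rcp (int n) ^ (p + q - (\<xi> +
         \<omega>)) * rcp (int n) ^ (r + \<omega>)))))"
      unfolding pfA_def pfB_def A ch by simp
    also have "c * (rcp (int n) ^ (p + q - (\<xi> + \<omega>)) * rcp (int n) ^ (r + \<omega>)) = e \<xi>" by (rule ee) (use le in simp)
    finally show "c * (pfB p q (\<xi> + \<omega>) * rcp (int n) ^ (p + q - (\<xi> + \<omega>)) * (pfA (\<xi> +
      \<omega>) r \<xi> * rcp (int n) ^ (\<xi> + \<omega> + r - \<xi>) * parity_sum (1 + int n) \<xi>))
      = - (of_nat ((\<omega> + r - 1) choose \<omega>) * of_nat ((p + q - 1 - \<xi> - \<omega>) choose (p - 1))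
       * ((-1) ^ p * (-1) ^ \<omega>) * ((betac \<xi> + gammac \<xi>) / 2 * e \<xi> - (gammac \<xi> - betac \<xi>) / 2 * ((- 1) ^ n
         * e \<xi>)))"
      unfolding sc2 mult_minus_right .
  qed
  have t4: "c * (\<Sum>j=1..q. pfB p q j * rcp (int n) ^ (p +
    q - j) * (\<Sum>c=1..r. pfB j r c * rcp (int n) ^ (j + r - c) * parity_sum 1 c))
    = - (\<Sum>\<xi>=0..r. \<Sum>\<omega>=0..q - 1. of_nat ((\<omega> + r - \<xi>) choose \<omega>) * of_nat ((p + q - 2 - \<omega>) choose (p - 1))
       * (- ((-1) ^ p * (-1) ^ \<omega>)) * (betac \<xi> * e \<xi>))"
    unfolding sum_distrib_left
  proof (subst sum_rectangle[OF q], simp add: sc1 betac_0, unfold sum_negf[symmetric], intro sum.cong refl)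
    fix \<xi> \<omega> assume "\<xi> \<in> {0..r}" "\<omega> \<in> {0..q - 1}"
    then have le: "\<xi> \<le> r" "\<omega> \<le> q - 1" by auto
    have A: "Suc \<omega> + r - \<xi> = r - \<xi> + \<omega> + 1" "Suc \<omega> + r - 1 - \<xi> = \<omega> + r - \<xi>" "Suc \<omega> - 1 = \<omega>"
      "p + q - 1 - Suc \<omega> = p + q - 2 - \<omega>" using le r by auto
    have "c * (pfB p q (Suc \<omega>) * rcp (int n) ^ (p + q - Suc \<omega>) * (pfB (Suc \<omega>) r \<xi> * rcp (int n) ^ (Suc \<omega>
      + r - \<xi>) * parity_sum 1 \<xi>))
      = - (of_nat ((\<omega> + r - \<xi>) choose \<omega>) * of_nat ((p + q - 2 - \<omega>) choose (p - 1))
       * (- ((-1) ^ p * (-1) ^ \<omega>)) * (betac \<xi> * (c * (rcp (int n) ^ (p +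
         q - Suc \<omega>) * rcp (int n) ^ (r - \<xi> + \<omega> + 1)))))"
      unfolding pfB_def A sc1 by simp
    also have "c * (rcp (int n) ^ (p + q - Suc \<omega>) * rcp (int n) ^ (r - \<xi> + \<omega> + 1)) = e \<xi>" by (rule ee)
      (use le q in simp)
    finally show "c * (pfB p q (Suc \<omega>) * rcp (int n) ^ (p +
      q - Suc \<omega>) * (pfB (Suc \<omega>) r \<xi> * rcp (int n) ^ (Suc \<omega> + r - \<xi>) * parity_sum 1 \<xi>))
      = - (of_nat ((\<omega> + r - \<xi>) choose \<omega>) * of_nat ((p + q - 2 - \<omega>) choose (p - 1))
       * (- ((-1) ^ p * (-1) ^ \<omega>)) * (betac \<xi> * e \<xi>))" .
  qed
  have N: "int n > 0" using n by simp
  have "((\<lambda>k. lattice_term p q r s (n, k)) has_sum c *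
     ((\<Sum>i=0..p. pfA p q i * rcp (int n) ^ (p + q - i) * (\<Sum>a=0..i. pfA i r a * rcp (2 * int n) ^ (i +
       r - a) * parity_sum 1 a))
    + (\<Sum>i=1..p. pfA p q i * rcp (int n) ^ (p + q - i) * (\<Sum>c=1..r. pfB i r c * rcp (2 * int n) ^ (i +
      r - c) * parity_sum 1 c))
    + (\<Sum>j=0..q. pfB p q j * rcp (int n) ^ (p + q - j) * (\<Sum>a=0..j. pfA j r a * rcp (int n) ^ (j +
      r - a) * parity_sum (1 + int n) a))
    + (\<Sum>j=1..q. pfB p q j * rcp (int n) ^ (p + q - j) * (\<Sum>c=1..r. pfB j r c * rcp (int n) ^ (j +
      r - c) * parity_sum 1 c)))) (parity_class 1)"
    unfolding lattice_term_def prod.case c_def[symmetric]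
      by (rule has_sum_cmult_right[OF three_factor_sum[OF N p q r]])
  then show ?thesis unfolding distrib_left t1 t2 t3 t4 e_def[symmetric] bernoulli_terms_def
    by (simp only: minus_add_distrib ac_simps)
qed

text \<open>One double sum evaluated twice: by the four sectors, and by first summing over
  \<open>k\<close> for each \<open>n\<close>.\<close>

lemma identity_convergent:
  assumes p: "p \<ge> 1" and q: "q \<ge> 1" and r: "r \<ge> 1" and s: "Re s > 4"
  shows "PSp2_zeta (vector [of_nat p, s, of_nat q, of_nat r])
     + (-1) ^ p * PSp2_zeta (vector [of_nat p, of_nat q, s, of_nat r])
     + (-1) ^ (p + q) * PSp2_zeta (vector [of_nat r, of_nat q, s, of_nat p])
     + (-1) ^ (p + q + r) * PSp2_zeta (vector [of_nat r, s, of_nat q, of_nat p])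
     + bernoulli_terms p q r (\<lambda>\<xi>. riemann_zeta (s + of_nat p + of_nat q + of_nat r - of_nat \<xi>))
        (\<lambda>\<xi>. (2 powr (1 - (s + of_nat p + of_nat q + of_nat r - of_nat \<xi>)) - 1)
           * riemann_zeta (s + of_nat p + of_nat q + of_nat r - of_nat \<xi>)) = 0"
    (is "?Z + ?L = 0")
proof -
  have 1: "((\<lambda>n. - bernoulli_terms p q r (\<lambda>\<xi>. 1 / of_nat n powr (s + of_nat p + of_nat q + of_nat r - of_nat \<xi>))
         (\<lambda>\<xi>. (- 1) ^ n * (1 / of_nat n powr (s + of_nat p + of_nat q +
           of_nat r - of_nat \<xi>)))) has_sum ?Z) {1..}"
    by (rule has_sum_SigmaD[OF lattice_term_has_sum[OF p q r s] sum_over_parity_class[OF _ p q r]]) auto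
  have re: "Re (s + of_nat p + of_nat q + of_nat r - of_nat \<xi>) > 1" if "\<xi> \<le> max p (max q r)" for \<xi>
  proof -
    have "real \<xi> \<le> real p + real q + real r" using that by linarith
    then show ?thesis using s by simp
  qed
  have 2: "((\<lambda>n. - bernoulli_terms p q r (\<lambda>\<xi>. 1 / of_nat n powr (s + of_nat p + of_nat q + of_nat r - of_nat \<xi>))
         (\<lambda>\<xi>. (- 1) ^ n * (1 / of_nat n powr (s + of_nat p + of_nat q +
           of_nat r - of_nat \<xi>)))) has_sum - ?L) {1..}"
    unfolding has_sum_uminus minus_minus by (intro bernoulli_terms_has_sum zeta_has_sum zeta_alt_has_sum re)
  show ?thesis using has_sum_unique[OF 1 2] by simp
qed

section \<open>Continuation of the relation in s\<close>

text \<open>Clearing denominators gives a holomorphic function that vanishes on \<open>W\<close>,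
  hence on \<open>O1\<close>. So the relation holds where \<open>D\<close> is not 0, in particular
  on a punctured neighbourhood of \<open>s0\<close>; continuity at \<open>s0\<close> closes the gap
  even if \<open>D s0 = 0\<close>.\<close>

lemma quotient_identity:
  fixes F G H :: "'i \<Rightarrow> complex \<Rightarrow> complex"
  assumes I: "finite I" and O: "open O1" "connected O1" "s0 \<in> O1"
    and hol: "\<And>i. i \<in> I \<Longrightarrow> G i holomorphic_on O1" "\<And>i. i \<in> I \<Longrightarrow> H i holomorphic_on O1" "L holomorphic_on O1"
    and FG: "\<And>i s. i \<in> I \<Longrightarrow> s \<in> O1 \<Longrightarrow> H i s \<noteq> 0 \<Longrightarrow> F i s = G i s / H i s"
    and W: "open W" "W \<noteq> {}" "W \<subseteq> O1" "\<And>i s. i \<in> I \<Longrightarrow> s \<in> W \<Longrightarrow> H i s \<noteq> 0"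
      "\<And>s. s \<in> W \<Longrightarrow> (\<Sum>i\<in>I. F i s) + L s = 0"
    and cont: "\<And>i. i \<in> I \<Longrightarrow> isCont (F i) s0"
  shows "(\<Sum>i\<in>I. F i s0) + L s0 = 0"
proof -
  define D where "D s = (\<Prod>i\<in>I. H i s)" for s
  define N where "N s = (\<Sum>i\<in>I. G i s * (\<Prod>j\<in>I - {i}. H j s)) + L s * D s" for s
  define E where "E s = (\<Sum>i\<in>I. F i s) + L s" for s
  have D_hol: "D holomorphic_on O1" unfolding D_def by (intro holomorphic_intros hol)
  have N_hol: "N holomorphic_on O1" unfolding N_def by (intro holomorphic_intros hol D_hol) auto
  have ND: "N s = E s * D s" if "s \<in> O1" "D s \<noteq> 0" for s
  proof -
    have nz: "H i s \<noteq> 0" if "i \<in> I" for i using \<open>D s \<noteq> 0\<close> that I by (auto simp: D_def)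
    have "G i s * (\<Prod>j\<in>I - {i}. H j s) = F i s * D s" if "i \<in> I" for i
    proof -
      have "D s = H i s * (\<Prod>j\<in>I - {i}. H j s)" unfolding D_def by (rule prod.remove[OF I \<open>i \<in> I\<close>])
      moreover have "G i s = F i s * H i s" using FG[OF \<open>i \<in> I\<close> \<open>s \<in> O1\<close> nz] nz that by simp
      ultimately show ?thesis by simp
    qed
    then show ?thesis unfolding N_def E_def by (simp add: sum_distrib_right distrib_right)
  qed
  have DW: "D s \<noteq> 0" if "s \<in> W" for s using W(4) that I by (simp add: D_def)
  have N0: "N s = 0" if "s \<in> O1" for s
  proof (rule analytic_continuation_open[OF W(1) O(1) W(2) O(2) W(3) N_hol, of "\<lambda>_. 0"])
    show "N s = 0" if "s \<in> W" for s
      using ND[of s] DW[OF that] W(3,5) that by (auto simp: E_def)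
  qed (use that in auto)
  obtain w where w: "w \<in> W" using W(2) by blast
  have "eventually (\<lambda>s. D s \<noteq> 0 \<and> s \<in> O1) (at s0)"
    by (rule non_zero_neighbour_alt[OF D_hol O, of w]) (use w W(3) DW in auto)
  then have "eventually (\<lambda>s. E s = 0) (at s0)"
    by (rule eventually_mono) (use N0 ND in force)
  then have "(E \<longlongrightarrow> 0) (at s0)" by (rule tendsto_eventually)
  moreover have "isCont E s0" unfolding E_def
    using hol(3) O by (intro continuous_intros cont) (auto simp: holomorphic_on_open intro: DERIV_isCont)
  then have "(E \<longlongrightarrow> E s0) (at s0)" by (simp add: isCont_def)
  ultimately have "E s0 = 0" by (metis tendsto_unique trivial_limit_at)
  then show ?thesis by (simp add: E_def)
qed

lemma bernoulli_terms_eq: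
  fixes p q r :: nat and s :: complex
  defines "w \<equiv> \<lambda>\<xi>. s + of_nat p + of_nat q + of_nat r - of_nat \<xi>"
  shows "bernoulli_terms p q r (\<lambda>\<xi>. riemann_zeta (w \<xi>)) (\<lambda>\<xi>. (2 powr (1 - w \<xi>) - 1) * riemann_zeta (w \<xi>)) =
    (\<Sum>\<xi>=0..p. \<Sum>\<omega>=0..p - \<xi>.
          of_nat ((\<omega> + r - 1) choose \<omega>) * of_nat ((p + q - 1 - \<xi> - \<omega>) choose (q - 1))
          * ((-1) ^ (p - \<xi>) / 2 ^ (r + \<omega>))
          * ((2 * of_real pi * \<i>) ^ \<xi> / fact \<xi>)
          * riemann_zeta (s + of_nat p + of_nat q + of_nat r - of_nat \<xi>)
          * ((bernoulli_poly \<xi> 0 - bernoulli_poly \<xi> (1 / 2)) / 2))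
     + (\<Sum>\<xi>=0..q. \<Sum>\<omega>=0..q - \<xi>.
          of_nat ((\<omega> + r - 1) choose \<omega>) * of_nat ((p + q - 1 - \<xi> - \<omega>) choose (p - 1))
          * (-1) powi (int p - int \<omega>)
          * ((2 * of_real pi * \<i>) ^ \<xi> / fact \<xi>)
          * riemann_zeta (s + of_nat p + of_nat q + of_nat r - of_nat \<xi>)
          * ((bernoulli_poly \<xi> 0
              - (2 powr (1 - s - of_nat p - of_nat q - of_nat r + of_nat \<xi>) - 1)
                * bernoulli_poly \<xi> (1 / 2)) / 2))
     + (\<Sum>\<xi>=0..r. \<Sum>\<omega>=0..p - 1.
          of_nat ((\<omega> + r - \<xi>) choose \<omega>) * of_nat ((p + q - 2 - \<omega>) choose (q - 1))
          * ((-1) ^ p / 2 ^ (r - \<xi> + \<omega> + 1))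
          * ((2 * of_real pi * \<i>) ^ \<xi> / fact \<xi>)
          * riemann_zeta (s + of_nat p + of_nat q + of_nat r - of_nat \<xi>)
          * ((bernoulli_poly \<xi> 0 - bernoulli_poly \<xi> (1 / 2)) / 2))
     + (\<Sum>\<xi>=0..r. \<Sum>\<omega>=0..q - 1.
          of_nat ((\<omega> + r - \<xi>) choose \<omega>) * of_nat ((p + q - 2 - \<omega>) choose (p - 1))
          * (-1) powi (int p - int \<omega> + 1)
          * ((2 * of_real pi * \<i>) ^ \<xi> / fact \<xi>)
          * riemann_zeta (s + of_nat p + of_nat q + of_nat r - of_nat \<xi>)
          * ((bernoulli_poly \<xi> 0 - bernoulli_poly \<xi> (1 / 2)) / 2))"
proof -
  \<comment> \<open>\<open>\<omega>\<close> may exceed \<open>p\<close>, hence the integer exponents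
    of -1.\<close>
  have sg: "(-1 :: complex) powi (int p - int \<omega>) = (-1) ^ p * (-1) ^ \<omega>" for \<omega>
    by (simp add: power_int_diff field_simps flip: power_mult_distrib)
  have sg': "(-1 :: complex) powi (int p - int \<omega> + 1) = - ((-1) ^ p * (-1) ^ \<omega>)" for \<omega>
    by (simp add: power_int_add sg)
  have w: "1 - s - of_nat p - of_nat q - of_nat r + of_nat \<xi> = 1 - w \<xi>" for \<xi> by (simp add: w_def)
  have ws: "s + of_nat p + of_nat q + of_nat r - of_nat \<xi> = w \<xi>" for \<xi> by (simp add: w_def)
  have b: "betac \<xi> * x = (2 * of_real pi * \<i>) ^ \<xi> / fact \<xi> * x * ((bernoulli_poly \<xi> 0 - bernoulli_poly \<xi>
    (1 / 2)) / 2)" for \<xi> x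
    by (simp only: betac_def mult_ac)
  have bg: "(betac \<xi> + gammac \<xi>) / 2 * x - (gammac \<xi> - betac \<xi>) / 2 * (y * x)
    = (2 * of_real pi * \<i>) ^ \<xi> / fact \<xi> * x * ((bernoulli_poly \<xi> 0 - y * bernoulli_poly \<xi> (1 / 2)) / 2)"
      for \<xi> x y
    unfolding betac_def gammac_def by (simp add: field_simps)
  show ?thesis unfolding bernoulli_terms_def sg sg' w unfolding ws b bg by (simp only: mult.assoc)
qed

theorem theorem5p26:
  fixes p q r :: nat and s :: complex
  assumes "p \<ge> 1" and "q \<ge> 1" and "r \<ge> 1"
    and "regular_at PSp2_zeta (vector [of_nat p, s, of_nat q, of_nat r])"
    and "regular_at PSp2_zeta (vector [of_nat p, of_nat q, s, of_nat r])"
    and "regular_at PSp2_zeta (vector [of_nat r, of_nat q, s, of_nat p])"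
    and "regular_at PSp2_zeta (vector [of_nat r, s, of_nat q, of_nat p])"
    and "\<And>\<xi>. \<xi> \<le> max p (max q r) \<Longrightarrow>
           s + of_nat p + of_nat q + of_nat r - of_nat \<xi> \<noteq> 1"
  shows
    "PSp2_zeta (vector [of_nat p, s, of_nat q, of_nat r])
     + (-1) ^ p * PSp2_zeta (vector [of_nat p, of_nat q, s, of_nat r])
     + (-1) ^ (p + q) * PSp2_zeta (vector [of_nat r, of_nat q, s, of_nat p])
     + (-1) ^ (p + q + r) * PSp2_zeta (vector [of_nat r, s, of_nat q, of_nat p])
     + (\<Sum>\<xi>=0..p. \<Sum>\<omega>=0..p - \<xi>.
          of_nat ((\<omega> + r - 1) choose \<omega>) * of_nat ((p + q - 1 - \<xi> - \<omega>) choose (q - 1))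
          * ((-1) ^ (p - \<xi>) / 2 ^ (r + \<omega>))
          * ((2 * of_real pi * \<i>) ^ \<xi> / fact \<xi>)
          * riemann_zeta (s + of_nat p + of_nat q + of_nat r - of_nat \<xi>)
          * ((bernoulli_poly \<xi> 0 - bernoulli_poly \<xi> (1 / 2)) / 2))
     + (\<Sum>\<xi>=0..q. \<Sum>\<omega>=0..q - \<xi>.
          of_nat ((\<omega> + r - 1) choose \<omega>) * of_nat ((p + q - 1 - \<xi> - \<omega>) choose (p - 1))
          * (-1) powi (int p - int \<omega>)
          * ((2 * of_real pi * \<i>) ^ \<xi> / fact \<xi>)
          * riemann_zeta (s + of_nat p + of_nat q + of_nat r - of_nat \<xi>)
          * ((bernoulli_poly \<xi> 0
              - (2 powr (1 - s - of_nat p - of_nat q - of_nat r + of_nat \<xi>) - 1)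
                * bernoulli_poly \<xi> (1 / 2)) / 2))
     + (\<Sum>\<xi>=0..r. \<Sum>\<omega>=0..p - 1.
          of_nat ((\<omega> + r - \<xi>) choose \<omega>) * of_nat ((p + q - 2 - \<omega>) choose (q - 1))
          * ((-1) ^ p / 2 ^ (r - \<xi> + \<omega> + 1))
          * ((2 * of_real pi * \<i>) ^ \<xi> / fact \<xi>)
          * riemann_zeta (s + of_nat p + of_nat q + of_nat r - of_nat \<xi>)
          * ((bernoulli_poly \<xi> 0 - bernoulli_poly \<xi> (1 / 2)) / 2))
     + (\<Sum>\<xi>=0..r. \<Sum>\<omega>=0..q - 1.
          of_nat ((\<omega> + r - \<xi>) choose \<omega>) * of_nat ((p + q - 2 - \<omega>) choose (p - 1))
          * (-1) powi (int p - int \<omega> + 1)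
          * ((2 * of_real pi * \<i>) ^ \<xi> / fact \<xi>)
          * riemann_zeta (s + of_nat p + of_nat q + of_nat r - of_nat \<xi>)
          * ((bernoulli_poly \<xi> 0 - bernoulli_poly \<xi> (1 / 2)) / 2))
     = 0"
proof -
  define w where "w t \<xi> = t + of_nat p + of_nat q + of_nat r - of_nat \<xi>" for t :: complex and \<xi> :: nat
  define L where "L t = bernoulli_terms p q r (\<lambda>\<xi>. riemann_zeta (w t \<xi>)) (\<lambda>\<xi>. (2 powr (1 - w t \<xi>) - 1) *
    riemann_zeta (w t \<xi>))" for t
  define z :: "nat \<Rightarrow> complex \<Rightarrow> complex^4" where "z i t = [vector [of_nat p, t, of_nat q, of_nat r],
    vector [of_nat p, of_nat q, t, of_nat r],
    vector [of_nat r, of_nat q, t, of_nat p], vector [of_nat r, t, of_nat q, of_nat p]] ! i" for i t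
  define c :: "nat \<Rightarrow> complex" where "c i = [1, (-1) ^ p, (-1) ^ (p + q), (-1) ^ (p + q + r)] ! i" for i
  \<comment> \<open>The variable sits in coordinate 2 or 3, so the four curves are complex lines in
    direction \<open>ax 2\<close> or \<open>ax 3\<close>.\<close>
  define v :: "nat \<Rightarrow> complex^4" where "v i = [ax 2, ax 3, ax 3, ax 2] ! i" for i
  have four: "(\<Sum>i\<in>{..<4}. f i) = f 0 + f 1 + f 2 + f 3" for f :: "nat \<Rightarrow> complex"
    by (simp add: eval_nat_numeral)
  have cases4: "P i" if "i \<in> {..<4}" "P 0" "P 1" "P 2" "P 3" for P and i :: nat
  proof -
    have "i = 0 \<or> i = 1 \<or> i = 2 \<or> i = 3" using that(1) by auto
    then show ?thesis using that by auto
  qed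
  define b where "b i = z i 0" for i
  have zv: "z i t = b i + t *s v i" if "i \<in> {..<4}" for i t
    by (rule cases4[OF that]) (simp_all add: b_def z_def v_def vec_eq_iff forall_4 ax_nth)
  \<comment> \<open>On these lines a form is either \<open>t\<close> plus at least two of
    \<open>p\<close>, \<open>q\<close>, \<open>r\<close>, or the constant \<open>p + q + r\<close>,
    which is at least 3; the bound \<open>min (Re t) 1 + 2\<close> covers both.\<close>
  have Wz: "Re (wA (z i t)) \<ge> min (Re t) 1 + 2 \<and> Re (wB (z i t)) \<ge> min (Re t) 1 + 2 \<and>
    Re (wT (z i t)) \<ge> min (Re t) 1 + 2" if "i \<in> {..<4}" for i t
    by (rule cases4[OF that]) (use assms(1-3) in \<open>auto simp: z_def w_vector4 min_def\<close>)
  \<comment> \<open>Large enough for the four lines to stay in the domain of the quotient as long as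
    \<open>Re t > Re s - 1\<close>.\<close>
  define n where "n = nat \<lceil>\<bar>Re s\<bar>\<rceil> + 10"
  have n: "real n \<ge> \<bar>Re s\<bar> + 10" unfolding n_def by linarith
  obtain h g where denominator: "denominator h" and g: "\<And>z. z \<in> halfspaces (real n) (real n) (real n) \<Longrightarrow>
    holo_at g z"
    and gh: "\<And>z. z \<in> halfspaces (real n) (real n) (real n) \<Longrightarrow> h z \<noteq> 0 \<Longrightarrow> PSp2_zeta z = g z / h z"
    using PSp2_zeta_continuation(2)[of n] by blast
  \<comment> \<open>The finitely many \<open>t\<close> at which the argument of some zeta value is
    the pole 1; deleting them keeps the half-plane connected.\<close>
  define X where "X = (\<lambda>\<xi>. 1 - of_nat p - of_nat q - of_nat r + of_nat \<xi> :: complex) ` {..max p (max q r)}"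
  define O1 where "O1 = {t. Re t > Re s - 1} - X"
  have zA: "z i t \<in> halfspaces (real n) (real n) (real n)" if "i \<in> {..<4}" "t \<in> O1" for i t
    using Wz[OF that(1), of t] that(2) n unfolding halfspaces_def O1_def by (auto simp: min_def split: if_splits)
  have w1: "w t \<xi> \<noteq> 1" if "t \<in> O1" "\<xi> \<le> max p (max q r)" for t \<xi>
  proof
    assume "w t \<xi> = 1"
    then have "t = 1 - of_nat p - of_nat q - of_nat r + of_nat \<xi>" unfolding w_def by (simp add: algebra_simps)
    then show False using that unfolding O1_def X_def by blast
  qed
  have O1: "open O1" "connected O1"
  proof -
    have "finite X" by (simp add: X_def)
    moreover have "open {t. Re t > Re s - 1}" by (rule open_halfspace_Re_gt)
    moreover have "connected {t. Re t > Re s - 1}" by (intro convex_connected convex_halfspace_Re_gt)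
    ultimately show "open O1" "connected O1"
      unfolding O1_def by (auto intro!: open_Diff finite_imp_closed connected_open_delete_finite)
  qed
  have sO: "s \<in> O1"
  proof -
    have "s \<notin> X"
    proof
      assume "s \<in> X"
      then obtain \<xi> where x: "\<xi> \<le> max p (max q r)" "s = 1 - of_nat p - of_nat q - of_nat r + of_nat \<xi>"
        unfolding X_def by blast
      have "s + of_nat p + of_nat q + of_nat r - of_nat \<xi> = 1" unfolding x(2) by simp
      then show False using assms(8)[OF x(1)] by simp
    qed
    then show ?thesis by (simp add: O1_def)
  qed
  define W where "W = {t. Re t > \<bar>Re s\<bar> + 4}"
  have W: "open W" "W \<noteq> {}" "W \<subseteq> O1"
  proof -
    show "open W" unfolding W_def by (rule open_halfspace_Re_gt)
    have "of_real (\<bar>Re s\<bar> + 5) \<in> W" by (simp add: W_def)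
    then show "W \<noteq> {}" by blast
    have "Re t \<le> 1" if t: "t \<in> X" for t
    proof -
      obtain \<xi> where x: "\<xi> \<le> max p (max q r)" "t = 1 - of_nat p - of_nat q - of_nat r + of_nat \<xi>" using t
        unfolding X_def by blast
      have "real \<xi> \<le> real p + real q + real r" using x(1) by linarith
      then show ?thesis unfolding x(2) by simp
    qed
    then show "W \<subseteq> O1" by (force simp: W_def O1_def)
  qed
  have zeta_hol: "(\<lambda>t. riemann_zeta (w t \<xi>)) holomorphic_on O1" if "\<xi> \<le> max p (max q r)" for \<xi>
  proof -
    have "riemann_zeta \<circ> (\<lambda>t. w t \<xi>) holomorphic_on O1"
      by (rule holomorphic_on_compose_gen[OF _ riemann_zeta_properties(2)])
         (use w1[OF _ that] in \<open>auto simp: w_def intro!: holomorphic_intros\<close>)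
    then show ?thesis by (simp add: o_def)
  qed
  have L_hol: "L holomorphic_on O1"
    unfolding L_def bernoulli_terms_def
    by (intro holomorphic_intros zeta_hol) (auto simp: w_def intro!: holomorphic_intros)
  have hol: "(\<lambda>t. f (z i t)) holomorphic_on O1" if "i \<in> {..<4}" "\<And>t. t \<in> O1 \<Longrightarrow> holo_at f (z i t)" for f i
    unfolding zv[OF that(1)] by (rule holo_at_line_holomorphic) (use that in \<open>simp add: zv[OF that(1)]\<close>)
  have "(\<Sum>i\<in>{..<4}. c i * PSp2_zeta (z i s)) + L s = 0"
  proof (rule quotient_identity[where G = "\<lambda>i t. c i * g (z i t)" and H = "\<lambda>i t. h (z i t)"
    and W = W, OF _ O1 sO])
    fix i :: nat assume i: "i \<in> {..<4}"
    show "(\<lambda>t. c i * g (z i t)) holomorphic_on O1" by (intro holomorphic_intros hol[OF i] g zA[OF i])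
    show "(\<lambda>t. h (z i t)) holomorphic_on O1" by (intro hol[OF i] denominator_holo_at[OF denominator])
    show "c i * PSp2_zeta (z i t) = c i * g (z i t) / h (z i t)" if "t \<in> O1" "h (z i t) \<noteq> 0" for t
      using gh[OF zA[OF i that(1)] that(2)] by simp
    \<comment> \<open>On \<open>W\<close> all three forms have real part above 2, so no factor with
      \<open>c \<ge> -2\<close> can vanish.\<close>
    show "h (z i t) \<noteq> 0" if "t \<in> W" for t
    proof (rule denominator_nonzero_real[OF denominator])
      have Re_nz: "u + of_real x \<noteq> 0" if "Re u > 2" "x \<ge> - 2" for u x
        using that by (auto simp: complex_eq_iff)
      have W3: "Re (wA (z i t)) > 2" "Re (wB (z i t)) > 2" "Re (wT (z i t)) > 2"
        using Wz[OF i, of t] \<open>t \<in> W\<close> by (auto simp: W_def min_def split: if_splits)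
      show "wA (z i t) + of_real x \<noteq> 0" "wB (z i t) + of_real x \<noteq> 0" "wT (z i t) + of_real x \<noteq> 0"
        if "x \<ge> - 2" for x
        by (intro Re_nz W3 that)+
    qed
    \<comment> \<open>Regularity makes \<open>PSp2_zeta\<close> continuous at the four points, which
      carries the relation to \<open>s\<close> itself.\<close>
    have "regular_at PSp2_zeta (z i s)" by (rule cases4[OF i]) (use assms(4-7) in \<open>simp_all add: z_def\<close>)
    then have "isCont PSp2_zeta (z i s)" unfolding regular_at_iff using holo_at_isCont by blast
    moreover have "isCont (z i) s"
      unfolding zv[OF i, abs_def] by (rule continuous_on_interior[OF isCont_cline[of UNIV]]) simp
    ultimately show "isCont (\<lambda>t. c i * PSp2_zeta (z i t)) s"
      by (intro continuous_intros) (rule isCont_o2)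
  next
    fix t assume t: "t \<in> W"
    then show "(\<Sum>i\<in>{..<4}. c i * PSp2_zeta (z i t)) + L t = 0"
      using identity_convergent[OF assms(1-3), of t] unfolding four
      by (simp add: z_def c_def L_def w_def W_def)
  qed (use W L_hol in auto)
  then show ?thesis unfolding four L_def w_def bernoulli_terms_eq
    by (simp add: z_def c_def add.assoc)
qed

end
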